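(* Let $\frac53<\alpha<2$, $\frac2{3-\alpha}\le q<3$, let $g:[x',x'']\to\mathbb R$ be continuous and of bounded $q$-variation, and let $Z_x=(L_t^x,g(x))$, $x\in[x',x'']$, where $L_t^x$ is the local time of a symmetric $\alpha$-stable process, so that $Z$ is a continuous path satisfying $E|Z_b-Z_a|^\theta\le c\,\mathbf w_1(a,b)^{h\theta}$ for all $(a,b)\in\Delta$. Let $\mathbf Z(m)^2$ be the second level of the smooth rough paths associated with $Z$ as in the context. Then there exists a unique $\mathbf Z^2$ on the simplex $\Delta$ taking values in $\mathbb R^2\otimes\mathbb R^2$ such that $$\sup_D\Big(\sum_l\big|\mathbf Z(m)^2_{x_{l-1},x_l}-\mathbf Z^2_{x_{l-1},x_l}\big|^{\theta/2}\Big)^{2/\theta}\to0$$ both almost surely and in $L^1(\Omega,\mathcal F,P)$ as $m\to\infty$, for some $\theta$ such that $\frac4{2h+\alpha-1}<\theta<3$. Here $\sup_D$ is over all finite partitions $D=\{x_l\}$ of $[x',x'']$.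
   Context: $X$ is a real-valued symmetric $\alpha$-stable process, $t\ge0$ is fixed, and $L_t^x$ is its jointly continuous local time (occupation density: $\int_0^t\varphi(X_s)ds=\int\varphi(x)L_t^xdx$). $[x',x'']$ is a fixed compact interval and $\Delta=\{(a,b):x'\le a\le b\le x''\}$. A function has bounded $q$-variation if $\sup\sum|g(x_i)-g(x_{i-1})|^q<\infty$ over finite partitions. A control is a continuous $\mathbf w:\Delta\to[0,\infty)$ with $\mathbf w(a,a)=0$ and $\mathbf w(a,b)+\mathbf w(b,c)\le\mathbf w(a,c)$. Fix a control $\mathbf w$ with $|g(b)-g(a)|^q\le\mathbf w(a,b)$ and put $\mathbf w_1(a,b)=\mathbf w(a,b)+(b-a)$, $\mathbf w_1(x)=\mathbf w_1(x',x)$. Fix $p\in(\frac2{\alpha-1},3)$, put $\hat q=\max\{p,q\}$, $h=1/\hat q>\frac13$; throughout $\theta>\hat q$, i.e. $h\theta>1$. For $m\in\mathbb N$ let $x'=x_0^m<x_1^m<\dots<x_{2^m}^m=x''$ be the partition with $\mathbf w_1(x_l^m)-\mathbf w_1(x_{l-1}^m)=2^{-m}\mathbf w_1(x',x'')$, let $\Delta_l^mZ=Z_{x_l^m}-Z_{x_{l-1}^m}$, and define the continuous bounded variation path $$Z(m)_x=Z_{x_{l-1}^m}+\frac{\mathbf w_1(x)-\mathbf w_1(x_{l-1}^m)}{\mathbf w_1(x_l^m)-\mathbf w_1(x_{l-1}^m)}\Delta_l^mZ,\qquad x_{l-1}^m\le x\le x_l^m .$$ For $(a,b)\in\Delta$,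 $\mathbf Z(m)^2_{a,b}=\int_{a<u_1<u_2<b}dZ(m)_{u_1}\otimes dZ(m)_{u_2}$. *)

theory Defs
  imports "HOL-Probability.Probability"
begin

definition Delta :: "real \<Rightarrow> real \<Rightarrow> (real \<times> real) set" where
  "Delta xl xr = {(a, b). xl \<le> a \<and> a \<le> b \<and> b \<le> xr}"

text \<open>A finite partition \<open>a = x\<^sub>0 \<le> \<dots> \<le> x\<^sub>n = b\<close> is encoded as the pair \<open>(n, x)\<close>; the values
  of \<open>x\<close> beyond \<open>n\<close> are irrelevant. Repeated points do not affect the variation of a path, but they
  let \<open>level2_dist\<close> below see the diagonal, where the second level of a path vanishes.\<close>

definition partitions :: "real \<Rightarrow> real \<Rightarrow> (nat \<times> (nat \<Rightarrow> real)) set" where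
  "partitions a b = {(n, x). x 0 = a \<and> x n = b \<and> (\<forall>l\<in>{1..n}. x (l - 1) \<le> x l)}"

definition bounded_q_variation :: "real \<Rightarrow> (real \<Rightarrow> real) \<Rightarrow> real \<Rightarrow> real \<Rightarrow> bool" where
  "bounded_q_variation q g a b \<longleftrightarrow>
     bdd_above ((\<lambda>(n, x). \<Sum>l=1..n. \<bar>g (x l) - g (x (l - 1))\<bar> powr q) ` partitions a b)"

definition control :: "real \<Rightarrow> real \<Rightarrow> (real \<Rightarrow> real \<Rightarrow> real) \<Rightarrow> bool" where
  "control xl xr w \<longleftrightarrow>
     continuous_on (Delta xl xr) (\<lambda>(a, b). w a b) \<and>
     (\<forall>(a, b)\<in>Delta xl xr. 0 \<le> w a b) \<and>
     (\<forall>a\<in>{xl..xr}. w a a = 0) \<and>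
     (\<forall>a b c. xl \<le> a \<and> a \<le> b \<and> b \<le> c \<and> c \<le> xr \<longrightarrow> w a b + w b c \<le> w a c)"

text \<open>Symmetric stable process: a cadlag process with stationary independent increments, started
  at a deterministic point, whose increments have characteristic function
  \<open>exp (- \<sigma> (t - s) \<bar>u\<bar>\<^sup>\<alpha>)\<close>. The scale \<open>\<sigma> > 0\<close> and the starting point are arbitrary.\<close>

definition symmetric_stable_process :: "'a measure \<Rightarrow> real \<Rightarrow> (real \<Rightarrow> 'a \<Rightarrow> real) \<Rightarrow> bool" where
  "symmetric_stable_process M \<alpha> X \<longleftrightarrow>
     (\<forall>t\<ge>0. X t \<in> borel_measurable M) \<and>
     (\<exists>x\<^sub>0. AE \<omega> in M. X 0 \<omega> = x\<^sub>0) \<and>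
     (\<forall>n s. 0 \<le> s 0 \<and> (\<forall>i<n. s i \<le> s (Suc i)) \<longrightarrow>
        prob_space.indep_vars M (\<lambda>_. borel) (\<lambda>i \<omega>. X (s (Suc i)) \<omega> - X (s i) \<omega>) {..<n::nat}) \<and>
     (\<exists>\<sigma>>0. \<forall>s t u. 0 \<le> s \<and> s \<le> t \<longrightarrow>
        char (distr M borel (\<lambda>\<omega>. X t \<omega> - X s \<omega>)) u
          = complex_of_real (exp (- \<sigma> * (t - s) * \<bar>u\<bar> powr \<alpha>))) \<and>
     (AE \<omega> in M. \<forall>t\<ge>0. continuous (at_right t) (\<lambda>s. X s \<omega>) \<and>
        (0 < t \<longrightarrow> (\<exists>l. ((\<lambda>s. X s \<omega>) \<longlongrightarrow> l) (at_left t))))"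

text \<open>Here \<open>L t x\<close> is the local time at level \<open>x\<close> up to time \<open>t\<close>.\<close>

definition jointly_continuous_local_time ::
    "'a measure \<Rightarrow> (real \<Rightarrow> 'a \<Rightarrow> real) \<Rightarrow> (real \<Rightarrow> real \<Rightarrow> 'a \<Rightarrow> real) \<Rightarrow> bool" where
  "jointly_continuous_local_time M X L \<longleftrightarrow>
     (\<forall>t\<ge>0. \<forall>x. L t x \<in> borel_measurable M) \<and>
     (AE \<omega> in M. \<forall>t\<ge>0. \<forall>x. 0 \<le> L t x \<omega>) \<and>
     (AE \<omega> in M. continuous_on ({0..} \<times> UNIV) (\<lambda>(t, x). L t x \<omega>)) \<and>
     (AE \<omega> in M. \<forall>t\<ge>0. \<forall>\<phi>\<in>borel_measurable borel.
        (\<integral>\<^sup>+s\<in>{0..t}. \<phi> (X s \<omega>) \<partial>lborel) = (\<integral>\<^sup>+x. \<phi> x * ennreal (L t x \<omega>) \<partial>lborel))"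

text \<open>\<open>z\<close> interpolated at the points \<open>pt\<close>, linearly in the parameter \<open>v\<close>. On a node of \<open>pt\<close> the two
  adjacent pieces agree, so selecting the leftmost piece containing \<open>x\<close> is harmless.\<close>

definition interpolate :: "(real \<Rightarrow> real) \<Rightarrow> (nat \<Rightarrow> real) \<Rightarrow> (real \<Rightarrow> real^2) \<Rightarrow> real \<Rightarrow> real^2" where
  "interpolate v pt z x =
     (let l = (LEAST l. 1 \<le> l \<and> x \<le> pt l)
      in z (pt (l - 1))
         + ((v x - v (pt (l - 1))) / (v (pt l) - v (pt (l - 1)))) *\<^sub>R (z (pt l) - z (pt (l - 1))))"

text \<open>Riemann--Stieltjes integral of \<open>f\<close> against \<open>G\<close> (limit as the mesh tends to 0).\<close>

definition has_RS_integral ::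
    "(real \<Rightarrow> real) \<Rightarrow> (real \<Rightarrow> real) \<Rightarrow> real \<Rightarrow> real \<Rightarrow> real \<Rightarrow> bool" where
  "has_RS_integral f G a b I \<longleftrightarrow>
     (\<forall>e>0. \<exists>d>0. \<forall>P. P tagged_division_of {a..b} \<and> (\<lambda>x. ball x d) fine P \<longrightarrow>
        \<bar>(\<Sum>(x, K)\<in>P. f x * (G (Sup K) - G (Inf K))) - I\<bar> < e)"

definition RS_integral :: "(real \<Rightarrow> real) \<Rightarrow> (real \<Rightarrow> real) \<Rightarrow> real \<Rightarrow> real \<Rightarrow> real" where
  "RS_integral f G a b = (THE I. has_RS_integral f G a b I)"

text \<open>The tensor product of \<open>real^2\<close> with itself is identified with the 2 by 2 matrices carrying the
  Euclidean (Hilbert--Schmidt) norm; the entry \<open>$ i $ j\<close> of \<open>level2 z a b\<close> is the iterated integral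
  of \<open>dz\<^sup>i\<^sub>u\<^sub>1 dz\<^sup>j\<^sub>u\<^sub>2\<close> over \<open>a < u\<^sub>1 < u\<^sub>2 < b\<close>.\<close>

definition level2 :: "(real \<Rightarrow> real^2) \<Rightarrow> real \<Rightarrow> real \<Rightarrow> real^2^2" where
  "level2 z a b =
     (\<chi> i j. RS_integral (\<lambda>u\<^sub>2. RS_integral (\<lambda>u\<^sub>1. 1) (\<lambda>u. z u $ i) a u\<^sub>2) (\<lambda>u. z u $ j) a b)"

definition level2_dist ::
    "real \<Rightarrow> real \<Rightarrow> real \<Rightarrow> (real \<Rightarrow> real \<Rightarrow> real^2^2) \<Rightarrow> (real \<Rightarrow> real \<Rightarrow> real^2^2) \<Rightarrow> ennreal" where
  "level2_dist \<theta> xl xr A B =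
     (SUP (n, x)\<in>partitions xl xr.
        ennreal ((\<Sum>l=1..n. norm (A (x (l - 1)) (x l) - B (x (l - 1)) (x l)) powr (\<theta> / 2))
          powr (2 / \<theta>)))"

text \<open>Measurability of the distance, a supremum over an uncountable family, is part of convergence
  in \<open>L\<^sup>1\<close>.\<close>

definition level2_converges ::
    "'a measure \<Rightarrow> real \<Rightarrow> real \<Rightarrow> real \<Rightarrow> (nat \<Rightarrow> real \<Rightarrow> real \<Rightarrow> 'a \<Rightarrow> real^2^2) \<Rightarrow>
     (real \<Rightarrow> real \<Rightarrow> 'a \<Rightarrow> real^2^2) \<Rightarrow> bool" where
  "level2_converges M \<theta> xl xr A B \<longleftrightarrow>
     (\<forall>(a, b)\<in>Delta xl xr. B a b \<in> borel_measurable M) \<and>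
     (let D = (\<lambda>m \<omega>. level2_dist \<theta> xl xr (\<lambda>a b. A m a b \<omega>) (\<lambda>a b. B a b \<omega>))
      in (\<forall>m. D m \<in> borel_measurable M) \<and>
         (AE \<omega> in M. (\<lambda>m. D m \<omega>) \<longlonglongrightarrow> 0) \<and>
         (\<lambda>m. \<integral>\<^sup>+\<omega>. D m \<omega> \<partial>M) \<longlonglongrightarrow> 0)"

end

theory Submission
  imports Defs "HOL-Real_Asymp.Real_Asymp"
begin

text \<open>
  The local time is in space only of finite variation of the orders above \<open>2 / (\<alpha> - 1) > 2\<close>, and \<open>g\<close>
  is of \<open>q\<close>-variation with \<open>q\<close> possibly close to \<open>3\<close>, so the iterated integrals of the two against
  each other are in general beyond Young's theory; they exist because of cancellations.

  In the parameter \<open>\<tau> = w1 xl / w1 xl xr\<close> the interpolation nodes are the dyadic points of \<open>[0, 1]\<close>,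
  and refining the interpolation adds to each iterated integral the signed areas of the triangles
  spanned by two neighbouring increments (\<open>lin_area_refine\<close>). These areas are antisymmetric, so they
  vanish for two equal components, and for the pair \<open>(L, g)\<close> they form a linear combination of
  increments of the local time with deterministic weights. Everything therefore rests on moments of
  \<open>\<Sum> c\<^sub>l (L\<^sub>t(x\<^sub>l\<^sub>+\<^sub>1) - L\<^sub>t(x\<^sub>l))\<close>. By \<open>local_time_moment\<close> they are bounded like those of fractional
  Brownian motion of Hurst index \<open>(\<alpha> - 1) / 2 < 1/2\<close>: its increments are negatively correlated, hence
  the variance is at most a multiple of \<open>(max c)\<^sup>2 \<Sum> (x\<^sub>l\<^sub>+\<^sub>1 - x\<^sub>l) powr (\<alpha> - 1)\<close>, as if they were
  independent.

  For these moments, occupation times turn increments of the local time into limits of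
  \<open>\<integral> \<phi>(X\<^sub>s) ds\<close> with Gaussian \<open>\<phi>\<close>. On a time grid, the moments of such a functional are, up to a
  vanishing error, expectations of elementary symmetric sums. Independence of the increments of \<open>X\<close>
  makes them iterated integrals in the Fourier variable (\<open>fourier_walk.moment_bound\<close>), with the kernel
  \<open>k(v) = 1 / (1 + \<bar>v\<bar> powr \<alpha>)\<close>, which is integrable as \<open>\<alpha> > 1\<close>. Because the convolution of \<open>k\<close> with
  itself is at most a multiple of \<open>k\<close>, each integration costs one factor \<open>(\<integral> \<bar>F\<bar>\<^sup>2 k)\<^sup>1\<^sup>/\<^sup>2\<close>, where
  \<open>F\<close> is the Fourier transform of \<open>\<phi>\<close> (\<open>kernel_chain_bound\<close>), and this energy is the variance
  of the fractional Brownian increments (\<open>step_transform_energy\<close>).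

  Put \<open>\<kappa> = min (1/q) ((\<alpha> - 1)/2)\<close>; the hypotheses say \<open>\<kappa> > 1/3\<close>. At level \<open>m\<close>, increments are of order
  \<open>2 powr (- m \<kappa>)\<close> and the triangle sums over a dyadic interval of length \<open>2\<^sup>-\<^sup>n\<close> of order
  \<open>2 powr ((m - n)/2 - 2 m \<kappa>)\<close>. Since all moments are available, slightly worse bounds hold at all scales
  simultaneously with one integrable random constant (\<open>local_time_dyadic_control\<close>). Chen's relation
  and chaining extend them from dyadic to all intervals (\<open>dyadic_area_diff\<close>): consecutive second levels
  differ by at most \<open>C \<Lambda> 2 powr (- m \<eta>) (\<tau> b - \<tau> a) powr (2 r)\<close> with some \<open>r > 1/3\<close> and \<open>\<eta> > 0\<close>. If
  \<open>\<theta> \<ge> 1/r\<close>, which leaves room below \<open>3\<close>, the sum over any partition telescopes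
  (\<open>level2_dist_le_holder\<close>), and the distances tend to \<open>0\<close> geometrically, almost surely and in the
  mean. The limit is unique because the distance dominates every single increment
  (\<open>level2_dist_upper\<close>).
\<close>


section \<open>Riemann--Stieltjes integrals with a quadratic remainder\<close>

lemma has_RS_integral_unique:
  assumes "has_RS_integral f G a b I" "has_RS_integral f G a b J"
  shows "I = J"
proof (rule ccontr)
  assume "I \<noteq> J"
  define e where "e = \<bar>I - J\<bar> / 2"
  have e: "e > 0" using \<open>I \<noteq> J\<close> by (simp add: e_def)
  obtain d1 where d1: "d1 > 0" "\<And>P. P tagged_division_of {a..b} \<Longrightarrow> (\<lambda>x. ball x d1) fine P \<Longrightarrow>
      \<bar>(\<Sum>(x, K)\<in>P. f x * (G (Sup K) - G (Inf K))) - I\<bar> < e"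
    using assms(1)[unfolded has_RS_integral_def, THEN spec, THEN mp, OF e] by auto
  obtain d2 where d2: "d2 > 0" "\<And>P. P tagged_division_of {a..b} \<Longrightarrow> (\<lambda>x. ball x d2) fine P \<Longrightarrow>
      \<bar>(\<Sum>(x, K)\<in>P. f x * (G (Sup K) - G (Inf K))) - J\<bar> < e"
    using assms(2)[unfolded has_RS_integral_def, THEN spec, THEN mp, OF e] by auto
  have "gauge (\<lambda>x::real. ball x (min d1 d2))"
    using d1 d2 by (intro gauge_ball) auto
  then obtain P where P: "P tagged_division_of {a..b}" "(\<lambda>x. ball x (min d1 d2)) fine P"
    by (rule fine_division_exists_real)
  have "(\<lambda>x. ball x d1) fine P" "(\<lambda>x. ball x d2) fine P"
    using P(2) unfolding fine_def by fastforce+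
  from d1(2)[OF P(1) this(1)] d2(2)[OF P(1) this(2)]
  show False unfolding e_def by argo
qed

lemma RS_integral_eq: "has_RS_integral f G a b I \<Longrightarrow> RS_integral f G a b = I"
  unfolding RS_integral_def by (blast intro: has_RS_integral_unique)

lemma has_RS_integral_cong:
  assumes "\<And>x. x \<in> {a..b} \<Longrightarrow> f x = f' x" "\<And>x. x \<in> {a..b} \<Longrightarrow> G x = G' x"
  shows "has_RS_integral f G a b I \<longleftrightarrow> has_RS_integral f' G' a b I"
proof -
  have eq: "(\<Sum>(x, K)\<in>P. f x * (G (Sup K) - G (Inf K))) = (\<Sum>(x, K)\<in>P. f' x * (G' (Sup K) - G' (Inf K)))"
    if P: "P tagged_division_of {a..b}" for P
  proof (intro sum.cong refl, safe)
    fix x K assume xK: "(x, K) \<in> P"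
    from tagged_division_ofD(2-4)[OF P xK]
    obtain c d where K: "K = {c..d}" "x \<in> K" "K \<subseteq> {a..b}" by (metis box_real(2))
    then have "c \<le> d" by auto
    with K have "Sup K = d" "Inf K = c" "c \<in> {a..b}" "d \<in> {a..b}" "x \<in> {a..b}" by auto
    then show "f x * (G (Sup K) - G (Inf K)) = f' x * (G' (Sup K) - G' (Inf K))"
      using assms by simp
  qed
  show ?thesis unfolding has_RS_integral_def by (auto simp: eq)
qed

text \<open>The Riemann sums of \<open>f dG\<close> telescope up to the sum of the remainders, which is at most the
  largest increment of \<open>V\<close> times its total increment.\<close>

lemma has_RS_integral_primitive:
  fixes f G V \<Psi> :: "real \<Rightarrow> real"
  assumes ab: "a \<le> b" and V: "continuous_on {a..b} V" "mono_on {a..b} V" and C: "0 \<le> C"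
    and rem: "\<And>c x d. a \<le> c \<Longrightarrow> c \<le> x \<Longrightarrow> x \<le> d \<Longrightarrow> d \<le> b \<Longrightarrow>
      \<bar>\<Psi> d - \<Psi> c - f x * (G d - G c)\<bar> \<le> C * (V d - V c)\<^sup>2"
  shows "has_RS_integral f G a b (\<Psi> b - \<Psi> a)"
  unfolding has_RS_integral_def
proof (intro allI impI)
  fix e :: real assume e: "e > 0"
  define e' where "e' = e / (C * (V b - V a) + 1)"
  have Vab: "V a \<le> V b" using V(2) ab by (auto intro: mono_onD)
  have pos: "C * (V b - V a) + 1 > 0" using C Vab by (simp add: add_nonneg_pos)
  then have e': "e' > 0" using e by (simp add: e'_def)
  have "uniformly_continuous_on {a..b} V"
    using V(1) by (simp add: compact_uniformly_continuous)
  then obtain d where d: "d > 0" "\<And>x y. x \<in> {a..b} \<Longrightarrow> y \<in> {a..b} \<Longrightarrow> dist y x < d \<Longrightarrow> dist (V y) (V x) < e'"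
    unfolding uniformly_continuous_on_def using e' by meson
  show "\<exists>d>0. \<forall>P. P tagged_division_of {a..b} \<and> (\<lambda>x. ball x d) fine P \<longrightarrow>
        \<bar>(\<Sum>(x, K)\<in>P. f x * (G (Sup K) - G (Inf K))) - (\<Psi> b - \<Psi> a)\<bar> < e"
  proof (intro exI[of _ "d / 2"] conjI allI impI)
    show "d / 2 > 0" using d by simp
    fix P assume "P tagged_division_of {a..b} \<and> (\<lambda>x. ball x (d / 2)) fine P"
    then have P: "P tagged_division_of {a..b}" and fine: "(\<lambda>x. ball x (d / 2)) fine P" by auto
    have fin: "finite P" using P by blast
    have each: "\<bar>f x * (G (Sup K) - G (Inf K)) - (\<Psi> (Sup K) - \<Psi> (Inf K))\<bar> \<le> C * e' * (V (Sup K) - V (Inf K))"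
      if xK: "(x, K) \<in> P" for x K
    proof -
      from tagged_division_ofD(2-4)[OF P xK]
      obtain u v where K: "K = {u..v}" "x \<in> K" "K \<subseteq> {a..b}" by (metis box_real(2))
      then have uv: "u \<le> v" by auto
      with K have S: "Sup K = v" "Inf K = u" "u \<in> {a..b}" "v \<in> {a..b}" by auto
      have "u \<in> K" "v \<in> K" using K uv by auto
      then have "u \<in> ball x (d/2)" "v \<in> ball x (d/2)" using fineD[OF fine xK] by blast+
      then have "dist v u < d" unfolding mem_ball dist_real_def by linarith
      then have "dist (V v) (V u) < e'" using d(2) S by blast
      moreover have mo: "V u \<le> V v" using V(2) S uv by (auto intro: mono_onD)
      ultimately have "V v - V u \<le> e'" by (simp add: dist_real_def)
      then have "(V v - V u) * (V v - V u) \<le> e' * (V v - V u)" using mo by (intro mult_right_mono) auto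
      then have "C * (V v - V u)\<^sup>2 \<le> C * e' * (V v - V u)"
        using C by (simp add: power2_eq_square mult.assoc mult_left_mono)
      then show ?thesis using rem[of u x v] K S by auto
    qed
    have "(\<Sum>(x, K)\<in>P. f x * (G (Sup K) - G (Inf K))) - (\<Psi> b - \<Psi> a)
        = (\<Sum>(x, K)\<in>P. f x * (G (Sup K) - G (Inf K)) - (\<Psi> (Sup K) - \<Psi> (Inf K)))"
      using additive_tagged_division_1[OF ab P, of \<Psi>] by (simp add: sum_subtractf split_def)
    also have "\<bar>\<dots>\<bar> \<le> (\<Sum>(x, K)\<in>P. C * e' * (V (Sup K) - V (Inf K)))"
      by (rule order_trans[OF sum_abs], rule sum_mono) (use each in auto)
    also have "\<dots> = C * e' * (V b - V a)"
      using additive_tagged_division_1[OF ab P, of V] by (simp add: sum_distrib_left[symmetric] split_def)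
    also have "\<dots> < e" using pos e by (simp add: e'_def field_simps)
    finally show "\<bar>(\<Sum>(x, K)\<in>P. f x * (G (Sup K) - G (Inf K))) - (\<Psi> b - \<Psi> a)\<bar> < e" .
  qed
qed

lemma has_RS_integral_one:
  assumes "a \<le> b" shows "has_RS_integral (\<lambda>_. 1) G a b (G b - G a)"
  unfolding has_RS_integral_def
  using additive_tagged_division_1[OF assms, of _ G] by (auto intro!: exI[of _ 1])

section \<open>Piecewise linear paths and their areas\<close>

definition clamp01 :: "real \<Rightarrow> real" where
  "clamp01 z = max 0 (min 1 z)"

text \<open>On \<open>[l, l + 1]\<close> the \<open>l\<close>-th summand runs from \<open>0\<close> to the full increment, elsewhere it is constant.\<close>

definition lin :: "nat \<Rightarrow> (nat \<Rightarrow> real) \<Rightarrow> real \<Rightarrow> real" where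
  "lin n \<phi> y = \<phi> 0 + (\<Sum>l<n. (\<phi> (Suc l) - \<phi> l) * clamp01 (y - real l))"

text \<open>The integral of \<open>lin n \<phi>\<close> against \<open>lin n \<gamma>\<close> from \<open>0\<close> to \<open>y\<close>, computed piece by piece.\<close>

definition lin_primitive :: "nat \<Rightarrow> (nat \<Rightarrow> real) \<Rightarrow> (nat \<Rightarrow> real) \<Rightarrow> real \<Rightarrow> real" where
  "lin_primitive n \<phi> \<gamma> y = (\<Sum>l<n. (\<gamma> (Suc l) - \<gamma> l) *
     (\<phi> l * clamp01 (y - real l) + (\<phi> (Suc l) - \<phi> l) * (clamp01 (y - real l))\<^sup>2 / 2))"

text \<open>The iterated integral of \<open>d(lin n \<phi>)\<close> and \<open>d(lin n \<gamma>)\<close> over \<open>a < u\<^sub>1 < u\<^sub>2 < b\<close>.\<close>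

definition lin_area :: "nat \<Rightarrow> (nat \<Rightarrow> real) \<Rightarrow> (nat \<Rightarrow> real) \<Rightarrow> real \<Rightarrow> real \<Rightarrow> real" where
  "lin_area n \<phi> \<gamma> a b = lin_primitive n \<phi> \<gamma> b - lin_primitive n \<phi> \<gamma> a
     - lin n \<phi> a * (lin n \<gamma> b - lin n \<gamma> a)"

lemma clamp01_sum_split:
  assumes "k < n" "real k \<le> y" "y \<le> real k + 1"
  shows "(\<Sum>l<n. h l (clamp01 (y - real l))) = (\<Sum>l<k. h l 1) + h k (y - real k) + (\<Sum>l\<in>{Suc k..<n}. h l 0)"
proof -
  have split: "{..<n} = {..<k} \<union> {k} \<union> {Suc k..<n}" using assms(1) by auto
  have "(\<Sum>l<n. h l (clamp01 (y - real l))) = (\<Sum>l<k. h l (clamp01 (y - real l)))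
      + h k (clamp01 (y - real k)) + (\<Sum>l\<in>{Suc k..<n}. h l (clamp01 (y - real l)))"
    unfolding split by (subst sum.union_disjoint; (subst sum.union_disjoint)?) auto
  moreover have "(\<Sum>l<k. h l (clamp01 (y - real l))) = (\<Sum>l<k. h l 1)"
  proof (intro sum.cong refl)
    fix l assume "l \<in> {..<k}"
    then have "real l + 1 \<le> real k" by auto
    then have "clamp01 (y - real l) = 1" using assms by (auto simp: clamp01_def)
    then show "h l (clamp01 (y - real l)) = h l 1" by simp
  qed
  moreover have "(\<Sum>l\<in>{Suc k..<n}. h l (clamp01 (y - real l))) = (\<Sum>l\<in>{Suc k..<n}. h l 0)"
  proof (intro sum.cong refl)
    fix l assume "l \<in> {Suc k..<n}"
    then have "real k + 1 \<le> real l" by auto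
    then have "clamp01 (y - real l) = 0" using assms by (auto simp: clamp01_def)
    then show "h l (clamp01 (y - real l)) = h l 0" by simp
  qed
  moreover have "clamp01 (y - real k) = y - real k" using assms by (auto simp: clamp01_def)
  ultimately show ?thesis by simp
qed

lemma lin_eq:
  assumes "k < n" "real k \<le> y" "y \<le> real k + 1"
  shows "lin n \<phi> y = \<phi> k + (\<phi> (Suc k) - \<phi> k) * (y - real k)"
  unfolding lin_def clamp01_sum_split[OF assms, of "\<lambda>l z. (\<phi> (Suc l) - \<phi> l) * z"]
  by (simp add: sum_lessThan_telescope)

lemma lin_node: "k \<le> n \<Longrightarrow> lin n \<phi> (real k) = \<phi> k"
proof (cases "k < n")
  case True then show ?thesis by (subst lin_eq[of k]) auto
next
  case False
  assume "k \<le> n"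
  with False have k: "k = n" by simp
  show ?thesis
  proof (cases n)
    case 0 then show ?thesis by (simp add: lin_def k)
  next
    case (Suc j) then show ?thesis unfolding k by (subst lin_eq[of j]) auto
  qed
qed

text \<open>Chen's relation: the triangle \<open>a < u\<^sub>1 < u\<^sub>2 < c\<close> consists of the triangles over \<open>[a, b]\<close> and
  \<open>[b, c]\<close> and of a rectangle, over which the integral is a product of increments.\<close>

lemma lin_area_chen:
  "lin_area n \<phi> \<gamma> a c = lin_area n \<phi> \<gamma> a b + lin_area n \<phi> \<gamma> b c
     + (lin n \<phi> b - lin n \<phi> a) * (lin n \<gamma> c - lin n \<gamma> b)"
  by (simp add: lin_area_def algebra_simps)

lemma lin_area_piece:
  assumes "k < n" "real k \<le> a" "a \<le> b" "b \<le> real k + 1"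
  shows "lin_area n \<phi> \<gamma> a b = (\<phi> (Suc k) - \<phi> k) * (\<gamma> (Suc k) - \<gamma> k) * (b - a)\<^sup>2 / 2"
proof -
  have a: "real k \<le> a" "a \<le> real k + 1" and b: "real k \<le> b" "b \<le> real k + 1" using assms by auto
  let ?h = "\<lambda>l z. (\<gamma> (Suc l) - \<gamma> l) * (\<phi> l * z + (\<phi> (Suc l) - \<phi> l) * z\<^sup>2 / 2)"
  show ?thesis
    unfolding lin_area_def lin_primitive_def clamp01_sum_split[OF assms(1) a, of ?h]
      clamp01_sum_split[OF assms(1) b, of ?h] lin_eq[OF assms(1) a] lin_eq[OF assms(1) b]
    by (simp add: field_simps power2_eq_square)
qed

lemma lin_area_unit:
  assumes "k < n"
  shows "lin_area n \<phi> \<gamma> (real k) (real (Suc k)) = (\<phi> (Suc k) - \<phi> k) * (\<gamma> (Suc k) - \<gamma> k) / 2"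
  using lin_area_piece[OF assms, of "real k" "real (Suc k)"] by simp

text \<open>Halving every piece adds to the area the signed areas of the triangles spanned by the two
  halves.\<close>

lemma lin_area_refine:
  assumes \<phi>: "\<And>l. \<phi>' (2 * l) = \<phi> l" and \<gamma>: "\<And>l. \<gamma>' (2 * l) = \<gamma> l" and ij: "i \<le> j" "j \<le> n"
  shows "lin_area (2 * n) \<phi>' \<gamma>' (real (2 * i)) (real (2 * j)) - lin_area n \<phi> \<gamma> (real i) (real j)
    = (\<Sum>l\<in>{i..<j}. ((\<phi>' (2 * l + 1) - \<phi>' (2 * l)) * (\<gamma>' (2 * l + 2) - \<gamma>' (2 * l + 1))
        - (\<phi>' (2 * l + 2) - \<phi>' (2 * l + 1)) * (\<gamma>' (2 * l + 1) - \<gamma>' (2 * l))) / 2)"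
  using ij
proof (induction j rule: dec_induct)
  case base
  then show ?case by (simp add: lin_area_def)
next
  case (step j)
  have j: "j < n" "2 * j < 2 * n" "Suc (2 * j) < 2 * n" "Suc (2 * j) \<le> 2 * n" using step by auto
  have nodes: "lin (2 * n) \<phi>' (real (2 * l)) = lin n \<phi> (real l)"
     "lin (2 * n) \<gamma>' (real (2 * l)) = lin n \<gamma> (real l)" if "l \<le> n" for l
    using that lin_node[of l n] lin_node[of "2 * l" "2 * n"] \<phi> \<gamma> by (simp_all del: of_nat_mult)
  have A: "lin_area (2 * n) \<phi>' \<gamma>' (real (2 * j)) (real (2 * Suc j))
     = (\<phi>' (2 * j + 1) - \<phi>' (2 * j)) * (\<gamma>' (2 * j + 1) - \<gamma>' (2 * j)) / 2
     + (\<phi>' (2 * j + 2) - \<phi>' (2 * j + 1)) * (\<gamma>' (2 * j + 2) - \<gamma>' (2 * j + 1)) / 2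
     + (\<phi>' (2 * j + 1) - \<phi>' (2 * j)) * (\<gamma>' (2 * j + 2) - \<gamma>' (2 * j + 1))"
    using lin_area_chen[of "2 * n" \<phi>' \<gamma>' "real (2 * j)" "real (2 * Suc j)" "real (Suc (2 * j))"]
      lin_area_unit[OF j(2), of \<phi>' \<gamma>'] lin_area_unit[OF j(3), of \<phi>' \<gamma>']
      lin_node[of "2 * j" "2 * n"] lin_node[of "Suc (2 * j)" "2 * n"] lin_node[of "Suc (Suc (2 * j))" "2 * n"] j
    by (simp del: of_nat_mult of_nat_Suc)
  have B: "lin_area n \<phi> \<gamma> (real j) (real (Suc j)) = (\<phi>' (2 * j + 2) - \<phi>' (2 * j)) * (\<gamma>' (2 * j + 2) - \<gamma>' (2 * j)) / 2"
    using lin_area_unit[OF j(1), of \<phi> \<gamma>] \<phi>[of j] \<phi>[of "Suc j"] \<gamma>[of j] \<gamma>[of "Suc j"] by simp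
  have "lin_area (2 * n) \<phi>' \<gamma>' (real (2 * i)) (real (2 * Suc j)) - lin_area n \<phi> \<gamma> (real i) (real (Suc j))
    = lin_area (2 * n) \<phi>' \<gamma>' (real (2 * i)) (real (2 * j)) - lin_area n \<phi> \<gamma> (real i) (real j)
     + (lin_area (2 * n) \<phi>' \<gamma>' (real (2 * j)) (real (2 * Suc j)) - lin_area n \<phi> \<gamma> (real j) (real (Suc j)))"
    using lin_area_chen[of "2 * n" \<phi>' \<gamma>' "real (2 * i)" "real (2 * Suc j)" "real (2 * j)"]
      lin_area_chen[of n \<phi> \<gamma> "real i" "real (Suc j)" "real j"] nodes[of i] nodes[of j] nodes[of "Suc j"] step j
    by (simp del: of_nat_mult of_nat_Suc)
  moreover have "lin_area (2 * n) \<phi>' \<gamma>' (real (2 * j)) (real (2 * Suc j)) - lin_area n \<phi> \<gamma> (real j) (real (Suc j))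
     = ((\<phi>' (2 * j + 1) - \<phi>' (2 * j)) * (\<gamma>' (2 * j + 2) - \<gamma>' (2 * j + 1))
        - (\<phi>' (2 * j + 2) - \<phi>' (2 * j + 1)) * (\<gamma>' (2 * j + 1) - \<gamma>' (2 * j))) / 2"
    unfolding A B by (simp add: field_simps)
  ultimately show ?case using step by simp
qed

lemma clamp01_props:
  "0 \<le> clamp01 z" "clamp01 z \<le> 1" "mono clamp01" "continuous_on S clamp01"
  unfolding clamp01_def[abs_def] by (auto simp: mono_def intro!: continuous_intros)

lemma sum_clamp01:
  assumes "0 \<le> y" "y \<le> real n"
  shows "(\<Sum>l<n. clamp01 (y - real l)) = y"
proof (cases "y = real n")
  case True
  have "(\<Sum>l<n. clamp01 (y - real l)) = (\<Sum>l<n. 1)"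
    using True by (intro sum.cong refl) (auto simp: clamp01_def)
  then show ?thesis using True by simp
next
  case False
  define k where "k = nat \<lfloor>y\<rfloor>"
  have k: "real k \<le> y" "y \<le> real k + 1" using assms unfolding k_def by linarith+
  have "k < n" using False assms k by linarith
  from clamp01_sum_split[OF this k, of "\<lambda>l z. z"] show ?thesis by simp
qed

lemma lin_lipschitz:
  assumes "0 \<le> c" "c \<le> d" "d \<le> real n"
  shows "\<bar>lin n \<phi> d - lin n \<phi> c\<bar> \<le> (\<Sum>l<n. \<bar>\<phi> (Suc l) - \<phi> l\<bar>) * (d - c)"
proof -
  define S where "S = (\<Sum>l<n. \<bar>\<phi> (Suc l) - \<phi> l\<bar>)"
  have le: "\<bar>\<phi> (Suc l) - \<phi> l\<bar> \<le> S" if "l < n" for l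
    unfolding S_def using that by (intro member_le_sum) auto
  have "lin n \<phi> d - lin n \<phi> c = (\<Sum>l<n. (\<phi> (Suc l) - \<phi> l) * (clamp01 (d - real l) - clamp01 (c - real l)))"
    by (simp add: lin_def sum_subtractf[symmetric] right_diff_distrib[symmetric])
  also have "\<bar>\<dots>\<bar> \<le> (\<Sum>l<n. S * (clamp01 (d - real l) - clamp01 (c - real l)))"
  proof (rule order_trans[OF sum_abs], rule sum_mono)
    fix l assume "l \<in> {..<n}"
    moreover have "clamp01 (c - real l) \<le> clamp01 (d - real l)"
      using assms clamp01_props(3) by (auto simp: mono_def)
    ultimately show "\<bar>(\<phi> (Suc l) - \<phi> l) * (clamp01 (d - real l) - clamp01 (c - real l))\<bar>
       \<le> S * (clamp01 (d - real l) - clamp01 (c - real l))"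
      using le[of l] by (simp add: abs_mult mult_right_mono)
  qed
  also have "\<dots> = S * (d - c)"
    using sum_clamp01[of c n] sum_clamp01[of d n] assms
    by (simp add: sum_distrib_left[symmetric] sum_subtractf)
  finally show ?thesis unfolding S_def .
qed

text \<open>On a single piece, the increment of the primitive is that of \<open>\<gamma>\<close> times the value of \<open>\<phi>\<close> halfway
  through the part of the piece that lies in \<open>[c, d]\<close>; it differs from the value at \<open>x\<close> by the
  oscillation of \<open>\<phi>\<close> on \<open>[c, d]\<close>.\<close>

lemma lin_primitive_remainder:
  assumes "0 \<le> c" "c \<le> x" "x \<le> d" "d \<le> real n"
  shows "\<bar>lin_primitive n \<phi> \<gamma> d - lin_primitive n \<phi> \<gamma> c - lin n \<phi> x * (lin n \<gamma> d - lin n \<gamma> c)\<bar>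
    \<le> (\<Sum>l<n. \<bar>\<phi> (Suc l) - \<phi> l\<bar>) * (\<Sum>l<n. \<bar>\<gamma> (Suc l) - \<gamma> l\<bar>) * (d - c)\<^sup>2"
proof -
  define S where "S = (\<Sum>l<n. \<bar>\<phi> (Suc l) - \<phi> l\<bar>)"
  define G where "G = (\<Sum>l<n. \<bar>\<gamma> (Suc l) - \<gamma> l\<bar>)"
  have S: "S \<ge> 0" unfolding S_def by (intro sum_nonneg) auto
  have le: "\<bar>\<gamma> (Suc l) - \<gamma> l\<bar> \<le> G" if "l < n" for l
    unfolding G_def using that by (intro member_le_sum) auto
  define r where "r l = (clamp01 (d - real l) + clamp01 (c - real l)) / 2" for l
  define D where "D l = clamp01 (d - real l) - clamp01 (c - real l)" for l
  have D: "D l \<ge> 0" for l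
    using assms clamp01_props(3) by (auto simp: D_def mono_def)
  have 1: "lin n \<gamma> d - lin n \<gamma> c = (\<Sum>l<n. (\<gamma> (Suc l) - \<gamma> l) * D l)"
    by (simp add: lin_def D_def sum_subtractf[symmetric] right_diff_distrib[symmetric])
  have 2: "lin_primitive n \<phi> \<gamma> d - lin_primitive n \<phi> \<gamma> c
     = (\<Sum>l<n. (\<gamma> (Suc l) - \<gamma> l) * (\<phi> l + (\<phi> (Suc l) - \<phi> l) * r l) * D l)"
    unfolding lin_primitive_def sum_subtractf[symmetric] r_def D_def
    by (intro sum.cong refl) (simp add: field_simps power2_eq_square)
  have "lin_primitive n \<phi> \<gamma> d - lin_primitive n \<phi> \<gamma> c - lin n \<phi> x * (lin n \<gamma> d - lin n \<gamma> c)
     = (\<Sum>l<n. (\<gamma> (Suc l) - \<gamma> l) * (\<phi> l + (\<phi> (Suc l) - \<phi> l) * r l - lin n \<phi> x) * D l)"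
    unfolding 1 2 sum_distrib_left sum_subtractf[symmetric]
    by (intro sum.cong refl) (simp add: algebra_simps)
  also have "\<bar>\<dots>\<bar> \<le> (\<Sum>l<n. S * G * (d - c) * D l)"
  proof (rule order_trans[OF sum_abs], rule sum_mono)
    fix l assume l: "l \<in> {..<n}"
    show "\<bar>(\<gamma> (Suc l) - \<gamma> l) * (\<phi> l + (\<phi> (Suc l) - \<phi> l) * r l - lin n \<phi> x) * D l\<bar> \<le> S * G * (d - c) * D l"
    proof (cases "D l = 0")
      case True then show ?thesis by simp
    next
      case False
      then have ov: "c < real l + 1" "real l < d"
        using assms unfolding D_def clamp01_def by linarith+
      have r01: "0 \<le> r l" "r l \<le> 1" unfolding r_def using clamp01_props(1,2)[of "d - real l"] clamp01_props(1,2)[of "c - real l"] by auto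
      have cl: "c \<le> real l + clamp01 (c - real l)" "real l + clamp01 (d - real l) \<le> d"
        using ov unfolding clamp01_def by linarith+
      have rin: "c \<le> real l + r l" "real l + r l \<le> d"
        using cl D[of l] unfolding r_def D_def by argo+
      have eq: "\<phi> l + (\<phi> (Suc l) - \<phi> l) * r l = lin n \<phi> (real l + r l)"
        using l r01 by (subst lin_eq[of l]) auto
      have "\<bar>lin n \<phi> (real l + r l) - lin n \<phi> x\<bar> \<le> S * \<bar>real l + r l - x\<bar>"
        using lin_lipschitz[of "real l + r l" x n \<phi>] lin_lipschitz[of x "real l + r l" n \<phi>] rin assms
        unfolding S_def[symmetric] by (cases "x \<le> real l + r l") auto
      also have "\<dots> \<le> S * (d - c)" using rin assms S by (intro mult_left_mono) auto
      finally have "\<bar>\<phi> l + (\<phi> (Suc l) - \<phi> l) * r l - lin n \<phi> x\<bar> \<le> S * (d - c)" unfolding eq .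
      then have "\<bar>\<gamma> (Suc l) - \<gamma> l\<bar> * \<bar>\<phi> l + (\<phi> (Suc l) - \<phi> l) * r l - lin n \<phi> x\<bar> \<le> G * (S * (d - c))"
        using le[of l] l order_trans[OF abs_ge_zero le[of l]] by (intro mult_mono) auto
      from mult_right_mono[OF this D[of l]] show ?thesis using D[of l] by (simp add: abs_mult mult_ac)
    qed
  qed
  also have "\<dots> = S * G * (d - c)\<^sup>2"
    using sum_clamp01[of c n] sum_clamp01[of d n] assms
    by (simp add: sum_distrib_left[symmetric] sum_subtractf D_def power2_eq_square)
  finally show ?thesis unfolding S_def G_def .
qed

section \<open>Dyadic chaining\<close>

text \<open>The sum of the geometric series in \<open>dyadic_chaining\<close>, once for each end of the interval; the factor
  \<open>2 powr r\<close> compares the interval with the dyadic length next above.\<close>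

definition chain_const :: "real \<Rightarrow> real" where
  "chain_const r = 2 * (1 + 2 / (1 - 2 powr - r)) * 2 powr r + 1"

lemma chain_const_ge1: "0 < r \<Longrightarrow> 1 \<le> chain_const r"
proof -
  assume "0 < r"
  then have "2 powr - r < (1::real)" by (simp add: powr_less_one)
  then have "0 \<le> 2 * (1 + 2 / (1 - 2 powr - r)) * 2 powr r" by (intro mult_nonneg_nonneg add_nonneg_nonneg divide_nonneg_nonneg) auto
  then show ?thesis unfolding chain_const_def by linarith
qed

lemma powr_half_Suc: "(1 / 2 ^ Suc n) powr r = 2 powr - r * (1 / 2 ^ n) powr (r::real)"
  by (simp add: powr_divide powr_mult powr_minus_divide)

lemma dyadic_piece_coarsen:
  assumes "M \<le> n" "k < 2 ^ n"
  shows "k div 2 ^ (n - M) < 2 ^ M"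
    and "real (k div 2 ^ (n - M)) / 2 ^ M \<le> real k / 2 ^ n"
    and "(real k + 1) / 2 ^ n \<le> (real (k div 2 ^ (n - M)) + 1) / 2 ^ M"
proof -
  have pow: "(2::nat) ^ n = 2 ^ M * 2 ^ (n - M)" "(2::real) ^ n = 2 ^ M * 2 ^ (n - M)"
    using assms(1) by (simp_all add: power_add[symmetric])
  show "k div 2 ^ (n - M) < 2 ^ M"
    using assms(2) unfolding pow by (simp add: less_mult_imp_div_less)
  have "k div 2 ^ (n - M) * 2 ^ (n - M) \<le> k" by simp
  then have "real (k div 2 ^ (n - M)) * 2 ^ (n - M) \<le> real k"
    by (metis of_nat_mono of_nat_mult of_nat_numeral of_nat_power)
  then show "real (k div 2 ^ (n - M)) / 2 ^ M \<le> real k / 2 ^ n"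
    unfolding pow(2) by (simp add: field_simps)
  have "k + 1 \<le> (k div 2 ^ (n - M) + 1) * 2 ^ (n - M)"
    by (metis Suc_eq_plus1 Suc_leI dividend_less_div_times pos2 zero_less_power add.commute mult_Suc mult.commute)
  then have "real (k + 1) \<le> real ((k div 2 ^ (n - M) + 1) * 2 ^ (n - M))" by (rule of_nat_mono)
  then have "real k + 1 \<le> (real (k div 2 ^ (n - M)) + 1) * 2 ^ (n - M)" by (simp add: algebra_simps)
  then have "(real k + 1) / (2 ^ M * 2 ^ (n - M))
      \<le> ((real (k div 2 ^ (n - M)) + 1) * 2 ^ (n - M)) / (2 ^ M * 2 ^ (n - M))"
    by (rule divide_right_mono) simp
  then show "(real k + 1) / 2 ^ n \<le> (real (k div 2 ^ (n - M)) + 1) / 2 ^ M"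
    unfolding pow(2) by simp
qed

text \<open>An interval is exhausted by dyadic intervals, at most two of each size. Almost additivity
  then costs a geometric series, dominated by the term of the size of the interval itself.\<close>

lemma dyadic_chaining:
  fixes \<psi> :: "real \<Rightarrow> real \<Rightarrow> real"
  assumes r: "0 < r" and E: "0 \<le> E"
    and defect: "\<And>a b c. 0 \<le> a \<Longrightarrow> a \<le> b \<Longrightarrow> b \<le> c \<Longrightarrow> c \<le> 1 \<Longrightarrow>
      \<bar>\<psi> a c - \<psi> a b - \<psi> b c\<bar> \<le> E * (c - a) powr r"
    and coarse: "\<And>n k. n < M \<Longrightarrow> k < 2 ^ n \<Longrightarrow>
      \<bar>\<psi> (real k / 2 ^ n) ((real k + 1) / 2 ^ n)\<bar> \<le> E * (1 / 2 ^ n) powr r"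
    and fine: "\<And>k a b. k < 2 ^ M \<Longrightarrow> real k / 2 ^ M \<le> a \<Longrightarrow> a \<le> b \<Longrightarrow> b \<le> (real k + 1) / 2 ^ M \<Longrightarrow>
      \<bar>\<psi> a b\<bar> \<le> E * (b - a) powr r"
    and ab: "0 \<le> a" "a \<le> b" "b \<le> 1"
  shows "\<bar>\<psi> a b\<bar> \<le> chain_const r * E * (b - a) powr r"
proof -
  define q where "q = 2 powr - r"
  have q: "0 < q" "q < 1" using r by (auto simp: q_def powr_less_one)
  define B where "B = 1 + 2 / (1 - q)"
  have B1: "1 \<le> B" using q by (simp add: B_def)
  have "2 / (1 - q) * (1 - q) = 2" using q by (intro nonzero_eq_divide_eq[THEN iffD1]) auto
  then have "B * (1 - q) = (1 - q) + 2" unfolding B_def distrib_right by simp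
  then have Bq: "B * q + 2 \<le> B" using q by (simp add: algebra_simps)
  define A where "A n = B * E * (1 / 2 ^ n) powr r" for n :: nat
  have A0: "0 \<le> A n" for n using B1 E by (simp add: A_def)
  have EA: "E * (1 / 2 ^ n) powr r \<le> A n" for n
    using mult_right_mono[OF B1, of "E * (1 / 2 ^ n) powr r"] E by (simp add: A_def)
  have AS: "A (Suc n) + 2 * (E * (1 / 2 ^ n) powr r) \<le> A n" for n
    using mult_right_mono[OF Bq, of "E * (1 / 2 ^ n) powr r"] E
    unfolding A_def powr_half_Suc q_def[symmetric] by (simp add: algebra_simps)
  have A_mono: "A (Suc n) \<le> A n" for n using AS[of n] mult_nonneg_nonneg[OF E powr_ge_zero[of "1 / 2 ^ n" r]] by linarith
  have diag: "\<psi> x x = 0" if "0 \<le> x" "x \<le> 1" for x using defect[of x x x] that by simp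
  have dyad: "\<bar>\<psi> (real k / 2 ^ n) ((real k + 1) / 2 ^ n)\<bar> \<le> E * (1 / 2 ^ n) powr r"
    if "n \<le> M" "k < 2 ^ n" for n k
    using coarse[of n k] fine[of k "real k / 2 ^ n" "(real k + 1) / 2 ^ n"] that
    by (cases "n = M") (auto simp: field_simps diff_divide_distrib[symmetric])
  \<comment> \<open>Intervals with one end at a dyadic point, by downward induction on its level: the midpoint splits
    off at most one dyadic interval of the next level.\<close>
  have oneside: "\<forall>k<2 ^ n. \<forall>t. real k / 2 ^ n \<le> t \<longrightarrow> t \<le> (real k + 1) / 2 ^ n \<longrightarrow>
      \<bar>\<psi> (real k / 2 ^ n) t\<bar> \<le> A n \<and> \<bar>\<psi> t ((real k + 1) / 2 ^ n)\<bar> \<le> A n" (is "?P n") for n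
  proof -
    have large: "?P n" if nM: "M \<le> n" for n
    proof (intro allI impI)
      fix k t assume k: "k < (2::nat) ^ n" and t: "real k / 2 ^ n \<le> t" "t \<le> (real k + 1) / 2 ^ n"
      note P = dyadic_piece_coarsen[OF nM k]
      have len: "t - real k / 2 ^ n \<le> 1 / 2 ^ n" "(real k + 1) / 2 ^ n - t \<le> 1 / 2 ^ n"
        using t by (simp_all add: add_divide_distrib)
      have "\<bar>\<psi> (real k / 2 ^ n) t\<bar> \<le> E * (t - real k / 2 ^ n) powr r"
        using P t by (intro fine[of "k div 2 ^ (n - M)"]) auto
      also have "\<dots> \<le> E * (1 / 2 ^ n) powr r"
        using len t E r by (intro mult_left_mono powr_mono2) auto
      finally have 1: "\<bar>\<psi> (real k / 2 ^ n) t\<bar> \<le> A n" using EA[of n] by linarith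
      have "\<bar>\<psi> t ((real k + 1) / 2 ^ n)\<bar> \<le> E * ((real k + 1) / 2 ^ n - t) powr r"
        using P t by (intro fine[of "k div 2 ^ (n - M)"]) auto
      also have "\<dots> \<le> E * (1 / 2 ^ n) powr r"
        using len t E r by (intro mult_left_mono powr_mono2) auto
      finally have "\<bar>\<psi> t ((real k + 1) / 2 ^ n)\<bar> \<le> A n" using EA[of n] by linarith
      with 1 show "\<bar>\<psi> (real k / 2 ^ n) t\<bar> \<le> A n \<and> \<bar>\<psi> t ((real k + 1) / 2 ^ n)\<bar> \<le> A n" by simp
    qed
    show "?P n"
    proof (cases "M \<le> n")
      case True then show ?thesis by (rule large)
    next
      case False
      then have "n \<le> M" by simp
      then show ?thesis
      proof (induction n rule: inc_induct)
        case base show ?case by (rule large) simp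
      next
        case (step n)
        show ?case
        proof (intro allI impI)
          fix k t assume k: "k < (2::nat) ^ n" and t: "real k / 2 ^ n \<le> t" "t \<le> (real k + 1) / 2 ^ n"
          define c u d where "c = real k / 2 ^ n" and "u = (2 * real k + 1) / 2 ^ Suc n" and "d = (real k + 1) / 2 ^ n"
          have k2: "2 * k < 2 ^ Suc n" "Suc (2 * k) < 2 ^ Suc n" using k by auto
          have c: "c = real (2 * k) / 2 ^ Suc n" and u1: "u = (real (2 * k) + 1) / 2 ^ Suc n"
            and u2: "u = real (Suc (2 * k)) / 2 ^ Suc n" and d: "d = (real (Suc (2 * k)) + 1) / 2 ^ Suc n"
            by (auto simp: c_def u_def d_def field_simps)
          have ord: "c \<le> u" "u \<le> d" "0 \<le> c" by (auto simp: c_def u_def d_def field_simps)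
          have "real k + 1 \<le> 2 ^ n" using k by (metis Suc_eq_plus1 Suc_leI of_nat_Suc of_nat_mono of_nat_numeral of_nat_power add.commute)
          then have d1: "d \<le> 1" by (simp add: d_def)
          have dc: "d - c = 1 / 2 ^ n" by (simp add: c_def d_def diff_divide_distrib[symmetric])
          have half: "E * (1 / 2 ^ Suc n) powr r \<le> E * (1 / 2 ^ n) powr r"
            using E r by (intro mult_left_mono powr_mono2) (auto simp: field_simps)
          have cu: "\<bar>\<psi> c u\<bar> \<le> E * (1 / 2 ^ n) powr r" and ud: "\<bar>\<psi> u d\<bar> \<le> E * (1 / 2 ^ n) powr r"
            using dyad[of "Suc n" "2 * k"] dyad[of "Suc n" "Suc (2 * k)"] k2 step half
            unfolding c[symmetric] u1[symmetric] u2[symmetric] d[symmetric] by auto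
          have IH1: "\<bar>\<psi> c s\<bar> \<le> A (Suc n)" "\<bar>\<psi> s u\<bar> \<le> A (Suc n)" if "c \<le> s" "s \<le> u" for s
            using step.IH[rule_format, of "2 * k" s] k2 that unfolding c[symmetric] u1[symmetric] by auto
          have IH2: "\<bar>\<psi> u s\<bar> \<le> A (Suc n)" "\<bar>\<psi> s d\<bar> \<le> A (Suc n)" if "u \<le> s" "s \<le> d" for s
            using step.IH[rule_format, of "Suc (2 * k)" s] k2 that unfolding u2[symmetric] d[symmetric] by auto
          have def: "\<bar>\<psi> x z - \<psi> x y - \<psi> y z\<bar> \<le> E * (1 / 2 ^ n) powr r"
            if "c \<le> x" "x \<le> y" "y \<le> z" "z \<le> d" for x y z
          proof -
            have "\<bar>\<psi> x z - \<psi> x y - \<psi> y z\<bar> \<le> E * (z - x) powr r" using that ord d1 by (intro defect) auto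
            also have "\<dots> \<le> E * (1 / 2 ^ n) powr r" using that dc E r by (intro mult_left_mono powr_mono2) auto
            finally show ?thesis .
          qed
          have t': "c \<le> t" "t \<le> d" using t by (auto simp: c_def d_def)
          have "\<bar>\<psi> c t\<bar> \<le> A n \<and> \<bar>\<psi> t d\<bar> \<le> A n"
          proof (cases "t \<le> u")
            case True
            then show ?thesis using IH1[of t] def[of t u d] ud t' ord AS[of n] A_mono[of n] by linarith
          next
            case False
            then show ?thesis using IH2[of t] def[of c u t] cu t' ord AS[of n] A_mono[of n] by linarith
          qed
          then show "\<bar>\<psi> (real k / 2 ^ n) t\<bar> \<le> A n \<and> \<bar>\<psi> t ((real k + 1) / 2 ^ n)\<bar> \<le> A n"
            by (simp add: c_def d_def)
        qed
      qed
    qed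
  qed
  have left: "\<bar>\<psi> x (real j / 2 ^ n)\<bar> \<le> A n"
    if "j \<le> 2 ^ n" "0 \<le> x" "x \<le> real j / 2 ^ n" "real j / 2 ^ n - x \<le> 1 / 2 ^ n" for j n x
  proof (cases j)
    case 0
    then have "x = 0" using that by simp
    then show ?thesis using diag[of 0] A0 0 by simp
  next
    case (Suc i)
    then show ?thesis using oneside[of n, rule_format, of i x] that
      by (auto simp: add_divide_distrib add.commute)
  qed
  have right: "\<bar>\<psi> (real j / 2 ^ n) x\<bar> \<le> A n"
    if "j \<le> 2 ^ n" "x \<le> 1" "real j / 2 ^ n \<le> x" "x - real j / 2 ^ n \<le> 1 / 2 ^ n" for j n x
  proof (cases "j = 2 ^ n")
    case True
    then have "x = 1" using that by simp
    then show ?thesis using diag[of 1] A0 True by simp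
  next
    case False
    then show ?thesis using oneside[of n, rule_format, of j x] that
      by (auto simp: add_divide_distrib add.commute)
  qed
  show ?thesis
  proof (cases "a = b")
    case True then show ?thesis using diag[of a] ab by simp
  next
    case False
    then have "0 < b - a" using ab by simp
    then obtain N where "(1 / 2) ^ N < b - a" using real_arch_pow_inv[of "b - a" "1/2"] by auto
    then have "1 / 2 ^ N < b - a" by (simp add: power_divide)
    moreover have "(1::real) / 2 ^ Suc N \<le> 1 / 2 ^ N" by (simp add: field_simps)
    ultimately have ex: "1 / 2 ^ Suc N < b - a" by linarith
    define n where "n = (LEAST n. 1 / 2 ^ Suc n < b - a)"
    have n1: "1 / 2 ^ Suc n < b - a" unfolding n_def by (rule LeastI[of _ N]) (rule ex)
    have n2: "b - a \<le> 1 / 2 ^ n"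
    proof (cases n)
      case 0 then show ?thesis using ab by simp
    next
      case (Suc i)
      then show ?thesis using not_less_Least[of i "\<lambda>n. 1 / 2 ^ Suc n < b - a"] unfolding n_def[symmetric] by auto
    qed
    \<comment> \<open>An interval longer than \<open>2\<^sup>-\<^sup>n\<^sup>-\<^sup>1\<close> contains a dyadic point of level \<open>n\<close> or the midpoint between two
      of them.\<close>
    obtain d where d: "a \<le> d" "d \<le> b" "\<bar>\<psi> a d\<bar> \<le> A n" "\<bar>\<psi> d b\<bar> \<le> A n"
    proof -
      define k where "k = nat \<lceil>a * 2 ^ n\<rceil>"
      have k: "a * 2 ^ n \<le> real k" "real k < a * 2 ^ n + 1"
        using ab unfolding k_def by (auto simp: of_nat_ceiling) linarith
      have k': "a \<le> real k / 2 ^ n" "real k / 2 ^ n - a \<le> 1 / 2 ^ n"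
        using k by (auto simp: pos_le_divide_eq diff_le_eq divide_le_eq distrib_right)
      have "a * 2 ^ n < 2 ^ n" using ab \<open>0 < b - a\<close> by simp
      then have "real k < 2 ^ n + 1" using k by linarith
      then have "real k < real (2 ^ n + 1)" by simp
      then have kn: "k \<le> 2 ^ n" unfolding of_nat_less_iff by simp
      show thesis
      proof (cases "real k / 2 ^ n \<le> b")
        case True
        show thesis
          using k' True n2 by (intro that[of "real k / 2 ^ n"] left right kn ab) auto
      next
        case False
        then have "k \<noteq> 0" using ab by (auto intro: ccontr)
        then obtain j where j: "k = Suc j" by (cases k) auto
        have jn: "Suc (2 * j) \<le> 2 ^ Suc n" using kn j by simp
        define u where "u = real (Suc (2 * j)) / 2 ^ Suc n"
        have u: "u - 1 / 2 ^ Suc n = (real k - 1) / 2 ^ n" "u + 1 / 2 ^ Suc n = real k / 2 ^ n"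
          by (auto simp: u_def j field_simps)
        have "(real k - 1) / 2 ^ n \<le> a" using k by (simp add: field_simps)
        then have u': "a \<le> u" "u \<le> b" "u - a \<le> 1 / 2 ^ Suc n" "b - u \<le> 1 / 2 ^ Suc n"
          using u False n1 by linarith+
        show thesis
        proof (rule that[of u])
          show "\<bar>\<psi> a u\<bar> \<le> A n" "\<bar>\<psi> u b\<bar> \<le> A n"
            using left[OF jn ab(1), folded u_def] right[OF jn ab(3), folded u_def] u' A_mono[of n] by linarith+
        qed (use u' in auto)
      qed
    qed
    have "\<bar>\<psi> a b\<bar> \<le> 2 * A n + E * (b - a) powr r"
      using defect[OF ab(1) d(1,2) ab(3)] d by linarith
    have "(1 / 2 ^ n) powr r \<le> (2 * (b - a)) powr r"
      using n1 r by (intro powr_mono2) (auto simp: field_simps)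
    moreover have "(2 * (b - a)) powr r = 2 powr r * (b - a) powr r"
      using ab by (subst powr_mult) auto
    ultimately have "A n \<le> B * E * (2 powr r * (b - a) powr r)"
      unfolding A_def using B1 E by (intro mult_left_mono) auto
    with \<open>\<bar>\<psi> a b\<bar> \<le> 2 * A n + E * (b - a) powr r\<close> show ?thesis
      unfolding chain_const_def q_def[symmetric] B_def[symmetric] by (simp add: algebra_simps)
  qed
qed

section \<open>Dyadic interpolation\<close>

definition dyadic_incr :: "(real \<Rightarrow> real) \<Rightarrow> nat \<Rightarrow> nat \<Rightarrow> real" where
  "dyadic_incr f n k = f (real (Suc k) / 2 ^ n) - f (real k / 2 ^ n)"

definition dyadic_lin :: "nat \<Rightarrow> (real \<Rightarrow> real) \<Rightarrow> real \<Rightarrow> real" where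
  "dyadic_lin m f s = lin (2 ^ m) (\<lambda>l. f (real l / 2 ^ m)) (2 ^ m * s)"

definition dyadic_area :: "nat \<Rightarrow> (real \<Rightarrow> real) \<Rightarrow> (real \<Rightarrow> real) \<Rightarrow> real \<Rightarrow> real \<Rightarrow> real" where
  "dyadic_area m f g a b =
     lin_area (2 ^ m) (\<lambda>l. f (real l / 2 ^ m)) (\<lambda>l. g (real l / 2 ^ m)) (2 ^ m * a) (2 ^ m * b)"

text \<open>Signed area of the triangles spanned by the two halves of the pieces \<open>i, \<dots>, j - 1\<close> of
  level \<open>m\<close>.\<close>

definition triangle_sum :: "(real \<Rightarrow> real) \<Rightarrow> (real \<Rightarrow> real) \<Rightarrow> nat \<Rightarrow> nat \<Rightarrow> nat \<Rightarrow> real" where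
  "triangle_sum f g m i j = (\<Sum>l\<in>{i..<j}.
     (dyadic_incr f (Suc m) (2 * l) * dyadic_incr g (Suc m) (2 * l + 1)
      - dyadic_incr f (Suc m) (2 * l + 1) * dyadic_incr g (Suc m) (2 * l)) / 2)"

lemma dyadic_scale:
  assumes "n \<le> m"
  shows "2 ^ m * (real k / 2 ^ n) = real (k * 2 ^ (m - n))"
proof -
  have "(2::real) ^ m = 2 ^ n * 2 ^ (m - n)" using assms by (simp add: power_add[symmetric])
  then show ?thesis by simp
qed

lemma dyadic_lin_node:
  assumes "n \<le> m" "k \<le> 2 ^ n"
  shows "dyadic_lin m f (real k / 2 ^ n) = f (real k / 2 ^ n)"
proof -
  have "k * 2 ^ (m - n) \<le> 2 ^ n * 2 ^ (m - n)" using assms by simp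
  then have le: "k * 2 ^ (m - n) \<le> 2 ^ m" using assms by (simp add: power_add[symmetric])
  have "real (k * 2 ^ (m - n)) / 2 ^ m = real k / 2 ^ n"
    unfolding dyadic_scale[OF assms(1), symmetric] by simp
  then show ?thesis unfolding dyadic_lin_def dyadic_scale[OF assms(1)] lin_node[OF le] by simp
qed

lemma dyadic_lin_piece:
  assumes "k < 2 ^ m" "real k / 2 ^ m \<le> a" "a \<le> b" "b \<le> (real k + 1) / 2 ^ m"
  shows "dyadic_lin m f b - dyadic_lin m f a = dyadic_incr f m k * (2 ^ m * (b - a))"
proof -
  have "real k \<le> 2 ^ m * a" "2 ^ m * b \<le> real k + 1" "2 ^ m * a \<le> 2 ^ m * b"
    using assms by (auto simp: field_simps)
  then have "real k \<le> 2 ^ m * a" "2 ^ m * a \<le> real k + 1" "real k \<le> 2 ^ m * b" "2 ^ m * b \<le> real k + 1"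
    by linarith+
  then show ?thesis
    unfolding dyadic_lin_def dyadic_incr_def
    using lin_eq[OF assms(1), of "2 ^ m * a" "\<lambda>l. f (real l / 2 ^ m)"]
      lin_eq[OF assms(1), of "2 ^ m * b" "\<lambda>l. f (real l / 2 ^ m)"]
    by (simp add: algebra_simps del: of_nat_Suc)
qed

lemma dyadic_area_piece:
  assumes "k < 2 ^ m" "real k / 2 ^ m \<le> a" "a \<le> b" "b \<le> (real k + 1) / 2 ^ m"
  shows "dyadic_area m f g a b = (dyadic_lin m f b - dyadic_lin m f a) * (dyadic_lin m g b - dyadic_lin m g a) / 2"
proof -
  have "real k \<le> 2 ^ m * a" "2 ^ m * b \<le> real k + 1" "2 ^ m * a \<le> 2 ^ m * b"
    using assms by (auto simp: field_simps)
  then have "dyadic_area m f g a b = dyadic_incr f m k * dyadic_incr g m k * (2 ^ m * b - 2 ^ m * a)\<^sup>2 / 2"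
    unfolding dyadic_area_def dyadic_incr_def using assms(1) by (subst lin_area_piece[of k]) auto
  then show ?thesis
    unfolding dyadic_lin_piece[OF assms] by (simp add: power2_eq_square algebra_simps)
qed

lemma dyadic_area_chen:
  "dyadic_area m f g a c = dyadic_area m f g a b + dyadic_area m f g b c
     + (dyadic_lin m f b - dyadic_lin m f a) * (dyadic_lin m g c - dyadic_lin m g b)"
  unfolding dyadic_area_def dyadic_lin_def by (rule lin_area_chen)

lemma dyadic_area_refine:
  assumes "n \<le> m" "k < 2 ^ n"
  shows "dyadic_area (Suc m) f g (real k / 2 ^ n) ((real k + 1) / 2 ^ n)
       - dyadic_area m f g (real k / 2 ^ n) ((real k + 1) / 2 ^ n)
     = triangle_sum f g m (k * 2 ^ (m - n)) (Suc k * 2 ^ (m - n))"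
proof -
  have "Suc k * 2 ^ (m - n) \<le> 2 ^ n * 2 ^ (m - n)" using assms by (intro mult_le_mono1) auto
  then have le: "Suc k * 2 ^ (m - n) \<le> 2 ^ m" using assms by (simp add: power_add[symmetric])
  have S: "2 ^ Suc m * (real k / 2 ^ n) = real (2 * (k * 2 ^ (m - n)))"
    "2 ^ Suc m * (real (Suc k) / 2 ^ n) = real (2 * (Suc k * 2 ^ (m - n)))"
    using dyadic_scale[OF assms(1), of k] dyadic_scale[OF assms(1), of "Suc k"] by simp_all
  have Sk: "real k + 1 = real (Suc k)" by simp
  have half: "real (2 * l) / 2 ^ Suc m = real l / 2 ^ m" for l by simp
  have "2 ^ Suc m = 2 * (2::nat) ^ m" by simp
  then show ?thesis
    unfolding dyadic_area_def Sk S dyadic_scale[OF assms(1)] triangle_sum_def dyadic_incr_def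
    using lin_area_refine[of "\<lambda>l. f (real l / 2 ^ Suc m)" "\<lambda>l. f (real l / 2 ^ m)"
        "\<lambda>l. g (real l / 2 ^ Suc m)" "\<lambda>l. g (real l / 2 ^ m)" "k * 2 ^ (m - n)" "Suc k * 2 ^ (m - n)" "2 ^ m"] le half
    by (simp del: of_nat_mult of_nat_Suc power_Suc add: numeral_2_eq_2)
qed

definition dyadic_holder :: "(real \<Rightarrow> real) \<Rightarrow> real \<Rightarrow> real \<Rightarrow> bool" where
  "dyadic_holder f c r \<longleftrightarrow> (\<forall>n. \<forall>k<2 ^ n. \<bar>dyadic_incr f n k\<bar> \<le> c * (1 / 2 ^ n) powr r)"

lemma powr_half_mono: "s \<le> r \<Longrightarrow> (1 / 2 ^ n) powr r \<le> (1 / 2 ^ n) powr (s::real)"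
  by (rule powr_mono') auto

lemma scaled_le_powr:
  fixes a b r :: real
  assumes "0 < r" "r \<le> 1" "a \<le> b" "b - a \<le> 1 / 2 ^ m"
  shows "(1 / 2 ^ m) powr r * (2 ^ m * (b - a)) \<le> (b - a) powr r"
proof (cases "a = b")
  case False
  define x where "x = 2 ^ m * (b - a)"
  have x: "0 < x" "x \<le> 1" using assms False by (auto simp: x_def field_simps)
  have "x = x powr 1" using x by simp
  also have "\<dots> \<le> x powr r" using x assms by (intro powr_mono') auto
  finally have "(1 / 2 ^ m) powr r * x \<le> (1 / 2 ^ m) powr r * x powr r" by (intro mult_left_mono) auto
  also have "\<dots> = (1 / 2 ^ m * x) powr r" using x by (simp add: powr_mult powr_divide)
  also have "1 / 2 ^ m * x = b - a" by (simp add: x_def)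
  finally show ?thesis by (simp add: x_def)
qed simp

lemma dyadic_lin_holder:
  assumes f: "dyadic_holder f c r" and r: "0 < r" "r \<le> 1" and c: "0 \<le> c"
    and ab: "0 \<le> a" "a \<le> b" "b \<le> 1"
  shows "\<bar>dyadic_lin m f b - dyadic_lin m f a\<bar> \<le> chain_const r * c * (b - a) powr r"
proof (rule dyadic_chaining[where M = m])
  fix n k assume n: "n < m" and k: "k < (2::nat) ^ n"
  then have "\<bar>dyadic_incr f n k\<bar> \<le> c * (1 / 2 ^ n) powr r" using f by (simp add: dyadic_holder_def)
  moreover have "dyadic_lin m f ((real k + 1) / 2 ^ n) - dyadic_lin m f (real k / 2 ^ n) = dyadic_incr f n k"
    using dyadic_lin_node[of n m k f] dyadic_lin_node[of n m "Suc k" f] n k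
    by (simp add: dyadic_incr_def add.commute)
  ultimately show "\<bar>dyadic_lin m f ((real k + 1) / 2 ^ n) - dyadic_lin m f (real k / 2 ^ n)\<bar> \<le> c * (1 / 2 ^ n) powr r"
    by simp
next
  fix k a b assume k: "k < (2::nat) ^ m" and ab: "real k / 2 ^ m \<le> a" "a \<le> b" "b \<le> (real k + 1) / 2 ^ m"
  have ba: "b - a \<le> 1 / 2 ^ m" using ab by (simp add: add_divide_distrib)
  have "\<bar>dyadic_lin m f b - dyadic_lin m f a\<bar> = \<bar>dyadic_incr f m k\<bar> * (2 ^ m * (b - a))"
    unfolding dyadic_lin_piece[OF k ab] using ab by (simp add: abs_mult)
  also have "\<dots> \<le> c * (1 / 2 ^ m) powr r * (2 ^ m * (b - a))"
    using f k ab by (intro mult_right_mono) (auto simp: dyadic_holder_def)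
  also have "\<dots> \<le> c * (b - a) powr r"
    using scaled_le_powr[OF r ab(2) ba] c by (simp add: mult.assoc mult_left_mono)
  finally show "\<bar>dyadic_lin m f b - dyadic_lin m f a\<bar> \<le> c * (b - a) powr r" .
qed (use assms in auto)

text \<open>The interpolations agree at the nodes of the coarser one, so that only the scale of level \<open>m + 1\<close>
  contributes; there the surplus \<open>\<eta>\<close> of the exponent turns into decay in \<open>m\<close>.\<close>

lemma dyadic_lin_diff_holder:
  assumes f: "dyadic_holder f c (r + \<eta>)" and r: "0 < r" "r \<le> 1" and \<eta>: "0 \<le> \<eta>" and c: "0 \<le> c"
    and ab: "0 \<le> a" "a \<le> b" "b \<le> 1"
  shows "\<bar>(dyadic_lin (Suc m) f b - dyadic_lin (Suc m) f a) - (dyadic_lin m f b - dyadic_lin m f a)\<bar>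
    \<le> chain_const r * (2 * c * (1 / 2 ^ m) powr \<eta>) * (b - a) powr r"
proof -
  define E where "E = 2 * c * (1 / 2 ^ m) powr \<eta>"
  have E: "0 \<le> E" using c by (simp add: E_def)
  show ?thesis unfolding E_def[symmetric]
  proof (rule dyadic_chaining[where M = "Suc m"])
    fix n k assume n: "n < Suc m" and k: "k < (2::nat) ^ n"
    have "dyadic_lin l f ((real k + 1) / 2 ^ n) - dyadic_lin l f (real k / 2 ^ n) = dyadic_incr f n k" if "l = m \<or> l = Suc m" for l
      using dyadic_lin_node[of n l k f] dyadic_lin_node[of n l "Suc k" f] n k that
      by (auto simp: dyadic_incr_def add.commute)
    then show "\<bar>(dyadic_lin (Suc m) f ((real k + 1) / 2 ^ n) - dyadic_lin (Suc m) f (real k / 2 ^ n))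
       - (dyadic_lin m f ((real k + 1) / 2 ^ n) - dyadic_lin m f (real k / 2 ^ n))\<bar> \<le> E * (1 / 2 ^ n) powr r"
      using E by simp
  next
    fix k a b assume k: "k < (2::nat) ^ Suc m" and ab: "real k / 2 ^ Suc m \<le> a" "a \<le> b" "b \<le> (real k + 1) / 2 ^ Suc m"
    note co = dyadic_piece_coarsen[of m "Suc m" k, OF _ k]
    define k' where "k' = k div 2 ^ (Suc m - m)"
    have k': "k' < 2 ^ m" "real k' / 2 ^ m \<le> a" "b \<le> (real k' + 1) / 2 ^ m"
      using co ab unfolding k'_def[symmetric] by auto
    define x where "x = (1 / 2 ^ Suc m) powr r * (2 ^ Suc m * (b - a))"
    have x0: "0 \<le> x" using ab by (simp add: x_def)
    have ba: "b - a \<le> 1 / 2 ^ Suc m" using ab by (simp add: add_divide_distrib)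
    have "\<bar>dyadic_lin (Suc m) f b - dyadic_lin (Suc m) f a\<bar> = \<bar>dyadic_incr f (Suc m) k\<bar> * (2 ^ Suc m * (b - a))"
      unfolding dyadic_lin_piece[OF k ab] using ab by (simp add: abs_mult)
    also have "\<dots> \<le> c * (1 / 2 ^ Suc m) powr (r + \<eta>) * (2 ^ Suc m * (b - a))"
      using f k ab by (intro mult_right_mono) (auto simp: dyadic_holder_def simp del: power_Suc)
    also have "\<dots> = c * (1 / 2 ^ Suc m) powr \<eta> * x" by (simp add: x_def powr_add)
    also have "\<dots> \<le> c * (1 / 2 ^ m) powr \<eta> * x"
      using c x0 \<eta> by (intro mult_right_mono mult_left_mono powr_mono2) (auto simp: field_simps)
    finally have 1: "\<bar>dyadic_lin (Suc m) f b - dyadic_lin (Suc m) f a\<bar> \<le> c * (1 / 2 ^ m) powr \<eta> * x" .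
    have half: "(1 / 2 ^ m) powr r \<le> 2 * (1 / 2 ^ Suc m) powr r"
    proof -
      have "1 / 2 ^ m = 2 * (1 / 2 ^ Suc m :: real)" by simp
      then have "(1 / 2 ^ m) powr r = 2 powr r * (1 / 2 ^ Suc m :: real) powr r"
        by (metis powr_mult zero_le_numeral zero_le_divide_1_iff zero_le_power)
      moreover have "2 powr r \<le> (2::real) powr 1" using r by (intro powr_mono) auto
      ultimately show ?thesis by (simp add: mult_right_mono)
    qed
    have "\<bar>dyadic_lin m f b - dyadic_lin m f a\<bar> = \<bar>dyadic_incr f m k'\<bar> * (2 ^ m * (b - a))"
      unfolding dyadic_lin_piece[OF k'(1,2) ab(2) k'(3)] using ab by (simp add: abs_mult)
    also have "\<dots> \<le> c * (1 / 2 ^ m) powr (r + \<eta>) * (2 ^ m * (b - a))"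
      using f k' ab by (intro mult_right_mono) (auto simp: dyadic_holder_def)
    also have "\<dots> = (c * (1 / 2 ^ m) powr \<eta>) * ((1 / 2 ^ m) powr r * (2 ^ m * (b - a)))" by (simp add: powr_add)
    also have "\<dots> \<le> (c * (1 / 2 ^ m) powr \<eta>) * ((2 * (1 / 2 ^ Suc m) powr r) * (2 ^ m * (b - a)))"
      using c ab half by (intro mult_left_mono mult_right_mono) auto
    also have "\<dots> = c * (1 / 2 ^ m) powr \<eta> * x" by (simp add: x_def)
    finally have 2: "\<bar>dyadic_lin m f b - dyadic_lin m f a\<bar> \<le> c * (1 / 2 ^ m) powr \<eta> * x" .
    have "\<bar>(dyadic_lin (Suc m) f b - dyadic_lin (Suc m) f a) - (dyadic_lin m f b - dyadic_lin m f a)\<bar> \<le> E * x"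
      using 1 2 unfolding E_def by simp
    also have "\<dots> \<le> E * (b - a) powr r"
      using scaled_le_powr[OF r ab(2) ba] E by (simp add: x_def mult_left_mono)
    finally show "\<bar>(dyadic_lin (Suc m) f b - dyadic_lin (Suc m) f a) - (dyadic_lin m f b - dyadic_lin m f a)\<bar> \<le> E * (b - a) powr r" .
  qed (use assms E in auto)
qed

text \<open>The areas of consecutive interpolations are close at every scale as soon as they are close on
  dyadic intervals. Both areas obey Chen's relation, so their difference is additive up to products
  of increments, one factor of which contains a difference of the two interpolations.\<close>

lemma dyadic_area_diff:
  assumes f: "dyadic_holder f c1 (r + \<eta>)" and g: "dyadic_holder g c2 (r + \<eta>)"
    and r: "0 < r" "r \<le> 1" and \<eta>: "0 \<le> \<eta>" and c: "0 \<le> c1" "0 \<le> c2" "0 \<le> c3"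
    and tri: "\<And>n k. n \<le> m \<Longrightarrow> k < 2 ^ n \<Longrightarrow>
      \<bar>triangle_sum f g m (k * 2 ^ (m - n)) (Suc k * 2 ^ (m - n))\<bar> \<le> c3 * (1 / 2 ^ m) powr \<eta> * (1 / 2 ^ n) powr (2 * r)"
    and ab: "0 \<le> a" "a \<le> b" "b \<le> 1"
  shows "\<bar>dyadic_area (Suc m) f g a b - dyadic_area m f g a b\<bar>
    \<le> chain_const (2 * r) * (4 * (chain_const r)\<^sup>2 * c1 * c2 + c3) * (1 / 2 ^ m) powr \<eta> * (b - a) powr (2 * r)"
proof -
  define K where "K = chain_const r"
  have K: "1 \<le> K" unfolding K_def using r by (intro chain_const_ge1) auto
  define \<delta> where "\<delta> = (1 / 2 ^ m :: real) powr \<eta>"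
  have \<delta>: "0 \<le> \<delta>" by (simp add: \<delta>_def)
  define E where "E = (4 * K\<^sup>2 * c1 * c2 + c3) * \<delta>"
  have E0: "0 \<le> 4 * K\<^sup>2 * c1 * c2 * \<delta>" "0 \<le> c3 * \<delta>" using c \<delta> by auto
  then have E: "0 \<le> E" by (simp add: E_def distrib_right)
  have weaken: "dyadic_holder h c r" if "dyadic_holder h c (r + \<eta>)" "0 \<le> c" for h c
    unfolding dyadic_holder_def
  proof (intro allI impI)
    fix n k assume "k < (2::nat) ^ n"
    then have "\<bar>dyadic_incr h n k\<bar> \<le> c * (1 / 2 ^ n) powr (r + \<eta>)" using that by (simp add: dyadic_holder_def)
    also have "\<dots> \<le> c * (1 / 2 ^ n) powr r" using that \<eta> by (intro mult_left_mono powr_half_mono) auto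
    finally show "\<bar>dyadic_incr h n k\<bar> \<le> c * (1 / 2 ^ n) powr r" .
  qed
  define F where "F l x y = dyadic_lin l f y - dyadic_lin l f x" for l x y
  define G where "G l x y = dyadic_lin l g y - dyadic_lin l g x" for l x y
  have FG: "\<bar>F l x y\<bar> \<le> K * c1 * (y - x) powr r" "\<bar>G l x y\<bar> \<le> K * c2 * (y - x) powr r"
    "\<bar>F (Suc m) x y - F m x y\<bar> \<le> K * (2 * c1 * \<delta>) * (y - x) powr r"
    "\<bar>G (Suc m) x y - G m x y\<bar> \<le> K * (2 * c2 * \<delta>) * (y - x) powr r"
    if "0 \<le> x" "x \<le> y" "y \<le> 1" for l x y
    using dyadic_lin_holder[OF weaken[OF f c(1)] r c(1) that] dyadic_lin_holder[OF weaken[OF g c(2)] r c(2) that]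
      dyadic_lin_diff_holder[OF f r \<eta> c(1) that] dyadic_lin_diff_holder[OF g r \<eta> c(2) that]
    unfolding F_def G_def K_def \<delta>_def by auto
  have prod: "\<bar>F (Suc m) x y * G (Suc m) x' y' - F m x y * G m x' y'\<bar> \<le> 4 * K\<^sup>2 * c1 * c2 * \<delta> * z powr (2 * r)"
    if xy: "0 \<le> x" "x \<le> y" "y \<le> 1" "0 \<le> x'" "x' \<le> y'" "y' \<le> 1" and z: "y - x \<le> z" "y' - x' \<le> z" for x y x' y' z
  proof -
    have p: "(y - x) powr r \<le> z powr r" "(y' - x') powr r \<le> z powr r"
      using z r xy by (auto intro!: powr_mono2)
    have pp: "(y - x) powr r * (y' - x') powr r \<le> z powr (2 * r)"
      using mult_mono[OF p] by (simp add: powr_add[symmetric])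
    have "F (Suc m) x y * G (Suc m) x' y' - F m x y * G m x' y'
      = (F (Suc m) x y - F m x y) * G (Suc m) x' y' + F m x y * (G (Suc m) x' y' - G m x' y')" by (simp add: algebra_simps)
    also have "\<bar>\<dots>\<bar> \<le> \<bar>F (Suc m) x y - F m x y\<bar> * \<bar>G (Suc m) x' y'\<bar> + \<bar>F m x y\<bar> * \<bar>G (Suc m) x' y' - G m x' y'\<bar>"
      by (metis abs_mult abs_triangle_ineq)
    also have "\<dots> \<le> (K * (2 * c1 * \<delta>) * (y - x) powr r) * (K * c2 * (y' - x') powr r)
        + (K * c1 * (y - x) powr r) * (K * (2 * c2 * \<delta>) * (y' - x') powr r)"
      using FG[OF xy(1-3)] FG[OF xy(4-6)] K c \<delta> by (intro add_mono mult_mono) auto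
    also have "\<dots> = 4 * K\<^sup>2 * c1 * c2 * \<delta> * ((y - x) powr r * (y' - x') powr r)"
      by (simp add: power2_eq_square algebra_simps)
    also have "\<dots> \<le> 4 * K\<^sup>2 * c1 * c2 * \<delta> * z powr (2 * r)"
      using pp E0 by (intro mult_left_mono) auto
    finally show ?thesis .
  qed
  define \<psi> where "\<psi> x y = dyadic_area (Suc m) f g x y - dyadic_area m f g x y" for x y
  have "\<bar>\<psi> a b\<bar> \<le> chain_const (2 * r) * E * (b - a) powr (2 * r)"
  proof (rule dyadic_chaining[where M = "Suc m"])
    fix a b c :: real assume abc: "0 \<le> a" "a \<le> b" "b \<le> c" "c \<le> 1"
    have "\<psi> a c - \<psi> a b - \<psi> b c = F (Suc m) a b * G (Suc m) b c - F m a b * G m b c"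
      unfolding \<psi>_def F_def G_def using dyadic_area_chen[of "Suc m" f g a c b] dyadic_area_chen[of m f g a c b] by simp
    also have "\<bar>\<dots>\<bar> \<le> 4 * K\<^sup>2 * c1 * c2 * \<delta> * (c - a) powr (2 * r)" using abc by (intro prod) auto
    also have "\<dots> \<le> E * (c - a) powr (2 * r)" using E0 by (intro mult_right_mono) (auto simp: E_def distrib_right)
    finally show "\<bar>\<psi> a c - \<psi> a b - \<psi> b c\<bar> \<le> E * (c - a) powr (2 * r)" .
  next
    fix n k assume n: "n < Suc m" and k: "k < (2::nat) ^ n"
    have "\<bar>\<psi> (real k / 2 ^ n) ((real k + 1) / 2 ^ n)\<bar> \<le> c3 * \<delta> * (1 / 2 ^ n) powr (2 * r)"
      using tri[of n k] dyadic_area_refine[of n m k f g] n k unfolding \<psi>_def \<delta>_def by simp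
    also have "\<dots> \<le> E * (1 / 2 ^ n) powr (2 * r)" using E0 by (intro mult_right_mono) (auto simp: E_def distrib_right)
    finally show "\<bar>\<psi> (real k / 2 ^ n) ((real k + 1) / 2 ^ n)\<bar> \<le> E * (1 / 2 ^ n) powr (2 * r)" .
  next
    fix k a b assume k: "k < (2::nat) ^ Suc m" and ab: "real k / 2 ^ Suc m \<le> a" "a \<le> b" "b \<le> (real k + 1) / 2 ^ Suc m"
    note co = dyadic_piece_coarsen[of m "Suc m" k, OF _ k]
    define k' where "k' = k div 2 ^ (Suc m - m)"
    have k': "k' < 2 ^ m" "real k' / 2 ^ m \<le> a" "b \<le> (real k' + 1) / 2 ^ m"
      using co ab unfolding k'_def[symmetric] by auto
    have "0 \<le> real k / 2 ^ Suc m" by simp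
    then have a0: "0 \<le> a" using ab by linarith
    have "real (Suc k) \<le> real (2 ^ Suc m)" using k by (intro of_nat_mono) simp
    then have "(real k + 1) / 2 ^ Suc m \<le> 1" by (simp add: field_simps)
    then have b1: "b \<le> 1" using ab by linarith
    have "\<psi> a b = (F (Suc m) a b * G (Suc m) a b - F m a b * G m a b) / 2"
      unfolding \<psi>_def F_def G_def dyadic_area_piece[OF k ab] dyadic_area_piece[OF k'(1,2) ab(2) k'(3)]
      by (simp add: diff_divide_distrib)
    also have "\<bar>\<dots>\<bar> \<le> \<bar>F (Suc m) a b * G (Suc m) a b - F m a b * G m a b\<bar>" by simp
    also have "\<dots> \<le> 4 * K\<^sup>2 * c1 * c2 * \<delta> * (b - a) powr (2 * r)" using ab a0 b1 by (intro prod) auto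
    also have "\<dots> \<le> E * (b - a) powr (2 * r)" using E0 by (intro mult_right_mono) (auto simp: E_def distrib_right)
    finally show "\<bar>\<psi> a b\<bar> \<le> E * (b - a) powr (2 * r)" .
  qed (use r E ab in auto)
  then show ?thesis unfolding \<psi>_def E_def \<delta>_def K_def by (simp add: mult.assoc)
qed

section \<open>The second level of the interpolated path\<close>

lemma continuous_on_dyadic_area:
  "continuous_on S (\<lambda>(a, b). dyadic_area m f g a b)"
proof -
  have c: "continuous_on UNIV (lin n \<phi>)" "continuous_on UNIV (lin_primitive n \<phi> \<gamma>)" for n \<phi> \<gamma>
    unfolding lin_def[abs_def] lin_primitive_def[abs_def]
    by (intro continuous_intros continuous_on_compose2[OF clamp01_props(4)[of UNIV]]; auto)+
  have "continuous_on S (\<lambda>p. lin n \<phi> (2 ^ m * fst p))" "continuous_on S (\<lambda>p. lin n \<phi> (2 ^ m * snd p))"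
    "continuous_on S (\<lambda>p. lin_primitive n \<phi> \<gamma> (2 ^ m * fst p))"
    "continuous_on S (\<lambda>p. lin_primitive n \<phi> \<gamma> (2 ^ m * snd p))"
    for n \<phi> \<gamma> and S :: "(real \<times> real) set"
    by (rule continuous_on_compose2[OF c(1)] continuous_on_compose2[OF c(2)]; auto intro!: continuous_intros)+
  then show ?thesis
    unfolding dyadic_area_def lin_area_def split_def
    by (intro continuous_on_diff continuous_on_mult) auto
qed

lemma interpolate_component:
  fixes z :: "real \<Rightarrow> real^2" and v :: "real \<Rightarrow> real" and pt :: "nat \<Rightarrow> real"
  assumes W: "0 < W" and x: "pt 0 \<le> x" "x \<le> pt (2 ^ m)"
    and node: "\<And>l. l \<le> 2 ^ m \<Longrightarrow> v (pt l) = W * (real l / 2 ^ m)"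
    and mono: "\<And>x y. pt 0 \<le> x \<Longrightarrow> x \<le> y \<Longrightarrow> y \<le> pt (2 ^ m) \<Longrightarrow> v x \<le> v y"
    and pts: "\<And>l. l \<le> 2 ^ m \<Longrightarrow> pt 0 \<le> pt l \<and> pt l \<le> pt (2 ^ m)"
    and f: "\<And>l. l \<le> 2 ^ m \<Longrightarrow> z (pt l) $ i = f (real l / 2 ^ m)"
  shows "interpolate v pt z x $ i = dyadic_lin m f (v x / W)"
proof -
  define l where "l = (LEAST l. 1 \<le> l \<and> x \<le> pt l)"
  have ex: "1 \<le> (2::nat) ^ m \<and> x \<le> pt (2 ^ m)" using x by simp
  have l1: "1 \<le> l" "x \<le> pt l" unfolding l_def using LeastI[of "\<lambda>l. 1 \<le> l \<and> x \<le> pt l", OF ex] by auto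
  have lm: "l \<le> 2 ^ m" unfolding l_def by (rule Least_le) (rule ex)
  have l2: "pt (l - 1) \<le> x"
  proof (cases "l = 1")
    case True then show ?thesis using x by simp
  next
    case False
    then have "1 \<le> l - 1" "l - 1 < l" using l1 by auto
    then show ?thesis using not_less_Least[of "l - 1" "\<lambda>l. 1 \<le> l \<and> x \<le> pt l"] unfolding l_def[symmetric] by auto
  qed
  obtain j where j: "l = Suc j" using l1 by (cases l) auto
  have jm: "j < 2 ^ m" using lm j by simp
  have vj: "v (pt j) = W * (real j / 2 ^ m)" "v (pt (Suc j)) = W * (real (Suc j) / 2 ^ m)" using node[of j] node[of "Suc j"] jm by auto
  have "v (pt j) \<le> v x" "v x \<le> v (pt (Suc j))"
    using l1 l2 x pts[of j] pts[of "Suc j"] jm unfolding j by (auto intro!: mono)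
  then have y: "real j / 2 ^ m \<le> v x / W" "v x / W \<le> real (Suc j) / 2 ^ m"
    unfolding vj using W by (simp_all add: field_simps)
  have y': "real j \<le> 2 ^ m * (v x / W)" "2 ^ m * (v x / W) \<le> real j + 1"
    using y W by (simp_all add: field_simps)
  have quot: "(v x - v (pt j)) / (v (pt (Suc j)) - v (pt j)) = 2 ^ m * (v x / W) - real j"
    unfolding vj using W by (simp add: field_simps)
  have "interpolate v pt z x $ i = z (pt j) $ i + (2 ^ m * (v x / W) - real j) * (z (pt (Suc j)) $ i - z (pt j) $ i)"
    unfolding interpolate_def l_def[symmetric] j Let_def using quot by simp
  also have "\<dots> = dyadic_lin m f (v x / W)"
    unfolding dyadic_lin_def lin_eq[OF jm y'] using f[of j] f[of "Suc j"] jm by (simp add: mult.commute)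
  finally show ?thesis .
qed

text \<open>The inner integral is an increment of the interpolated path, and \<open>lin_primitive\<close> is a primitive of
  the outer one, with a remainder that is quadratic in \<open>v\<close>.\<close>

lemma level2_interpolate:
  fixes z :: "real \<Rightarrow> real^2" and v :: "real \<Rightarrow> real" and pt :: "nat \<Rightarrow> real"
  assumes W: "0 < W" "v (pt 0) = 0" "v (pt (2 ^ m)) = W"
    and node: "\<And>l. l \<le> 2 ^ m \<Longrightarrow> v (pt l) = W * (real l / 2 ^ m)"
    and mono: "\<And>x y. pt 0 \<le> x \<Longrightarrow> x \<le> y \<Longrightarrow> y \<le> pt (2 ^ m) \<Longrightarrow> v x \<le> v y"
    and cont: "continuous_on {pt 0..pt (2 ^ m)} v"
    and pts: "\<And>l. l \<le> 2 ^ m \<Longrightarrow> pt 0 \<le> pt l \<and> pt l \<le> pt (2 ^ m)"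
    and f: "\<And>i l. l \<le> 2 ^ m \<Longrightarrow> z (pt l) $ i = f i (real l / 2 ^ m)"
    and ab: "pt 0 \<le> a" "a \<le> b" "b \<le> pt (2 ^ m)"
  shows "level2 (interpolate v pt z) a b $ i $ j = dyadic_area m (f i) (f j) (v a / W) (v b / W)"
proof -
  let ?z = "interpolate v pt z"
  have comp: "?z x $ i = dyadic_lin m (f i) (v x / W)" if "pt 0 \<le> x" "x \<le> pt (2 ^ m)" for x i
    by (rule interpolate_component[where pt = pt and f = "f i"]) (use W(1) that node mono pts f in auto)
  define V where "V x = 2 ^ m * (v x / W)" for x
  define \<phi> where "\<phi> i l = f i (real l / 2 ^ m)" for i and l :: nat
  define \<Psi> where "\<Psi> x = lin_primitive (2 ^ m) (\<phi> i) (\<phi> j) (V x) - dyadic_lin m (f i) (v a / W) * dyadic_lin m (f j) (v x / W)" for x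
  have lin: "dyadic_lin m (f i) (v x / W) = lin (2 ^ m) (\<phi> i) (V x)" for x i
    unfolding dyadic_lin_def \<phi>_def[abs_def] V_def ..
  have Vm: "V x \<le> V y" if "pt 0 \<le> x" "x \<le> y" "y \<le> pt (2 ^ m)" for x y
    unfolding V_def using mono[OF that] W by (intro mult_left_mono divide_right_mono) auto
  have V0: "0 \<le> V x" "V x \<le> 2 ^ m" if "pt 0 \<le> x" "x \<le> pt (2 ^ m)" for x
    using mono[of "pt 0" x] mono[of x "pt (2 ^ m)"] that W by (auto simp: V_def field_simps)
  have inner: "RS_integral (\<lambda>_. 1) (\<lambda>u. ?z u $ i) a u2 = ?z u2 $ i - ?z a $ i" if "a \<le> u2" for u2
    by (rule RS_integral_eq) (rule has_RS_integral_one[OF that])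
  have "has_RS_integral (\<lambda>u. lin (2 ^ m) (\<phi> i) (V u) - lin (2 ^ m) (\<phi> i) (V a)) (\<lambda>u. lin (2 ^ m) (\<phi> j) (V u)) a b (\<Psi> b - \<Psi> a)"
  proof (rule has_RS_integral_primitive[where V = V])
    show "continuous_on {a..b} V"
      unfolding V_def using W by (intro continuous_intros continuous_on_subset[OF cont]) (use ab in auto)
    show "mono_on {a..b} V" using ab by (intro mono_onI Vm) auto
    show "a \<le> b" by (rule ab)
    show "0 \<le> (\<Sum>l<2 ^ m. \<bar>\<phi> i (Suc l) - \<phi> i l\<bar>) * (\<Sum>l<2 ^ m. \<bar>\<phi> j (Suc l) - \<phi> j l\<bar>)"
      by (intro mult_nonneg_nonneg sum_nonneg) auto
    fix c x d assume cd: "a \<le> c" "c \<le> x" "x \<le> d" "d \<le> b"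
    have "\<Psi> d - \<Psi> c - (lin (2 ^ m) (\<phi> i) (V x) - lin (2 ^ m) (\<phi> i) (V a)) * (lin (2 ^ m) (\<phi> j) (V d) - lin (2 ^ m) (\<phi> j) (V c))
      = lin_primitive (2 ^ m) (\<phi> i) (\<phi> j) (V d) - lin_primitive (2 ^ m) (\<phi> i) (\<phi> j) (V c)
       - lin (2 ^ m) (\<phi> i) (V x) * (lin (2 ^ m) (\<phi> j) (V d) - lin (2 ^ m) (\<phi> j) (V c))"
      unfolding \<Psi>_def lin by (simp add: algebra_simps)
    also have "\<bar>\<dots>\<bar> \<le> (\<Sum>l<2 ^ m. \<bar>\<phi> i (Suc l) - \<phi> i l\<bar>) * (\<Sum>l<2 ^ m. \<bar>\<phi> j (Suc l) - \<phi> j l\<bar>) * (V d - V c)\<^sup>2"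
      using cd ab by (intro lin_primitive_remainder Vm V0) (auto intro: V0(2)[of d, simplified])
    finally show "\<bar>\<Psi> d - \<Psi> c - (lin (2 ^ m) (\<phi> i) (V x) - lin (2 ^ m) (\<phi> i) (V a)) * (lin (2 ^ m) (\<phi> j) (V d) - lin (2 ^ m) (\<phi> j) (V c))\<bar>
      \<le> (\<Sum>l<2 ^ m. \<bar>\<phi> i (Suc l) - \<phi> i l\<bar>) * (\<Sum>l<2 ^ m. \<bar>\<phi> j (Suc l) - \<phi> j l\<bar>) * (V d - V c)\<^sup>2" .
  qed
  then have "has_RS_integral (\<lambda>u2. RS_integral (\<lambda>u1. 1) (\<lambda>u. ?z u $ i) a u2) (\<lambda>u. ?z u $ j) a b (\<Psi> b - \<Psi> a)"
    by (subst has_RS_integral_cong[where f' = "\<lambda>u. lin (2 ^ m) (\<phi> i) (V u) - lin (2 ^ m) (\<phi> i) (V a)"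
          and G' = "\<lambda>u. lin (2 ^ m) (\<phi> j) (V u)"])
       (use ab in \<open>auto simp: inner comp lin\<close>)
  then have "level2 ?z a b $ i $ j = \<Psi> b - \<Psi> a"
    unfolding level2_def by (simp add: RS_integral_eq)
  also have "\<dots> = dyadic_area m (f i) (f j) (v a / W) (v b / W)"
    unfolding \<Psi>_def dyadic_area_def lin_area_def lin \<phi>_def[abs_def] V_def by (simp add: algebra_simps)
  finally show ?thesis .
qed

section \<open>The potential kernel\<close>

text \<open>Up to a constant, a bound for \<open>\<integral>\<^sub>0\<^sup>t exp (- \<sigma> s \<bar>v\<bar> powr \<alpha>) ds\<close>, the Fourier transform of the
  potential density of the stable process up to time \<open>t\<close>.\<close>

definition stable_kernel :: "real \<Rightarrow> real \<Rightarrow> real" where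
  "stable_kernel \<alpha> v = 1 / (1 + \<bar>v\<bar> powr \<alpha>)"

lemma stable_kernel_pos: "0 < stable_kernel \<alpha> v"
  unfolding stable_kernel_def by (intro divide_pos_pos add_pos_nonneg) auto

lemma measurable_stable_kernel [measurable]: "stable_kernel \<alpha> \<in> borel_measurable borel"
  unfolding stable_kernel_def[abs_def] by measurable

text \<open>Since \<open>w = (w + v) - v\<close>, one of \<open>\<bar>v\<bar>\<close> and \<open>\<bar>w + v\<bar>\<close> is at least \<open>\<bar>w\<bar> / 2\<close>.\<close>

lemma stable_kernel_mult_le:
  assumes "0 < \<alpha>" "\<alpha> \<le> 2"
  shows "stable_kernel \<alpha> v * stable_kernel \<alpha> (w + v)
     \<le> 4 * stable_kernel \<alpha> w * (stable_kernel \<alpha> v + stable_kernel \<alpha> (w + v))"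
proof -
  define m where "m = max \<bar>v\<bar> \<bar>w + v\<bar>"
  define x y z where "x = 1 + \<bar>v\<bar> powr \<alpha>" and "y = 1 + \<bar>w + v\<bar> powr \<alpha>" and "z = 1 + \<bar>w\<bar> powr \<alpha>"
  have pos: "0 < x" "0 < y" "0 < z" by (auto simp: x_def y_def z_def intro!: add_pos_nonneg)
  have "\<bar>v\<bar> \<le> m" "\<bar>w + v\<bar> \<le> m" by (auto simp: m_def)
  then have "\<bar>w\<bar> \<le> 2 * m" by linarith
  then have "\<bar>w\<bar> powr \<alpha> \<le> (2 * m) powr \<alpha>" using assms by (intro powr_mono2) auto
  also have "\<dots> = 2 powr \<alpha> * m powr \<alpha>" by (subst powr_mult) (auto simp: m_def)
  also have "\<dots> \<le> 2 powr 2 * m powr \<alpha>" using assms by (intro mult_right_mono powr_mono) auto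
  also have "m powr \<alpha> \<le> \<bar>v\<bar> powr \<alpha> + \<bar>w + v\<bar> powr \<alpha>" unfolding m_def max_def by auto
  finally have "z \<le> 4 * (x + y)" unfolding x_def y_def z_def by (simp add: powr_numeral)
  then have "z * (1 / (x * y * z)) \<le> 4 * (x + y) * (1 / (x * y * z))"
    using pos by (intro mult_right_mono) auto
  then have "1 / x * (1 / y) \<le> 4 * (1 / z) * (1 / x + 1 / y)"
    using pos by (simp add: field_simps)
  then show ?thesis unfolding stable_kernel_def x_def y_def z_def .
qed

lemma nn_integral_powr_tail:
  assumes "1 < \<alpha>"
  shows "(\<integral>\<^sup>+v. ennreal (indicator {1..} v * v powr - \<alpha>) \<partial>lborel) < \<infinity>"
proof -
  have "((\<lambda>x. x powr - \<alpha>) has_integral - (1 powr (- \<alpha> + 1)) / (- \<alpha> + 1)) {1..}"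
    using assms by (intro has_integral_powr_to_inf) auto
  from nn_integral_has_integral_lebesgue[OF _ this] show ?thesis by simp
qed

text \<open>Bounded near the origin and dominated by an integrable power at infinity.\<close>

lemma nn_integral_power_decay:
  assumes "1 < \<alpha>" and [measurable]: "f \<in> borel_measurable borel"
    and C: "0 \<le> C" "\<And>v. f v \<le> C" "\<And>v. v \<noteq> 0 \<Longrightarrow> f v \<le> C * \<bar>v\<bar> powr - \<alpha>"
  shows "(\<integral>\<^sup>+v. ennreal (f v) \<partial>lborel) < \<infinity>"
proof -
  let ?t = "\<lambda>v::real. indicator {1..} v * v powr - \<alpha>"
  have "f v \<le> C * (indicator {-1..1} v + ?t v + ?t (- v))" for v
  proof -
    consider "\<bar>v\<bar> \<le> 1" | "1 < v" | "v < -1" by linarith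
    then show ?thesis
    proof cases
      case 1
      then have "0 \<le> ?t v" "0 \<le> ?t (- v)" "indicator {-1..1} v = (1::real)"
        by (auto simp: indicator_def abs_le_iff)
      then have "C * 1 \<le> C * (indicator {-1..1} v + ?t v + ?t (- v))" using C by (intro mult_left_mono) auto
      then show ?thesis using C(2)[of v] by simp
    qed (use C(3)[of v] in auto)
  qed
  then have "(\<integral>\<^sup>+v. ennreal (f v) \<partial>lborel) \<le> (\<integral>\<^sup>+v. ennreal C * (indicator {-1..1} v + ennreal (?t v) + ennreal (?t (- v))) \<partial>lborel)"
    using C(1) by (intro nn_integral_mono)
      (auto simp: ennreal_mult[symmetric] ennreal_plus[symmetric] ennreal_indicator[symmetric] simp del: ennreal_plus intro!: ennreal_leI)
  also have "\<dots> = ennreal C * (emeasure lborel {-1..1::real} + (\<integral>\<^sup>+v. ennreal (?t v) \<partial>lborel) + (\<integral>\<^sup>+v. ennreal (?t (- v)) \<partial>lborel))"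
    by (simp add: nn_integral_cmult nn_integral_add)
  also have "(\<integral>\<^sup>+v. ennreal (?t (- v)) \<partial>lborel) = (\<integral>\<^sup>+v. ennreal (?t v) \<partial>lborel)"
    by (subst (2) nn_integral_real_affine[where c = "-1" and t = 0]) auto
  also have "ennreal C * (emeasure lborel {-1..1::real} + (\<integral>\<^sup>+v. ennreal (?t v) \<partial>lborel) + (\<integral>\<^sup>+v. ennreal (?t v) \<partial>lborel)) < \<infinity>"
    using nn_integral_powr_tail[OF assms(1)] by (simp add: ennreal_mult_less_top)
  finally show ?thesis .
qed

lemma stable_kernel_le:
  "stable_kernel \<alpha> v \<le> 1" "v \<noteq> 0 \<Longrightarrow> stable_kernel \<alpha> v \<le> \<bar>v\<bar> powr - \<alpha>"
proof -
  have p: "0 \<le> \<bar>v\<bar> powr \<alpha>" by simp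
  show "stable_kernel \<alpha> v \<le> 1" unfolding stable_kernel_def using p by (simp add: divide_le_eq_1 add_pos_nonneg)
  assume "v \<noteq> 0"
  then show "stable_kernel \<alpha> v \<le> \<bar>v\<bar> powr - \<alpha>"
    unfolding stable_kernel_def powr_minus_divide by (intro divide_left_mono mult_pos_pos add_pos_nonneg) auto
qed

lemma nn_integral_stable_kernel:
  assumes "1 < \<alpha>"
  shows "(\<integral>\<^sup>+v. ennreal (stable_kernel \<alpha> v) \<partial>lborel) < \<infinity>"
  using assms stable_kernel_le by (intro nn_integral_power_decay[where C = 1]) auto

text \<open>Writing \<open>T\<^sub>n = \<surd>k f\<^sub>n\<close>, the recursion says that \<open>f\<^sub>n\<^sub>+\<^sub>1\<close> is at most the image of \<open>f\<^sub>n\<close> under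
  the integral operator with kernel \<open>\<surd>k(v) F(u - v) \<surd>k(u)\<close>. Since \<open>k \<star> k\<close> is bounded by a multiple
  of \<open>k\<close>, its Hilbert--Schmidt norm is controlled by the energy \<open>\<integral> F\<^sup>2 k\<close>.\<close>

lemma kernel_chain_bound:
  fixes k :: "real \<Rightarrow> real" and F :: "real \<Rightarrow> ennreal" and T :: "nat \<Rightarrow> real \<Rightarrow> ennreal"
  assumes [measurable]: "k \<in> borel_measurable borel" "F \<in> borel_measurable borel" "\<And>n. T n \<in> borel_measurable borel"
    and k: "\<And>v. 0 < k v" and A: "0 \<le> A" and kk: "\<And>v w. k v * k (w + v) \<le> A * k w * (k v + k (w + v))"
    and T0: "\<And>v. T 0 v \<le> ennreal (k v)"
    and TS: "\<And>n v. T (Suc n) v \<le> ennreal (k v) * (\<integral>\<^sup>+u. F u * T n (u + v) \<partial>lborel)"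
  defines "\<kappa> \<equiv> (\<integral>\<^sup>+v. ennreal (k v) \<partial>lborel)"
    and "B \<equiv> (\<integral>\<^sup>+u. F u ^ 2 * ennreal (k u) \<partial>lborel)"
  shows "(\<integral>\<^sup>+u. F u * T n u \<partial>lborel)\<^sup>2 \<le> B * ((ennreal (2 * A) * \<kappa> * B) ^ n * \<kappa>)"
proof -
  define s where "s v = sqrt (k v)" for v
  have [measurable]: "s \<in> borel_measurable borel" unfolding s_def[abs_def] by measurable
  have s: "0 < s v" "s v * s v = k v" for v using k[of v] by (auto simp: s_def)
  have s1: "ennreal (s v) * ennreal (1 / s v) = 1" for v
    using s(1)[of v] by (simp add: ennreal_mult[symmetric])
  have s2: "(ennreal (s v))\<^sup>2 = ennreal (k v)" for v
    using s[of v] by (simp add: power2_eq_square ennreal_mult[symmetric])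
  have s3: "ennreal (k v) * ennreal (1 / s v) = ennreal (s v)" for v
  proof -
    have "k v * (1 / s v) = s v" unfolding s(2)[symmetric] using s(1)[of v] by simp
    then show ?thesis using k[of v] s(1)[of v] by (simp add: ennreal_mult[symmetric] less_imp_le del: times_divide_eq_right)
  qed
  define J where "J n = (\<integral>\<^sup>+v. (T n v * ennreal (1 / s v))\<^sup>2 \<partial>lborel)" for n
  have CS: "(\<integral>\<^sup>+u. G u * T n u \<partial>lborel)\<^sup>2 \<le> (\<integral>\<^sup>+u. G u ^ 2 * ennreal (k u) \<partial>lborel) * J n"
    if [measurable]: "G \<in> borel_measurable borel" for G n
  proof -
    have "(\<integral>\<^sup>+u. G u * T n u \<partial>lborel) = (\<integral>\<^sup>+u. (G u * ennreal (s u)) * (T n u * ennreal (1 / s u)) \<partial>lborel)"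
    proof (intro nn_integral_cong)
      fix u
      have "(G u * ennreal (s u)) * (T n u * ennreal (1 / s u)) = (G u * T n u) * (ennreal (s u) * ennreal (1 / s u))"
        by (simp only: mult_ac)
      then show "G u * T n u = (G u * ennreal (s u)) * (T n u * ennreal (1 / s u))" unfolding s1 by simp
    qed
    also have "\<dots>\<^sup>2 \<le> (\<integral>\<^sup>+u. (G u * ennreal (s u))\<^sup>2 \<partial>lborel) * (\<integral>\<^sup>+u. (T n u * ennreal (1 / s u))\<^sup>2 \<partial>lborel)"
      by (intro Cauchy_Schwarz_nn_integral) auto
    finally show ?thesis unfolding J_def power_mult_distrib[of "G _"] s2 .
  qed
  have J0: "J 0 \<le> \<kappa>"
    unfolding J_def \<kappa>_def
  proof (rule nn_integral_mono)
    fix v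
    have "T 0 v * ennreal (1 / s v) \<le> ennreal (s v)"
      using mult_right_mono[OF T0[of v], of "ennreal (1 / s v)"] unfolding s3 by simp
    from power_mono[OF this, of 2] show "(T 0 v * ennreal (1 / s v))\<^sup>2 \<le> ennreal (k v)" unfolding s2 by simp
  qed
  have shift: "(\<integral>\<^sup>+u. h u \<partial>lborel) = (\<integral>\<^sup>+u. h (t + u) \<partial>lborel)"
    if "h \<in> borel_measurable borel" for h :: "real \<Rightarrow> ennreal" and t
    using nn_integral_real_affine[OF that, of 1 t] by simp
  have conv: "(\<integral>\<^sup>+v. ennreal (k v) * ennreal (k (w + v)) \<partial>lborel) \<le> ennreal (2 * A) * \<kappa> * ennreal (k w)" for w
  proof -
    have "(\<integral>\<^sup>+v. ennreal (k v) * ennreal (k (w + v)) \<partial>lborel)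
       \<le> (\<integral>\<^sup>+v. ennreal (A * k w) * (ennreal (k v) + ennreal (k (w + v))) \<partial>lborel)"
    proof (rule nn_integral_mono)
      fix v
      have "ennreal (k v) * ennreal (k (w + v)) = ennreal (k v * k (w + v))" using k[of v] by (simp add: ennreal_mult')
      also have "\<dots> \<le> ennreal (A * k w * (k v + k (w + v)))" by (rule ennreal_leI[OF kk])
      also have "\<dots> = ennreal (A * k w) * (ennreal (k v) + ennreal (k (w + v)))"
        using k[of v] k[of w] k[of "w + v"] A by (subst ennreal_mult) (auto simp: less_imp_le)
      finally show "ennreal (k v) * ennreal (k (w + v)) \<le> ennreal (A * k w) * (ennreal (k v) + ennreal (k (w + v)))" .
    qed
    also have "\<dots> = ennreal (A * k w) * (\<kappa> + \<kappa>)"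
      using shift[of "\<lambda>v. ennreal (k v)" w] by (simp add: nn_integral_cmult nn_integral_add \<kappa>_def)
    also have "\<dots> = ennreal (2 * A) * \<kappa> * ennreal (k w)"
      using A k[of w] by (simp add: ennreal_mult less_imp_le mult_2[symmetric] mult_ac)
    finally show ?thesis .
  qed
  have JS: "J (Suc n) \<le> ennreal (2 * A) * \<kappa> * B * J n" for n
  proof -
    have "J (Suc n) \<le> (\<integral>\<^sup>+v. ennreal (k v) * ((\<integral>\<^sup>+u. F (u - v) ^ 2 * ennreal (k u) \<partial>lborel) * J n) \<partial>lborel)"
      unfolding J_def[of "Suc n"]
    proof (rule nn_integral_mono)
      fix v
      have "(\<integral>\<^sup>+u. F u * T n (u + v) \<partial>lborel) = (\<integral>\<^sup>+u. F (u - v) * T n u \<partial>lborel)"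
        by (subst shift[where t = "- v"]) auto
      then have "T (Suc n) v \<le> ennreal (k v) * (\<integral>\<^sup>+u. F (u - v) * T n u \<partial>lborel)"
        using TS[of n v] by simp
      then have "T (Suc n) v * ennreal (1 / s v) \<le> ennreal (k v) * (\<integral>\<^sup>+u. F (u - v) * T n u \<partial>lborel) * ennreal (1 / s v)"
        by (rule mult_right_mono) simp
      also have "\<dots> = (ennreal (k v) * ennreal (1 / s v)) * (\<integral>\<^sup>+u. F (u - v) * T n u \<partial>lborel)"
        by (simp only: mult_ac)
      finally have "T (Suc n) v * ennreal (1 / s v) \<le> ennreal (s v) * (\<integral>\<^sup>+u. F (u - v) * T n u \<partial>lborel)"
        unfolding s3 .
      from power_mono[OF this, of 2]
      have "(T (Suc n) v * ennreal (1 / s v))\<^sup>2 \<le> ennreal (k v) * (\<integral>\<^sup>+u. F (u - v) * T n u \<partial>lborel)\<^sup>2"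
        by (simp add: power_mult_distrib s2)
      also have "\<dots> \<le> ennreal (k v) * ((\<integral>\<^sup>+u. F (u - v) ^ 2 * ennreal (k u) \<partial>lborel) * J n)"
        by (intro mult_left_mono CS) auto
      finally show "(T (Suc n) v * ennreal (1 / s v))\<^sup>2 \<le> ennreal (k v) * ((\<integral>\<^sup>+u. F (u - v) ^ 2 * ennreal (k u) \<partial>lborel) * J n)" .
    qed
    also have "\<dots> = (\<integral>\<^sup>+v. ennreal (k v) * (\<integral>\<^sup>+u. F (u - v) ^ 2 * ennreal (k u) \<partial>lborel) \<partial>lborel) * J n"
      unfolding mult.assoc[symmetric] by (rule nn_integral_multc) measurable
    also have "\<dots> = (\<integral>\<^sup>+v. \<integral>\<^sup>+u. ennreal (k v) * (F (u - v) ^ 2 * ennreal (k u)) \<partial>lborel \<partial>lborel) * J n"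
      by (simp add: nn_integral_cmult)
    also have "(\<integral>\<^sup>+v. \<integral>\<^sup>+u. ennreal (k v) * (F (u - v) ^ 2 * ennreal (k u)) \<partial>lborel \<partial>lborel)
       = (\<integral>\<^sup>+v. \<integral>\<^sup>+w. F w ^ 2 * (ennreal (k v) * ennreal (k (w + v))) \<partial>lborel \<partial>lborel)"
    proof (rule nn_integral_cong)
      fix v
      show "(\<integral>\<^sup>+u. ennreal (k v) * (F (u - v) ^ 2 * ennreal (k u)) \<partial>lborel) = (\<integral>\<^sup>+w. F w ^ 2 * (ennreal (k v) * ennreal (k (w + v))) \<partial>lborel)"
        by (subst shift[where t = v]) (auto simp: mult_ac add.commute)
    qed
    also have "\<dots> = (\<integral>\<^sup>+w. \<integral>\<^sup>+v. F w ^ 2 * (ennreal (k v) * ennreal (k (w + v))) \<partial>lborel \<partial>lborel)"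
      by (rule lborel_pair.Fubini') measurable
    also have "\<dots> \<le> (\<integral>\<^sup>+w. F w ^ 2 * (ennreal (2 * A) * \<kappa> * ennreal (k w)) \<partial>lborel)"
      by (intro nn_integral_mono) (simp add: nn_integral_cmult mult_left_mono conv)
    also have "\<dots> = ennreal (2 * A) * \<kappa> * B"
      unfolding B_def by (subst nn_integral_cmult[symmetric]) (auto simp: mult_ac)
    finally show ?thesis by (simp add: mult_right_mono)
  qed
  have "J n \<le> (ennreal (2 * A) * \<kappa> * B) ^ n * \<kappa>"
  proof (induction n)
    case (Suc n)
    have "J (Suc n) \<le> ennreal (2 * A) * \<kappa> * B * ((ennreal (2 * A) * \<kappa> * B) ^ n * \<kappa>)"
      using JS[of n] Suc by (meson mult_left_mono order_trans zero_le)
    then show ?case by (simp add: mult.assoc)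
  qed (use J0 in simp)
  then have "B * J n \<le> B * ((ennreal (2 * A) * \<kappa> * B) ^ n * \<kappa>)" by (intro mult_left_mono) auto
  then show ?thesis using CS[of F n] unfolding B_def by simp
qed

section \<open>Energy of step functions\<close>

lemma powr_add_le:
  fixes a b \<beta> :: real
  assumes "0 \<le> a" "0 \<le> b" "0 < \<beta>" "\<beta> \<le> 1"
  shows "(a + b) powr \<beta> \<le> a powr \<beta> + b powr \<beta>"
proof (cases "a + b = 0")
  case False
  then have ab: "0 < a + b" using assms by simp
  have "x * (a + b) powr \<beta> \<le> (x * (a + b)) powr \<beta>" if "0 \<le> x" "x \<le> 1" for x
  proof -
    have "x \<le> x powr \<beta>"
    proof (cases "x = 0")
      case False
      then have "x = x powr 1" using that by simp
      also have "\<dots> \<le> x powr \<beta>" using that assms by (intro powr_mono') auto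
      finally show ?thesis .
    qed simp
    then have "x * (a + b) powr \<beta> \<le> x powr \<beta> * (a + b) powr \<beta>" by (intro mult_right_mono) auto
    then show ?thesis using that ab by (subst powr_mult) auto
  qed
  from this[of "a / (a + b)"] this[of "b / (a + b)"]
  have "(a / (a + b)) * (a + b) powr \<beta> + (b / (a + b)) * (a + b) powr \<beta> \<le> a powr \<beta> + b powr \<beta>"
    using assms ab by (auto simp: divide_le_eq_1)
  moreover have "(a / (a + b)) * (a + b) powr \<beta> + (b / (a + b)) * (a + b) powr \<beta> = (a / (a + b) + b / (a + b)) * (a + b) powr \<beta>"
    by (simp only: distrib_right)
  moreover have "a / (a + b) + b / (a + b) = 1" using ab by (simp add: add_divide_distrib[symmetric])
  ultimately show ?thesis by simp
qed (use assms in auto)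

lemma powr_increment_antimono:
  fixes s t h \<beta> :: real
  assumes "0 \<le> s" "s \<le> t" "0 \<le> h" "0 < \<beta>" "\<beta> \<le> 1"
  shows "(t + h) powr \<beta> - t powr \<beta> \<le> (s + h) powr \<beta> - s powr \<beta>"
proof (cases "s = 0")
  case True
  then show ?thesis using powr_add_le[of t h \<beta>] assms by simp
next
  case False
  show ?thesis
  proof (rule DERIV_nonpos_imp_nonincreasing[OF assms(2), of "\<lambda>y. (y + h) powr \<beta> - y powr \<beta>"])
    fix y assume y: "s \<le> y" "y \<le> t"
    then have "((\<lambda>y. (y + h) powr \<beta> - y powr \<beta>) has_real_derivative \<beta> * (y + h) powr (\<beta> - 1) - \<beta> * y powr (\<beta> - 1)) (at y)"
      using False assms by (auto intro!: derivative_eq_intros)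
    moreover have "(y + h) powr (\<beta> - 1) \<le> y powr (\<beta> - 1)"
      using y False assms by (intro powr_mono2') auto
    then have "\<beta> * (y + h) powr (\<beta> - 1) - \<beta> * y powr (\<beta> - 1) \<le> 0" using assms by (simp add: mult_left_mono)
    ultimately show "\<exists>z. ((\<lambda>y. (y + h) powr \<beta> - y powr \<beta>) has_real_derivative z) (at y) \<and> z \<le> 0" by blast
  qed
qed

text \<open>Covariance of the increments over \<open>[x l, x (l + 1)]\<close> and \<open>[x r, x (r + 1)]\<close> of fractional
  Brownian motion of Hurst index \<open>\<beta>/2\<close>, up to a constant factor.\<close>

definition fbm_cov :: "real \<Rightarrow> (nat \<Rightarrow> real) \<Rightarrow> nat \<Rightarrow> nat \<Rightarrow> real" where
  "fbm_cov \<beta> x l r = \<bar>x (Suc l) - x r\<bar> powr \<beta> + \<bar>x l - x (Suc r)\<bar> powr \<beta>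
     - \<bar>x (Suc l) - x (Suc r)\<bar> powr \<beta> - \<bar>x l - x r\<bar> powr \<beta>"

lemma fbm_cov_sym: "fbm_cov \<beta> x l r = fbm_cov \<beta> x r l"
  unfolding fbm_cov_def by (simp add: abs_minus_commute)

lemma mono_upto:
  fixes x :: "nat \<Rightarrow> real"
  assumes "\<And>l. l < n \<Longrightarrow> x l \<le> x (Suc l)" "i \<le> j" "j \<le> n"
  shows "x i \<le> x j"
  using assms(2,3)
proof (induction j rule: dec_induct)
  case (step j)
  then show ?case using assms(1)[of j] by auto
qed simp

text \<open>For \<open>\<beta> \<le> 1\<close> increments over disjoint intervals are negatively correlated, so the absolute
  values of the covariances with one increment telescope.\<close>

lemma fbm_cov_row_sum:
  assumes x: "\<And>l. l < n \<Longrightarrow> x l \<le> x (Suc l)" and \<beta>: "0 < \<beta>" "\<beta> \<le> 1" and l: "l < n"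
  shows "(\<Sum>r\<in>{Suc l..<n}. \<bar>fbm_cov \<beta> x l r\<bar>) \<le> (x (Suc l) - x l) powr \<beta>"
proof -
  define D where "D r = (x r - x l) powr \<beta> - (x r - x (Suc l)) powr \<beta>" for r
  have "\<bar>fbm_cov \<beta> x l r\<bar> = D r - D (Suc r)" if r: "r \<in> {Suc l..<n}" for r
  proof -
    have o: "x l \<le> x (Suc l)" "x (Suc l) \<le> x r" "x r \<le> x (Suc r)"
      using mono_upto[of n x "Suc l" r] x l r by auto
    have e: "fbm_cov \<beta> x l r = D (Suc r) - D r"
    proof -
      have "\<bar>x (Suc l) - x r\<bar> = x r - x (Suc l)" "\<bar>x l - x (Suc r)\<bar> = x (Suc r) - x l"
        "\<bar>x (Suc l) - x (Suc r)\<bar> = x (Suc r) - x (Suc l)" "\<bar>x l - x r\<bar> = x r - x l"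
        using o by linarith+
      then show ?thesis unfolding fbm_cov_def D_def by simp
    qed
    have "D (Suc r) \<le> D r"
      using powr_increment_antimono[of "x r - x (Suc l)" "x (Suc r) - x (Suc l)" "x (Suc l) - x l" \<beta>] o \<beta>
      by (simp add: D_def)
    then show ?thesis unfolding e by simp
  qed
  then have "(\<Sum>r\<in>{Suc l..<n}. \<bar>fbm_cov \<beta> x l r\<bar>) = (\<Sum>r\<in>{Suc l..<n}. D r - D (Suc r))" by simp
  also have "\<dots> = D (Suc l) - D n" using sum_Suc_diff'[of "Suc l" n "\<lambda>r. - D r"] l by (simp add: algebra_simps)
  also have "\<dots> \<le> D (Suc l)"
  proof -
    have "x l \<le> x (Suc l)" "x (Suc l) \<le> x n" using mono_upto[of n x "Suc l" n] x l by auto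
    then have "(x n - x (Suc l)) powr \<beta> \<le> (x n - x l) powr \<beta>" using \<beta> by (intro powr_mono2) auto
    then show ?thesis by (simp add: D_def)
  qed
  finally show ?thesis by (simp add: D_def)
qed

lemma fbm_cov_double_sum:
  assumes x: "\<And>l. l < n \<Longrightarrow> x l \<le> x (Suc l)" and \<beta>: "0 < \<beta>" "\<beta> \<le> 1"
  shows "(\<Sum>l<n. \<Sum>r<n. \<bar>fbm_cov \<beta> x l r\<bar>) \<le> 4 * (\<Sum>l<n. (x (Suc l) - x l) powr \<beta>)"
proof -
  let ?U = "\<Sum>l<n. \<Sum>r\<in>{Suc l..<n}. \<bar>fbm_cov \<beta> x l r\<bar>"
  have "(\<Sum>l<n. \<Sum>r<n. \<bar>fbm_cov \<beta> x l r\<bar>)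
     = (\<Sum>l<n. (\<Sum>r<l. \<bar>fbm_cov \<beta> x l r\<bar>) + \<bar>fbm_cov \<beta> x l l\<bar> + (\<Sum>r\<in>{Suc l..<n}. \<bar>fbm_cov \<beta> x l r\<bar>))"
  proof (intro sum.cong refl)
    fix l assume "l \<in> {..<n}"
    then have split: "{..<n} = insert l ({..<l} \<union> {Suc l..<n})" by auto
    have "(\<Sum>r<n. \<bar>fbm_cov \<beta> x l r\<bar>) = \<bar>fbm_cov \<beta> x l l\<bar> + (\<Sum>r\<in>{..<l} \<union> {Suc l..<n}. \<bar>fbm_cov \<beta> x l r\<bar>)"
      unfolding split by (rule sum.insert) auto
    also have "(\<Sum>r\<in>{..<l} \<union> {Suc l..<n}. \<bar>fbm_cov \<beta> x l r\<bar>) = (\<Sum>r<l. \<bar>fbm_cov \<beta> x l r\<bar>) + (\<Sum>r\<in>{Suc l..<n}. \<bar>fbm_cov \<beta> x l r\<bar>)"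
      by (rule sum.union_disjoint) auto
    finally show "(\<Sum>r<n. \<bar>fbm_cov \<beta> x l r\<bar>) = (\<Sum>r<l. \<bar>fbm_cov \<beta> x l r\<bar>) + \<bar>fbm_cov \<beta> x l l\<bar> + (\<Sum>r\<in>{Suc l..<n}. \<bar>fbm_cov \<beta> x l r\<bar>)"
      by simp
  qed
  also have "\<dots> = (\<Sum>l<n. \<Sum>r<l. \<bar>fbm_cov \<beta> x l r\<bar>) + (\<Sum>l<n. \<bar>fbm_cov \<beta> x l l\<bar>) + ?U"
    by (simp add: sum.distrib)
  also have "(\<Sum>l<n. \<Sum>r<l. \<bar>fbm_cov \<beta> x l r\<bar>) = ?U"
  proof -
    have "(\<Sum>l<n. \<Sum>r<l. \<bar>fbm_cov \<beta> x l r\<bar>) = (\<Sum>(l, r)\<in>(SIGMA l:{..<n}. {..<l}). \<bar>fbm_cov \<beta> x l r\<bar>)"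
      by (subst sum.Sigma) auto
    also have "\<dots> = (\<Sum>(r, l)\<in>(SIGMA r:{..<n}. {Suc r..<n}). \<bar>fbm_cov \<beta> x r l\<bar>)"
      by (rule sum.reindex_bij_witness[where i = "\<lambda>(a, b). (b, a)" and j = "\<lambda>(a, b). (b, a)"])
         (auto simp: fbm_cov_sym)
    also have "\<dots> = ?U" by (subst sum.Sigma) auto
    finally show ?thesis .
  qed
  also have "?U + (\<Sum>l<n. \<bar>fbm_cov \<beta> x l l\<bar>) + ?U \<le> (\<Sum>l<n. (x (Suc l) - x l) powr \<beta>)
     + (\<Sum>l<n. 2 * (x (Suc l) - x l) powr \<beta>) + (\<Sum>l<n. (x (Suc l) - x l) powr \<beta>)"
  proof (intro add_mono sum_mono)
    fix l assume "l \<in> {..<n}"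
    then show "(\<Sum>r\<in>{Suc l..<n}. \<bar>fbm_cov \<beta> x l r\<bar>) \<le> (x (Suc l) - x l) powr \<beta>"
      using fbm_cov_row_sum[of n x \<beta> l] x \<beta> by auto
    then show "(\<Sum>r\<in>{Suc l..<n}. \<bar>fbm_cov \<beta> x l r\<bar>) \<le> (x (Suc l) - x l) powr \<beta>" .
    show "\<bar>fbm_cov \<beta> x l l\<bar> \<le> 2 * (x (Suc l) - x l) powr \<beta>"
      using x[of l] \<open>l \<in> {..<n}\<close> by (simp add: fbm_cov_def abs_minus_commute[of "x l"])
  qed
  also have "\<dots> = 4 * (\<Sum>l<n. (x (Suc l) - x l) powr \<beta>)" by (simp add: sum_distrib_left[symmetric])
  finally show ?thesis .
qed

text \<open>The constant in \<open>\<integral> (1 - cos (u z)) \<bar>u\<bar> powr (- \<alpha>) du = levy_const \<alpha> \<bar>z\<bar> powr (\<alpha> - 1)\<close>, which follows by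
  scaling.\<close>

definition levy_const :: "real \<Rightarrow> real" where
  "levy_const \<alpha> = (\<integral>u. (1 - cos u) * \<bar>u\<bar> powr - \<alpha> \<partial>lborel)"

lemma one_minus_cos_le: "1 - cos u \<le> u\<^sup>2 / (2::real)"
proof -
  have "1 - cos u = 2 * (sin (u / 2))\<^sup>2" using cos_double_sin[of "u / 2"] by simp
  also have "(sin (u / 2))\<^sup>2 \<le> (u / 2)\<^sup>2"
    using abs_sin_x_le_abs_x[of "u / 2"] by (simp add: abs_le_square_iff[symmetric])
  finally show ?thesis by (simp add: power2_eq_square)
qed

lemma integrable_one_minus_cos:
  fixes \<alpha> z :: real
  assumes \<alpha>: "1 < \<alpha>" "\<alpha> < 2"
  shows "integrable lborel (\<lambda>u. (1 - cos (u * z)) * \<bar>u\<bar> powr - \<alpha>)"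
proof (rule integrableI_bounded)
  define C where "C = 2 + z\<^sup>2"
  have C: "2 \<le> C" by (simp add: C_def)
  have nn: "0 \<le> (1 - cos (u * z)) * \<bar>u\<bar> powr - \<alpha>" for u by simp
  have "(\<integral>\<^sup>+u. ennreal ((1 - cos (u * z)) * \<bar>u\<bar> powr - \<alpha>) \<partial>lborel) < \<infinity>"
  proof (rule nn_integral_power_decay[OF \<alpha>(1)])
    show "0 \<le> C" using C by simp
    have c2: "1 - cos (u * z) \<le> 2" for u using cos_ge_minus_one[of "u * z"] by linarith
    show d: "(1 - cos (u * z)) * \<bar>u\<bar> powr - \<alpha> \<le> C * \<bar>u\<bar> powr - \<alpha>" for u
      using order_trans[OF c2[of u] C] by (rule mult_right_mono) simp
    show "(1 - cos (u * z)) * \<bar>u\<bar> powr - \<alpha> \<le> C" for u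
    proof (cases "\<bar>u\<bar> \<le> 1")
      case True
      show ?thesis
      proof (cases "u = 0")
        case False
        have "(1 - cos (u * z)) * \<bar>u\<bar> powr - \<alpha> \<le> ((u * z)\<^sup>2 / 2) * \<bar>u\<bar> powr - \<alpha>"
          by (intro mult_right_mono one_minus_cos_le) auto
        also have "\<dots> = z\<^sup>2 / 2 * (\<bar>u\<bar> powr 2 * \<bar>u\<bar> powr - \<alpha>)"
          using False by (simp add: power_mult_distrib powr_numeral)
        also have "\<bar>u\<bar> powr 2 * \<bar>u\<bar> powr - \<alpha> = \<bar>u\<bar> powr (2 - \<alpha>)" by (simp only: powr_add[symmetric] add_uminus_conv_diff)
        also have "\<bar>u\<bar> powr (2 - \<alpha>) \<le> 1 powr (2 - \<alpha>)" using \<alpha> True by (intro powr_mono2) auto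
        also have "z\<^sup>2 / 2 * 1 powr (2 - \<alpha>) \<le> C" by (simp add: C_def add_increasing)
        finally show ?thesis by (simp add: mult_left_mono)
      qed (use C in simp)
    next
      case False
      have "C * \<bar>u\<bar> powr - \<alpha> \<le> C * \<bar>u\<bar> powr 0" using False C \<alpha> by (intro mult_left_mono powr_mono) auto
      then have "C * \<bar>u\<bar> powr - \<alpha> \<le> C" using False by (simp split: if_splits)
      then show ?thesis by (rule order_trans[OF d[of u]])
    qed
  qed auto
  then show "(\<integral>\<^sup>+u. ennreal (norm ((1 - cos (u * z)) * \<bar>u\<bar> powr - \<alpha>)) \<partial>lborel) < \<infinity>" by simp
qed auto

lemma integral_one_minus_cos:
  fixes \<alpha> z :: real
  assumes \<alpha>: "1 < \<alpha>" "\<alpha> < 2"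
  shows "(\<integral>u. (1 - cos (u * z)) * \<bar>u\<bar> powr - \<alpha> \<partial>lborel) = levy_const \<alpha> * \<bar>z\<bar> powr (\<alpha> - 1)"
proof (cases "z = 0")
  case False
  have "(\<integral>u. (1 - cos (u * z)) * \<bar>u\<bar> powr - \<alpha> \<partial>lborel)
     = \<bar>1 / z\<bar> *\<^sub>R (\<integral>u. (1 - cos ((0 + 1 / z * u) * z)) * \<bar>0 + 1 / z * u\<bar> powr - \<alpha> \<partial>lborel)"
    by (rule lborel_integral_real_affine) (use False in auto)
  also have "(\<integral>u. (1 - cos ((0 + 1 / z * u) * z)) * \<bar>0 + 1 / z * u\<bar> powr - \<alpha> \<partial>lborel)
     = (\<integral>u. \<bar>z\<bar> powr \<alpha> * ((1 - cos u) * \<bar>u\<bar> powr - \<alpha>) \<partial>lborel)"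
  proof (rule Bochner_Integration.integral_cong[OF refl])
    fix u
    have "\<bar>0 + 1 / z * u\<bar> powr - \<alpha> = \<bar>z\<bar> powr \<alpha> * \<bar>u\<bar> powr - \<alpha>"
      by (simp add: abs_mult powr_divide powr_minus_divide)
    then show "(1 - cos ((0 + 1 / z * u) * z)) * \<bar>0 + 1 / z * u\<bar> powr - \<alpha> = \<bar>z\<bar> powr \<alpha> * ((1 - cos u) * \<bar>u\<bar> powr - \<alpha>)"
      using False by simp
  qed
  also have "\<bar>1 / z\<bar> *\<^sub>R (\<integral>u. \<bar>z\<bar> powr \<alpha> * ((1 - cos u) * \<bar>u\<bar> powr - \<alpha>) \<partial>lborel) = (\<bar>z\<bar> powr \<alpha> / \<bar>z\<bar>) * levy_const \<alpha>"
    by (simp add: levy_const_def)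
  also have "\<bar>z\<bar> powr \<alpha> / \<bar>z\<bar> = \<bar>z\<bar> powr (\<alpha> - 1)" using False by (simp add: powr_diff)
  finally show ?thesis by simp
qed simp

lemma levy_const_nonneg: "0 \<le> levy_const \<alpha>"
  unfolding levy_const_def by (intro Bochner_Integration.integral_nonneg) auto

text \<open>The Fourier transform of the measure \<open>\<Sum> c\<^sub>l (\<delta>\<^bsub>x (l + 1)\<^esub> - \<delta>\<^bsub>x l\<^esub>)\<close>, the derivative of a step
  function.\<close>

definition step_transform :: "nat \<Rightarrow> (nat \<Rightarrow> real) \<Rightarrow> (nat \<Rightarrow> real) \<Rightarrow> real \<Rightarrow> complex" where
  "step_transform n c x u = (\<Sum>l<n. of_real (c l) * (iexp (- u * x (Suc l)) - iexp (- u * x l)))"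

lemma cmod_step_transform:
  "(cmod (step_transform n c x u))\<^sup>2 = (\<Sum>l<n. \<Sum>r<n. c l * c r *
     ((1 - cos (u * (x (Suc l) - x r))) + (1 - cos (u * (x l - x (Suc r))))
      - (1 - cos (u * (x (Suc l) - x (Suc r)))) - (1 - cos (u * (x l - x r)))))"
proof -
  define d where "d l = iexp (- u * x (Suc l)) - iexp (- u * x l)" for l
  have "complex_of_real ((cmod (step_transform n c x u))\<^sup>2) = step_transform n c x u * cnj (step_transform n c x u)"
    by (rule complex_norm_square)
  also have "\<dots> = (\<Sum>l<n. \<Sum>r<n. of_real (c l * c r) * (d l * cnj (d r)))"
    unfolding step_transform_def d_def[symmetric] cnj_sum sum_product by (simp add: mult_ac)
  finally have "(cmod (step_transform n c x u))\<^sup>2 = Re (\<Sum>l<n. \<Sum>r<n. of_real (c l * c r) * (d l * cnj (d r)))"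
    by (metis Re_complex_of_real)
  also have "\<dots> = (\<Sum>l<n. \<Sum>r<n. c l * c r * Re (d l * cnj (d r)))" by simp
  finally have *: "(cmod (step_transform n c x u))\<^sup>2 = (\<Sum>l<n. \<Sum>r<n. c l * c r * Re (d l * cnj (d r)))" .
  have "Re (d l * cnj (d r)) = (1 - cos (u * (x (Suc l) - x r))) + (1 - cos (u * (x l - x (Suc r))))
      - (1 - cos (u * (x (Suc l) - x (Suc r)))) - (1 - cos (u * (x l - x r)))" for l r
    unfolding d_def by (simp add: Re_exp Im_exp right_diff_distrib cos_diff algebra_simps)
  then show ?thesis unfolding * by simp
qed

text \<open>Expanding the square, the energy is the variance of \<open>\<Sum> c\<^sub>l (B(x\<^sub>l\<^sub>+\<^sub>1) - B(x\<^sub>l))\<close> for a multiple \<open>B\<close> of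
  fractional Brownian motion.\<close>

lemma step_transform_energy:
  assumes \<alpha>: "1 < \<alpha>" "\<alpha> < 2" and x: "\<And>l. l < n \<Longrightarrow> x l \<le> x (Suc l)"
    and c: "\<And>l. l < n \<Longrightarrow> \<bar>c l\<bar> \<le> b"
  shows "(\<integral>\<^sup>+u. ennreal ((cmod (step_transform n c x u))\<^sup>2 * \<bar>u\<bar> powr - \<alpha>) \<partial>lborel)
    \<le> ennreal (4 * levy_const \<alpha> * (b\<^sup>2 * (\<Sum>l<n. (x (Suc l) - x l) powr (\<alpha> - 1))))"
proof -
  define h where "h z u = (1 - cos (u * z)) * \<bar>u\<bar> powr - \<alpha>" for z u :: real
  have h: "integrable lborel (h z)" "integral\<^sup>L lborel (h z) = levy_const \<alpha> * \<bar>z\<bar> powr (\<alpha> - 1)" for z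
    using integrable_one_minus_cos[OF \<alpha>, of z] integral_one_minus_cos[OF \<alpha>, of z] by (auto simp: h_def[abs_def])
  have eq: "(cmod (step_transform n c x u))\<^sup>2 * \<bar>u\<bar> powr - \<alpha> = (\<Sum>l<n. \<Sum>r<n. c l * c r *
     (h (x (Suc l) - x r) u + h (x l - x (Suc r)) u - h (x (Suc l) - x (Suc r)) u - h (x l - x r) u))" for u
    unfolding cmod_step_transform h_def sum_distrib_right by (intro sum.cong refl) (simp add: algebra_simps)
  have int: "integrable lborel (\<lambda>u. (cmod (step_transform n c x u))\<^sup>2 * \<bar>u\<bar> powr - \<alpha>)"
    unfolding eq by (intro Bochner_Integration.integrable_sum integrable_mult_right
        Bochner_Integration.integrable_add Bochner_Integration.integrable_diff h)
  have "(\<integral>u. (cmod (step_transform n c x u))\<^sup>2 * \<bar>u\<bar> powr - \<alpha> \<partial>lborel)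
     = (\<Sum>l<n. \<Sum>r<n. c l * c r * (levy_const \<alpha> * fbm_cov (\<alpha> - 1) x l r))"
    unfolding eq by (simp add: h Bochner_Integration.integrable_sum Bochner_Integration.integrable_add
        Bochner_Integration.integrable_diff Bochner_Integration.integral_sum fbm_cov_def right_diff_distrib distrib_left)
  also have "\<dots> \<le> (\<Sum>l<n. \<Sum>r<n. b\<^sup>2 * (levy_const \<alpha> * \<bar>fbm_cov (\<alpha> - 1) x l r\<bar>))"
  proof (intro sum_mono)
    fix l r assume lr: "l \<in> {..<n}" "r \<in> {..<n}"
    have "\<bar>c l\<bar> * \<bar>c r\<bar> \<le> b * b" using c[of l] c[of r] lr by (intro mult_mono) auto
    then have "\<bar>c l * c r\<bar> * \<bar>levy_const \<alpha> * fbm_cov (\<alpha> - 1) x l r\<bar> \<le> b\<^sup>2 * \<bar>levy_const \<alpha> * fbm_cov (\<alpha> - 1) x l r\<bar>"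
      by (intro mult_right_mono) (auto simp: abs_mult power2_eq_square)
    then show "c l * c r * (levy_const \<alpha> * fbm_cov (\<alpha> - 1) x l r) \<le> b\<^sup>2 * (levy_const \<alpha> * \<bar>fbm_cov (\<alpha> - 1) x l r\<bar>)"
      using levy_const_nonneg[of \<alpha>] abs_ge_self[of "c l * c r * (levy_const \<alpha> * fbm_cov (\<alpha> - 1) x l r)"]
      unfolding abs_mult[of "c l * c r"] abs_mult[of "levy_const \<alpha>"] by simp
  qed
  also have "\<dots> = b\<^sup>2 * levy_const \<alpha> * (\<Sum>l<n. \<Sum>r<n. \<bar>fbm_cov (\<alpha> - 1) x l r\<bar>)"
    by (simp add: sum_distrib_left mult.assoc)
  also have "\<dots> \<le> b\<^sup>2 * levy_const \<alpha> * (4 * (\<Sum>l<n. (x (Suc l) - x l) powr (\<alpha> - 1)))"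
    using \<alpha> levy_const_nonneg[of \<alpha>] by (intro mult_left_mono fbm_cov_double_sum x) auto
  finally show ?thesis
    using nn_integral_eq_integral[OF int] by (simp add: ennreal_leI mult_ac)
qed

section \<open>Elementary symmetric sums\<close>

text \<open>\<open>esum a n k\<close> is the \<open>n\<close>-th elementary symmetric polynomial of \<open>a 1, \<dots>, a k\<close>.\<close>

fun esum :: "(nat \<Rightarrow> real) \<Rightarrow> nat \<Rightarrow> nat \<Rightarrow> real" where
  "esum a 0 k = 1"
| "esum a (Suc n) 0 = 0"
| "esum a (Suc n) (Suc k) = esum a (Suc n) k + a (Suc k) * esum a n k"

lemma esum_cong:
  "(\<And>j. j \<le> k \<Longrightarrow> a j = b j) \<Longrightarrow> esum a n k = esum b n k"
  by (induction a n k rule: esum.induct) auto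

lemma esum_abs_le:
  assumes "0 \<le> m" "\<And>j. \<bar>a j\<bar> \<le> m"
  shows "\<bar>esum a n k\<bar> \<le> (real k * m) ^ n"
  using assms(2)
proof (induction a n k rule: esum.induct)
  case (3 a n k)
  have "\<bar>esum a (Suc n) (Suc k)\<bar> \<le> \<bar>esum a (Suc n) k\<bar> + \<bar>a (Suc k)\<bar> * \<bar>esum a n k\<bar>"
    by (simp add: abs_mult[symmetric] abs_triangle_ineq)
  also have "\<dots> \<le> (real k * m) ^ Suc n + m * (real k * m) ^ n"
    using 3 assms(1) by (intro add_mono mult_mono) auto
  also have "\<dots> = (real k * m) ^ n * (real (Suc k) * m)" by (simp add: algebra_simps)
  also have "\<dots> \<le> (real (Suc k) * m) ^ n * (real (Suc k) * m)"
    using assms(1) by (intro mult_right_mono power_mono) auto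
  finally show ?case unfolding power_Suc by (simp only: mult.commute)
qed auto

lemma power_Taylor_bound:
  assumes "0 \<le> R"
  shows "\<exists>C\<ge>0. \<forall>x y::real. \<bar>x\<bar> \<le> R \<longrightarrow> \<bar>y\<bar> \<le> R \<longrightarrow>
    \<bar>x ^ Suc n - y ^ Suc n - real (Suc n) * (x - y) * y ^ n\<bar> \<le> C * (x - y)\<^sup>2"
proof (induction n)
  case 0
  show ?case by (rule exI[of _ 0]) simp
next
  case (Suc n)
  then obtain C where C: "C \<ge> 0" "\<And>x y::real. \<bar>x\<bar> \<le> R \<Longrightarrow> \<bar>y\<bar> \<le> R \<Longrightarrow>
    \<bar>x ^ Suc n - y ^ Suc n - real (Suc n) * (x - y) * y ^ n\<bar> \<le> C * (x - y)\<^sup>2" by blast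
  show ?case
  proof (intro exI[of _ "R * C + real (Suc n) * R ^ n"] conjI allI impI)
    show "0 \<le> R * C + real (Suc n) * R ^ n" using C assms by simp
    fix x y :: real assume xy: "\<bar>x\<bar> \<le> R" "\<bar>y\<bar> \<le> R"
    let ?D = "x ^ Suc n - y ^ Suc n - real (Suc n) * (x - y) * y ^ n"
    have "x ^ Suc (Suc n) - y ^ Suc (Suc n) - real (Suc (Suc n)) * (x - y) * y ^ Suc n
      = x * ?D + real (Suc n) * (x - y)\<^sup>2 * y ^ n"
      by (simp add: algebra_simps power2_eq_square)
    also have "\<bar>\<dots>\<bar> \<le> \<bar>x\<bar> * \<bar>?D\<bar> + real (Suc n) * (x - y)\<^sup>2 * \<bar>y\<bar> ^ n"
      by (rule order_trans[OF abs_triangle_ineq]) (simp add: abs_mult power_abs)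
    also have "\<dots> \<le> R * (C * (x - y)\<^sup>2) + real (Suc n) * (x - y)\<^sup>2 * R ^ n"
      using C(2)[OF xy] xy assms by (intro add_mono mult_mono[of "\<bar>x\<bar>"] mult_left_mono[of "\<bar>y\<bar> ^ n"] power_mono) auto
    also have "\<dots> = (R * C + real (Suc n) * R ^ n) * (x - y)\<^sup>2" by (simp add: algebra_simps)
    finally show "\<bar>x ^ Suc (Suc n) - y ^ Suc (Suc n) - real (Suc (Suc n)) * (x - y) * y ^ Suc n\<bar>
      \<le> (R * C + real (Suc n) * R ^ n) * (x - y)\<^sup>2" .
  qed
qed

text \<open>If the summands are small, tuples with a repeated index contribute little to a power of the
  sum.\<close>

lemma esum_power_bound:
  assumes "0 \<le> T"
  shows "\<exists>C\<ge>0. \<forall>a k m. 0 \<le> m \<longrightarrow> real k * m \<le> T \<longrightarrow> (\<forall>j. \<bar>a j\<bar> \<le> m) \<longrightarrow>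
    \<bar>fact n * esum a n k - (\<Sum>j<k. a (Suc j)) ^ n\<bar> \<le> C * real k * m\<^sup>2"
proof (induction n)
  case 0
  show ?case by (rule exI[of _ 0]) simp
next
  case (Suc n)
  then obtain C where C: "C \<ge> 0" "\<And>a k m. 0 \<le> m \<Longrightarrow> real k * m \<le> T \<Longrightarrow> (\<And>j. \<bar>a j\<bar> \<le> m) \<Longrightarrow>
    \<bar>fact n * esum a n k - (\<Sum>j<k. a (Suc j)) ^ n\<bar> \<le> C * real k * m\<^sup>2" by blast
  obtain D where D: "D \<ge> 0" "\<And>x y::real. \<bar>x\<bar> \<le> T \<Longrightarrow> \<bar>y\<bar> \<le> T \<Longrightarrow>
    \<bar>x ^ Suc n - y ^ Suc n - real (Suc n) * (x - y) * y ^ n\<bar> \<le> D * (x - y)\<^sup>2"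
    using power_Taylor_bound[OF assms, of n] by blast
  define C' where "C' = real (Suc n) * T * C + D"
  show ?case
  proof (intro exI[of _ C'] conjI allI impI)
    show "0 \<le> C'" using C(1) D(1) assms by (simp add: C'_def)
    fix a :: "nat \<Rightarrow> real" and k m
    assume m: "0 \<le> m" and km: "real k * m \<le> T" and a: "\<forall>j. \<bar>a j\<bar> \<le> m"
    show "\<bar>fact (Suc n) * esum a (Suc n) k - (\<Sum>j<k. a (Suc j)) ^ Suc n\<bar> \<le> C' * real k * m\<^sup>2"
      using km
    proof (induction k)
      case (Suc k)
      let ?s = "\<lambda>k. \<Sum>j<k. a (Suc j)"
      have sk: "\<bar>?s k\<bar> \<le> real k * m" for k
        by (rule order_trans[OF sum_abs]) (use sum_mono[of "{..<k}" "\<lambda>j. \<bar>a (Suc j)\<bar>" "\<lambda>_. m"] a in simp)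
      have km': "real k * m \<le> T" using Suc.prems m by (simp add: algebra_simps)
      have tay: "\<bar>?s (Suc k) ^ Suc n - ?s k ^ Suc n - real (Suc n) * a (Suc k) * ?s k ^ n\<bar> \<le> D * m\<^sup>2"
      proof -
        have "\<bar>?s (Suc k) ^ Suc n - ?s k ^ Suc n - real (Suc n) * (?s (Suc k) - ?s k) * ?s k ^ n\<bar> \<le> D * (?s (Suc k) - ?s k)\<^sup>2"
          using order_trans[OF sk[of k] km'] order_trans[OF sk[of "Suc k"] Suc.prems] by (intro D(2)) auto
        also have "(?s (Suc k) - ?s k)\<^sup>2 = \<bar>a (Suc k)\<bar>\<^sup>2" by simp
        also have "D * \<bar>a (Suc k)\<bar>\<^sup>2 \<le> D * m\<^sup>2" using a D(1) by (intro mult_left_mono power_mono) auto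
        finally show ?thesis by simp
      qed
      have prev: "\<bar>real (Suc n) * a (Suc k) * (fact n * esum a n k - ?s k ^ n)\<bar> \<le> real (Suc n) * T * C * m\<^sup>2"
      proof -
        have "\<bar>real (Suc n) * a (Suc k) * (fact n * esum a n k - ?s k ^ n)\<bar>
           = real (Suc n) * \<bar>a (Suc k)\<bar> * \<bar>fact n * esum a n k - ?s k ^ n\<bar>" by (simp add: abs_mult)
        also have "\<dots> \<le> real (Suc n) * m * (C * real k * m\<^sup>2)"
          using C(2)[OF m km'] a m by (intro mult_mono) auto
        also have "\<dots> = real (Suc n) * (real k * m) * (C * m\<^sup>2)" by simp
        also have "\<dots> \<le> real (Suc n) * T * (C * m\<^sup>2)"
          using km' C(1) by (intro mult_right_mono mult_left_mono) auto
        finally show ?thesis by (simp add: mult.assoc)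
      qed
      have IH: "\<bar>fact (Suc n) * esum a (Suc n) k - ?s k ^ Suc n\<bar> \<le> C' * real k * m\<^sup>2"
        using Suc.IH km' by blast
      have "fact (Suc n) * esum a (Suc n) (Suc k) - ?s (Suc k) ^ Suc n
        = (fact (Suc n) * esum a (Suc n) k - ?s k ^ Suc n)
        + real (Suc n) * a (Suc k) * (fact n * esum a n k - ?s k ^ n)
        - (?s (Suc k) ^ Suc n - ?s k ^ Suc n - real (Suc n) * a (Suc k) * ?s k ^ n)"
        by (simp only: esum.simps fact_Suc) (simp add: algebra_simps)
      moreover have "C' * real (Suc k) * m\<^sup>2 = C' * real k * m\<^sup>2 + real (Suc n) * T * C * m\<^sup>2 + D * m\<^sup>2"
        by (simp add: C'_def algebra_simps)
      ultimately show ?case using IH prev tay by linarith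
    qed simp
  qed
qed

section \<open>Moments of additive functionals of a random walk\<close>

text \<open>The steps \<open>\<xi>\<close> are the increments of the process over the cells of a time grid of mesh \<open>\<delta>\<close>; \<open>\<rho>\<close> is
  their characteristic function and \<open>F\<close> the Fourier transform of the test function \<open>\<phi>\<close>.\<close>

locale fourier_walk = prob_space M for M :: "'a measure" +
  fixes \<xi> :: "nat \<Rightarrow> 'a \<Rightarrow> real" and N :: nat and \<rho> :: "real \<Rightarrow> real" and x0 \<delta> m :: real
    and \<phi> :: "real \<Rightarrow> real" and F :: "real \<Rightarrow> complex"
  assumes indep: "indep_vars (\<lambda>_. borel) \<xi> {..<N}"
    and char_\<xi>: "\<And>i u. i < N \<Longrightarrow> char (distr M borel (\<xi> i)) u = of_real (\<rho> u)"
    and \<rho>: "\<And>u. 0 \<le> \<rho> u" "\<And>u. \<rho> u \<le> 1" "\<rho> 0 = 1" and \<rho>_measurable [measurable]: "\<rho> \<in> borel_measurable borel"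
    and \<delta>: "0 \<le> \<delta>"
    and \<phi>_bound: "\<And>y. \<bar>\<phi> y\<bar> \<le> m" and \<phi>_measurable [measurable]: "\<phi> \<in> borel_measurable borel"
    and F_integrable: "integrable lborel F"
    and \<phi>_fourier: "\<And>y. complex_of_real (\<phi> y) = (\<integral>u. F u * iexp (u * y) \<partial>lborel)"
begin

definition walk :: "nat \<Rightarrow> (nat \<Rightarrow> real) \<Rightarrow> real" where
  "walk k z = x0 + (\<Sum>i<k. z i)"

definition walk_esum :: "nat \<Rightarrow> nat \<Rightarrow> (nat \<Rightarrow> real) \<Rightarrow> real" where
  "walk_esum n k z = esum (\<lambda>j. \<delta> * \<phi> (walk j z)) n k"

abbreviation path :: "'a \<Rightarrow> nat \<Rightarrow> real" where
  "path \<omega> \<equiv> (\<lambda>i. \<xi> i \<omega>)"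

text \<open>With an exponential of the current position as an additional factor, the expectations of the symmetric
  sums satisfy a closed recursion: expanding \<open>\<phi>\<close> into exponentials just shifts \<open>v\<close>.\<close>

definition Q :: "nat \<Rightarrow> real \<Rightarrow> nat \<Rightarrow> complex" where
  "Q n v k = (\<integral>\<omega>. iexp (v * walk k (path \<omega>)) * of_real (walk_esum n k (path \<omega>)) \<partial>M)"

lemma F_measurable [measurable]: "F \<in> borel_measurable borel"
  using F_integrable by auto

lemma m_nonneg: "0 \<le> m" using \<phi>_bound[of 0] by linarith

lemma \<xi>_measurable: "i < N \<Longrightarrow> \<xi> i \<in> borel_measurable M"
  using indep by (auto simp: indep_vars_def)

lemma walk_restrict: "j \<le> k \<Longrightarrow> walk j (restrict z {..<k}) = walk j z"
  unfolding walk_def by simp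

lemma walk_esum_restrict: "walk_esum n k (restrict z {..<k}) = walk_esum n k z"
  unfolding walk_esum_def by (rule esum_cong) (simp add: walk_restrict)

lemma walk_measurable: "j \<le> k \<Longrightarrow> walk j \<in> borel_measurable (PiM {..<k} (\<lambda>_. borel))"
  unfolding walk_def[abs_def] by (intro borel_measurable_add borel_measurable_const borel_measurable_sum measurable_component_singleton) auto

lemma esum_measurable:
  "(\<And>j. j \<le> k \<Longrightarrow> (\<lambda>z. a z j) \<in> borel_measurable R) \<Longrightarrow> (\<lambda>z. esum (a z) n k) \<in> borel_measurable R"
proof (induction n arbitrary: k)
  case (Suc n)
  note IH = Suc.IH
  from Suc.prems show ?case
  proof (induction k)
    case (Suc k)
    have "(\<lambda>z. esum (a z) (Suc n) k) \<in> borel_measurable R" using Suc.prems by (intro Suc.IH) auto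
    moreover have "(\<lambda>z. esum (a z) n k) \<in> borel_measurable R" using Suc.prems by (intro IH) auto
    moreover have "(\<lambda>z. a z (Suc k)) \<in> borel_measurable R" using Suc.prems[of "Suc k"] by simp
    ultimately show ?case by simp
  qed simp
qed simp

lemma walk_esum_measurable: "walk_esum n k \<in> borel_measurable (PiM {..<k} (\<lambda>_. borel))"
  unfolding walk_esum_def[abs_def]
  by (rule esum_measurable) (use walk_measurable in measurable)

lemma path_measurable: "k \<le> N \<Longrightarrow> (\<lambda>\<omega>. restrict (path \<omega>) {..<k}) \<in> measurable M (PiM {..<k} (\<lambda>_. borel))"
  by (intro measurable_restrict \<xi>_measurable) auto

lemma walk_path_measurable:
  assumes "k \<le> N" shows "(\<lambda>\<omega>. walk k (path \<omega>)) \<in> borel_measurable M" "(\<lambda>\<omega>. walk_esum n k (path \<omega>)) \<in> borel_measurable M"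
  using measurable_compose[OF path_measurable[OF assms] walk_measurable[of k k]]
    measurable_compose[OF path_measurable[OF assms] walk_esum_measurable[of n k]]
  by (simp_all add: walk_restrict walk_esum_restrict)

lemma walk_esum_bound: "\<bar>walk_esum n k z\<bar> \<le> (real k * (\<delta> * m)) ^ n"
  unfolding walk_esum_def
  by (rule esum_abs_le) (use \<delta> m_nonneg \<phi>_bound in \<open>auto simp: abs_mult mult_left_mono\<close>)

lemma integrable_bounded:
  fixes f :: "'a \<Rightarrow> complex"
  assumes "f \<in> borel_measurable M" "\<And>\<omega>. norm (f \<omega>) \<le> B"
  shows "integrable M f"
  using assms by (intro integrable_const_bound[of _ B]) auto

text \<open>The next increment is independent of the past.\<close>

lemma increment_factor:
  assumes k: "k < N" and h: "h \<in> borel_measurable (PiM {..<k} (\<lambda>_. borel))" and B: "\<And>z. norm (h z) \<le> B"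
  shows "(\<integral>\<omega>. iexp (v * \<xi> k \<omega>) * h (restrict (path \<omega>) {..<k}) \<partial>M) = of_real (\<rho> v) * (\<integral>\<omega>. h (restrict (path \<omega>) {..<k}) \<partial>M)"
proof -
  let ?Y1 = "\<lambda>z::nat \<Rightarrow> real. iexp (v * z k)"
  have mY1: "?Y1 \<in> borel_measurable (PiM {k} (\<lambda>_. borel))"
  proof -
    have [measurable]: "(\<lambda>z. z k) \<in> borel_measurable (PiM {k} (\<lambda>_. borel :: real measure))"
      by (rule measurable_component_singleton) simp
    show ?thesis by measurable
  qed
  have "indep_var borel (?Y1 \<circ> (\<lambda>\<omega>. restrict (path \<omega>) {k})) borel (h \<circ> (\<lambda>\<omega>. restrict (path \<omega>) {..<k}))"
    by (rule indep_var_compose[OF indep_var_restrict[OF indep] mY1 h]) (use k in auto)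
  then have ind: "indep_var borel (\<lambda>\<omega>. iexp (v * \<xi> k \<omega>)) borel (\<lambda>\<omega>. h (restrict (path \<omega>) {..<k}))"
    by (simp add: comp_def)
  have m1: "(\<lambda>\<omega>. iexp (v * \<xi> k \<omega>)) \<in> borel_measurable M" using \<xi>_measurable[OF k] by measurable
  have m2: "(\<lambda>\<omega>. h (restrict (path \<omega>) {..<k})) \<in> borel_measurable M"
    using measurable_compose[OF path_measurable h] k by simp
  have "(\<integral>\<omega>. iexp (v * \<xi> k \<omega>) \<partial>M) = char (distr M borel (\<xi> k)) v"
    unfolding char_def using \<xi>_measurable[OF k] by (subst integral_distr) auto
  then show ?thesis
    using indep_var_lebesgue_integral[OF ind integrable_bounded[OF m1, of 1] integrable_bounded[OF m2 B]] char_\<xi>[OF k]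
    by simp
qed

lemma walk_Suc: "walk (Suc k) z = walk k z + z k"
  by (simp add: walk_def)

lemma iexp_add: "iexp (v * (a + b)) = iexp (v * b) * iexp (v * a)"
  by (simp add: exp_add[symmetric] algebra_simps)

lemma Q_step:
  assumes k: "k < N"
  shows "(\<integral>\<omega>. iexp (v * walk (Suc k) (path \<omega>)) * of_real (walk_esum n k (path \<omega>)) \<partial>M) = of_real (\<rho> v) * Q n v k"
proof -
  let ?h = "\<lambda>z. iexp (v * walk k z) * complex_of_real (walk_esum n k z)"
  have "?h \<in> borel_measurable (PiM {..<k} (\<lambda>_. borel))"
    using walk_measurable[of k k] walk_esum_measurable[of n k] by measurable
  moreover have "norm (?h z) \<le> (real k * (\<delta> * m)) ^ n" for z
    using walk_esum_bound[of n k z] by (simp add: norm_mult)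
  ultimately have "(\<integral>\<omega>. iexp (v * \<xi> k \<omega>) * ?h (restrict (path \<omega>) {..<k}) \<partial>M) = of_real (\<rho> v) * (\<integral>\<omega>. ?h (restrict (path \<omega>) {..<k}) \<partial>M)"
    by (rule increment_factor[OF k])
  then show ?thesis
    unfolding Q_def walk_Suc iexp_add by (simp add: walk_restrict walk_esum_restrict mult.assoc)
qed

lemma Q_measurable [measurable]:
  assumes "k \<le> N" shows "(\<lambda>v. Q n v k) \<in> borel_measurable borel"
proof -
  note [measurable] = walk_path_measurable[OF assms]
  show ?thesis unfolding Q_def by measurable
qed

lemma Q_Suc:
  assumes k: "k < N"
  shows "Q (Suc n) v (Suc k) = of_real (\<rho> v) * Q (Suc n) v k + of_real \<delta> * (\<integral>u. F u * (of_real (\<rho> (u + v)) * Q n (u + v) k) \<partial>lborel)"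
proof -
  have kN: "k \<le> N" "Suc k \<le> N" using k by auto
  note [measurable] = walk_path_measurable[OF kN(1)] walk_path_measurable[OF kN(2)]
  let ?E = "\<lambda>v \<omega>. iexp (v * walk (Suc k) (path \<omega>))"
  let ?e = "\<lambda>n \<omega>. complex_of_real (walk_esum n k (path \<omega>))"
  have be: "norm (?e n \<omega>) \<le> (real k * (\<delta> * m)) ^ n" for n \<omega> using walk_esum_bound[of n k "path \<omega>"] by simp
  have int: "integrable M (\<lambda>\<omega>. ?E v \<omega> * ?e n \<omega>)" for n v
    using be by (intro integrable_bounded[where B = "(real k * (\<delta> * m)) ^ n"]) (auto simp: norm_mult)
  have int\<phi>: "integrable M (\<lambda>\<omega>. ?E v \<omega> * complex_of_real (\<phi> (walk (Suc k) (path \<omega>))) * ?e n \<omega>)"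
    using be \<phi>_bound m_nonneg by (intro integrable_bounded[where B = "m * (real k * (\<delta> * m)) ^ n"]) (auto simp: norm_mult intro!: mult_mono)
  interpret P: pair_sigma_finite lborel M ..
  let ?f = "\<lambda>(u, \<omega>). F u * (?E (u + v) \<omega> * ?e n \<omega>)"
  have "integrable (lborel \<Otimes>\<^sub>M M) ?f"
  proof (rule Bochner_Integration.integrable_bound)
    have "integrable (lborel \<Otimes>\<^sub>M M) (\<lambda>(u, \<omega>). of_real ((real k * (\<delta> * m)) ^ n) * F u)"
    proof (rule P.Fubini_integrable)
      show "AE u in lborel. integrable M (\<lambda>\<omega>. case (u, \<omega>) of (u, \<omega>) \<Rightarrow> of_real ((real k * (\<delta> * m)) ^ n) * F u)" by simp
      show "integrable lborel (\<lambda>u. \<integral>\<omega>. norm (case (u, \<omega>) of (u, \<omega>) \<Rightarrow> of_real ((real k * (\<delta> * m)) ^ n) * F u) \<partial>M)"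
        using F_integrable by (simp add: norm_mult prob_space)
    qed measurable
    then show "integrable (lborel \<Otimes>\<^sub>M M) (\<lambda>x. case x of (u, \<omega>) \<Rightarrow> of_real ((real k * (\<delta> * m)) ^ n) * F u)" .
    show "AE x in lborel \<Otimes>\<^sub>M M. norm (?f x) \<le> norm (case x of (u, \<omega>) \<Rightarrow> of_real ((real k * (\<delta> * m)) ^ n) * F u)"
    proof (rule AE_I2)
      fix x
      show "norm (?f x) \<le> norm (case x of (u, \<omega>) \<Rightarrow> of_real ((real k * (\<delta> * m)) ^ n) * F u)"
        using mult_left_mono[OF be[of n "snd x"] norm_ge_zero[of "F (fst x)"]] \<delta> m_nonneg
        by (cases x) (simp add: norm_mult norm_power abs_mult mult_ac)
    qed
  qed measurable
  then have swap: "(\<integral>\<omega>. \<integral>u. F u * (?E (u + v) \<omega> * ?e n \<omega>) \<partial>lborel \<partial>M) = (\<integral>u. \<integral>\<omega>. F u * (?E (u + v) \<omega> * ?e n \<omega>) \<partial>M \<partial>lborel)"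
    by (rule P.Fubini_integral)
  have rep: "?E v \<omega> * complex_of_real (\<phi> (walk (Suc k) (path \<omega>))) * ?e n \<omega> = (\<integral>u. F u * (?E (u + v) \<omega> * ?e n \<omega>) \<partial>lborel)" for \<omega>
  proof -
    have "(\<integral>u. F u * (?E (u + v) \<omega> * ?e n \<omega>) \<partial>lborel) = (\<integral>u. F u * iexp (u * walk (Suc k) (path \<omega>)) * (?E v \<omega> * ?e n \<omega>) \<partial>lborel)"
      by (intro Bochner_Integration.integral_cong refl) (simp add: exp_add[symmetric] algebra_simps)
    also have "\<dots> = (\<integral>u. F u * iexp (u * walk (Suc k) (path \<omega>)) \<partial>lborel) * (?E v \<omega> * ?e n \<omega>)" by simp
    finally show ?thesis unfolding \<phi>_fourier by (simp add: mult_ac)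
  qed
  have "Q (Suc n) v (Suc k) = (\<integral>\<omega>. ?E v \<omega> * ?e (Suc n) \<omega> + of_real \<delta> * (?E v \<omega> * complex_of_real (\<phi> (walk (Suc k) (path \<omega>))) * ?e n \<omega>) \<partial>M)"
    unfolding Q_def walk_esum_def by (intro Bochner_Integration.integral_cong refl) (simp add: algebra_simps)
  also have "\<dots> = (\<integral>\<omega>. ?E v \<omega> * ?e (Suc n) \<omega> \<partial>M) + of_real \<delta> * (\<integral>\<omega>. ?E v \<omega> * complex_of_real (\<phi> (walk (Suc k) (path \<omega>))) * ?e n \<omega> \<partial>M)"
    using int int\<phi> by simp
  also have "(\<integral>\<omega>. ?E v \<omega> * complex_of_real (\<phi> (walk (Suc k) (path \<omega>))) * ?e n \<omega> \<partial>M) = (\<integral>u. F u * (\<integral>\<omega>. ?E (u + v) \<omega> * ?e n \<omega> \<partial>M) \<partial>lborel)"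
    unfolding rep swap by simp
  finally show ?thesis unfolding Q_step[OF k] .
qed

definition bQ :: "nat \<Rightarrow> real \<Rightarrow> nat \<Rightarrow> ennreal" where
  "bQ n v k = ennreal (\<rho> v * norm (Q n v k))"

lemma bQ_measurable [measurable]: "k \<le> N \<Longrightarrow> (\<lambda>v. bQ n v k) \<in> borel_measurable borel"
  using Q_measurable[of k n] unfolding bQ_def by measurable

lemma norm_Q_Suc:
  assumes k: "k < N"
  shows "ennreal (norm (Q (Suc n) v (Suc k))) \<le> bQ (Suc n) v k + ennreal \<delta> * (\<integral>\<^sup>+u. ennreal (norm (F u)) * bQ n (u + v) k \<partial>lborel)"
proof -
  let ?I = "\<integral>u. F u * (of_real (\<rho> (u + v)) * Q n (u + v) k) \<partial>lborel"
  have "ennreal (norm ?I) \<le> (\<integral>\<^sup>+u. ennreal (norm (F u)) * bQ n (u + v) k \<partial>lborel)"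
  proof (cases "integrable lborel (\<lambda>u. F u * (of_real (\<rho> (u + v)) * Q n (u + v) k))")
    case True
    from integral_norm_bound_ennreal[OF True] show ?thesis
      using \<rho> by (simp add: bQ_def norm_mult ennreal_mult)
  qed (simp add: not_integrable_integral_eq)
  then have "ennreal \<delta> * ennreal (norm ?I) \<le> ennreal \<delta> * (\<integral>\<^sup>+u. ennreal (norm (F u)) * bQ n (u + v) k \<partial>lborel)"
    by (rule mult_left_mono) simp
  moreover have "norm (Q (Suc n) v (Suc k)) \<le> \<rho> v * norm (Q (Suc n) v k) + \<delta> * norm ?I"
    unfolding Q_Suc[OF k] using \<rho>(1)[of v] \<delta>
    by (intro norm_triangle_le) (simp add: norm_mult)
  then have "ennreal (norm (Q (Suc n) v (Suc k))) \<le> bQ (Suc n) v k + ennreal \<delta> * ennreal (norm ?I)"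
    unfolding bQ_def using \<rho>(1)[of v] \<delta> by (simp add: ennreal_mult[symmetric] ennreal_plus[symmetric] ennreal_leI del: ennreal_plus)
  ultimately show ?thesis by (meson add_left_mono order_trans)
qed

definition TQ :: "nat \<Rightarrow> real \<Rightarrow> ennreal" where
  "TQ n v = ennreal \<delta> * (\<Sum>k<N. bQ n v k)"

lemma TQ_measurable [measurable]: "TQ n \<in> borel_measurable borel"
proof -
  have "(\<lambda>v. \<Sum>k<N. bQ n v k) \<in> borel_measurable borel"
    by (rule borel_measurable_sum) (auto intro: bQ_measurable)
  then show ?thesis unfolding TQ_def[abs_def] by measurable
qed

text \<open>A discrete form of the bound of a convolution in time by the product of two integrals.\<close>

lemma sum_recursion_bound:
  fixes b d :: "nat \<Rightarrow> ennreal" and r :: ennreal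
  assumes "b 0 = 0" "\<And>k. Suc k < N' \<Longrightarrow> b (Suc k) \<le> r * (b k + d k)"
  shows "(\<Sum>k<N'. b k) \<le> (\<Sum>i<N'. r ^ Suc i) * (\<Sum>k<N'. d k)"
  using assms(2)
proof (induction N')
  case (Suc n)
  let ?G = "\<lambda>n. \<Sum>i<n. r ^ Suc i"
  have IH: "(\<Sum>k<n. b k) \<le> ?G n * (\<Sum>k<n. d k)" using Suc by auto
  have "(\<Sum>k<Suc n. b k) = (\<Sum>k<n. b (Suc k))" using assms(1) by (subst sum.lessThan_Suc_shift) simp
  also have "\<dots> \<le> (\<Sum>k<n. r * (b k + d k))" using Suc.prems by (intro sum_mono) auto
  also have "\<dots> = r * ((\<Sum>k<n. b k) + (\<Sum>k<n. d k))" by (simp add: sum_distrib_left[symmetric] sum.distrib)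
  also have "\<dots> \<le> r * (?G n * (\<Sum>k<n. d k) + (\<Sum>k<n. d k))" using IH by (intro mult_left_mono add_right_mono) auto
  also have "\<dots> = ?G (Suc n) * (\<Sum>k<n. d k)"
    by (subst sum.lessThan_Suc_shift) (simp add: sum_distrib_left distrib_left distrib_right mult_ac add.commute)
  also have "\<dots> \<le> ?G (Suc n) * (\<Sum>k<Suc n. d k)" by (intro mult_left_mono) auto
  finally show ?case .
qed simp

text \<open>Summed over time, the recursion for \<open>Q\<close> has the form required by \<open>kernel_chain_bound\<close>; the sum of the
  powers of \<open>\<rho>\<close> over the time grid plays the role of the kernel.\<close>

lemma moment_bound:
  assumes K [measurable]: "K \<in> borel_measurable borel" and K0: "\<And>v. 0 < K v" and A: "0 \<le> A"
    and KK: "\<And>v w. K v * K (w + v) \<le> A * K w * (K v + K (w + v))"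
    and \<rho>K: "\<And>v. \<delta> * (\<Sum>i<N. \<rho> v ^ Suc i) \<le> K v"
  defines "\<kappa> \<equiv> (\<integral>\<^sup>+v. ennreal (K v) \<partial>lborel)"
    and "B \<equiv> (\<integral>\<^sup>+u. ennreal (norm (F u)) ^ 2 * ennreal (K u) \<partial>lborel)"
  shows "(ennreal \<bar>expectation (\<lambda>\<omega>. walk_esum (Suc n) N (path \<omega>))\<bar>)\<^sup>2 \<le> B * ((ennreal (2 * A) * \<kappa> * B) ^ n * \<kappa>)"
proof -
  have \<rho>K': "ennreal \<delta> * (\<Sum>i<N. ennreal (\<rho> v) ^ Suc i) \<le> ennreal (K v)" for v
  proof -
    have "ennreal \<delta> * (\<Sum>i<N. ennreal (\<rho> v) ^ Suc i) = ennreal (\<delta> * (\<Sum>i<N. \<rho> v ^ Suc i))"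
      using \<rho>(1)[of v] \<delta> by (simp add: ennreal_mult' ennreal_power sum_nonneg sum_ennreal del: power_Suc)
    then show ?thesis using \<rho>K[of v] by (simp add: ennreal_leI)
  qed
  have T0: "TQ 0 v \<le> ennreal (K v)" for v
  proof -
    have "norm (Q 0 v k) = \<rho> v ^ k" if "k \<le> N" for k
      using that
    proof (induction k)
      case 0
      then show ?case by (simp add: Q_def walk_def walk_esum_def prob_space)
    next
      case (Suc k)
      have "Q 0 v (Suc k) = of_real (\<rho> v) * Q 0 v k"
        using Q_step[of k v 0] Suc.prems by (simp add: Q_def walk_esum_def)
      then show ?case using Suc \<rho>(1)[of v] by (simp add: norm_mult)
    qed
    then have "TQ 0 v = ennreal \<delta> * (\<Sum>i<N. ennreal (\<rho> v) ^ Suc i)"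
      using \<rho>(1)[of v] unfolding TQ_def bQ_def by (intro arg_cong2[where f = "(*)"] refl sum.cong) (auto simp: ennreal_mult ennreal_power)
    then show ?thesis using \<rho>K'[of v] by simp
  qed
  define d where "d n v k = ennreal \<delta> * (\<integral>\<^sup>+u. ennreal (norm (F u)) * bQ n (u + v) k \<partial>lborel)" for n v k
  have d_sum: "(\<Sum>k<N. d n v k) = (\<integral>\<^sup>+u. ennreal (norm (F u)) * TQ n (u + v) \<partial>lborel)" for n v
  proof -
    have "(\<Sum>k<N. d n v k) = (\<Sum>k<N. \<integral>\<^sup>+u. ennreal \<delta> * (ennreal (norm (F u)) * bQ n (u + v) k) \<partial>lborel)"
      unfolding d_def
    proof (intro sum.cong refl)
      fix k assume "k \<in> {..<N}"
      then have [measurable]: "(\<lambda>v. bQ n v k) \<in> borel_measurable borel" by (intro bQ_measurable) auto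
      have [measurable]: "(\<lambda>u. bQ n (u + v) k) \<in> borel_measurable borel"
        by (rule measurable_compose[of "\<lambda>u. u + v" _ borel "\<lambda>v. bQ n v k"]) measurable
      show "ennreal \<delta> * (\<integral>\<^sup>+u. ennreal (norm (F u)) * bQ n (u + v) k \<partial>lborel) = (\<integral>\<^sup>+u. ennreal \<delta> * (ennreal (norm (F u)) * bQ n (u + v) k) \<partial>lborel)"
        by (rule nn_integral_cmult[symmetric]) measurable
    qed
    also have "\<dots> = (\<integral>\<^sup>+u. (\<Sum>k<N. ennreal \<delta> * (ennreal (norm (F u)) * bQ n (u + v) k)) \<partial>lborel)"
    proof (rule nn_integral_sum[symmetric])
      fix k assume "k \<in> {..<N}"
      then have [measurable]: "(\<lambda>v. bQ n v k) \<in> borel_measurable borel" by (intro bQ_measurable) auto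
      have [measurable]: "(\<lambda>u. bQ n (u + v) k) \<in> borel_measurable borel"
        by (rule measurable_compose[of "\<lambda>u. u + v" _ borel "\<lambda>v. bQ n v k"]) measurable
      show "(\<lambda>u. ennreal \<delta> * (ennreal (norm (F u)) * bQ n (u + v) k)) \<in> borel_measurable lborel" by measurable
    qed
    also have "\<dots> = (\<integral>\<^sup>+u. ennreal (norm (F u)) * TQ n (u + v) \<partial>lborel)"
      unfolding TQ_def by (intro nn_integral_cong) (simp add: sum_distrib_left mult_ac)
    finally show ?thesis .
  qed
  have Q0: "Q (Suc n) v 0 = 0" for n v by (simp add: Q_def walk_esum_def)
  have TS: "TQ (Suc n) v \<le> ennreal (K v) * (\<integral>\<^sup>+u. ennreal (norm (F u)) * TQ n (u + v) \<partial>lborel)" for n v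
  proof -
    have "bQ (Suc n) v (Suc k) \<le> ennreal (\<rho> v) * (bQ (Suc n) v k + d n v k)" if "Suc k < N" for k
    proof -
      have "bQ (Suc n) v (Suc k) = ennreal (\<rho> v) * ennreal (norm (Q (Suc n) v (Suc k)))"
        using \<rho>(1)[of v] by (simp add: bQ_def ennreal_mult)
      then show ?thesis using norm_Q_Suc[of k n v] that by (simp add: d_def mult_left_mono)
    qed
    from sum_recursion_bound[of "bQ (Suc n) v" N "ennreal (\<rho> v)" "d n v", OF _ this]
    have "(\<Sum>k<N. bQ (Suc n) v k) \<le> (\<Sum>i<N. ennreal (\<rho> v) ^ Suc i) * (\<Sum>k<N. d n v k)"
      by (simp add: bQ_def Q0)
    then have "TQ (Suc n) v \<le> ennreal \<delta> * ((\<Sum>i<N. ennreal (\<rho> v) ^ Suc i) * (\<Sum>k<N. d n v k))"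
      unfolding TQ_def by (rule mult_left_mono) simp
    also have "\<dots> \<le> ennreal (K v) * (\<Sum>k<N. d n v k)"
      unfolding mult.assoc[symmetric] by (rule mult_right_mono[OF \<rho>K']) simp
    finally show ?thesis unfolding d_sum .
  qed
  have "ennreal (norm (Q (Suc n) 0 k)) \<le> (\<Sum>j<k. d n 0 j)" if "k \<le> N" for k
    using that
  proof (induction k)
    case (Suc k)
    then have "ennreal (norm (Q (Suc n) 0 (Suc k))) \<le> ennreal (norm (Q (Suc n) 0 k)) + d n 0 k"
      using norm_Q_Suc[of k n 0] by (simp add: bQ_def \<rho>(3) d_def)
    also have "\<dots> \<le> (\<Sum>j<k. d n 0 j) + d n 0 k" using Suc by (intro add_right_mono) auto
    finally show ?case by simp
  qed (simp add: Q0)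
  from this[of N] have "ennreal (norm (Q (Suc n) 0 N)) \<le> (\<integral>\<^sup>+u. ennreal (norm (F u)) * TQ n u \<partial>lborel)"
    unfolding d_sum by simp
  moreover have "Q (Suc n) 0 N = of_real (expectation (\<lambda>\<omega>. walk_esum (Suc n) N (path \<omega>)))"
    unfolding Q_def by (simp add: integral_complex_of_real)
  ultimately have "(ennreal \<bar>expectation (\<lambda>\<omega>. walk_esum (Suc n) N (path \<omega>))\<bar>)\<^sup>2 \<le> (\<integral>\<^sup>+u. ennreal (norm (F u)) * TQ n u \<partial>lborel)\<^sup>2"
    by (intro power_mono) auto
  also have "\<dots> \<le> B * ((ennreal (2 * A) * \<kappa> * B) ^ n * \<kappa>)"
    unfolding B_def \<kappa>_def
    by (rule kernel_chain_bound[OF K _ TQ_measurable K0 A KK T0 TS]) measurable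
  finally show ?thesis .
qed

end

section \<open>From the walk to the process\<close>

lemma right_continuous_seq:
  fixes Y :: "real \<Rightarrow> real"
  assumes Y: "continuous (at_right s) Y" and p: "p \<longlonglongrightarrow> s" "\<And>n. s \<le> p n"
  shows "(\<lambda>n. Y (p n)) \<longlonglongrightarrow> Y s"
proof (rule LIMSEQ_I)
  fix e :: real assume "0 < e"
  have "(Y \<longlongrightarrow> Y s) (at_right s)" using Y by (simp add: continuous_within)
  then have "\<forall>\<^sub>F y in at_right s. dist (Y y) (Y s) < e" using \<open>0 < e\<close> by (rule tendstoD)
  then obtain b where b: "s < b" "\<And>y. s < y \<Longrightarrow> y < b \<Longrightarrow> dist (Y y) (Y s) < e"
    unfolding eventually_at_right_field by blast
  have "\<forall>\<^sub>F n in sequentially. p n < b" using p(1) b(1) by (rule order_tendstoD)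
  then obtain n0 where n0: "\<And>n. n \<ge> n0 \<Longrightarrow> p n < b" by (auto simp: eventually_sequentially)
  show "\<exists>n0. \<forall>n\<ge>n0. norm (Y (p n) - Y s) < e"
  proof (intro exI allI impI)
    fix n assume "n \<ge> n0"
    then show "norm (Y (p n) - Y s) < e"
      using b(2)[of "p n"] n0[of n] p(2)[of n] \<open>0 < e\<close> by (cases "p n = s") (auto simp: dist_real_def)
  qed
qed

text \<open>The path is sampled at the right ends of the cells, so that right continuity suffices.\<close>

lemma riemann_sum_right_continuous:
  fixes Y \<phi> :: "real \<Rightarrow> real"
  assumes t: "0 \<le> t" and Y: "\<And>s. 0 \<le> s \<Longrightarrow> continuous (at_right s) Y"
    and \<phi>: "continuous_on UNIV \<phi>" "\<And>y. \<bar>\<phi> y\<bar> \<le> m"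
  shows "integrable lborel (\<lambda>s. indicator {0..t} s * \<phi> (Y s))"
    and "(\<lambda>n. \<Sum>j<Suc n. t / real (Suc n) * \<phi> (Y (real (Suc j) * (t / real (Suc n)))))
       \<longlonglongrightarrow> (\<integral>s. indicator {0..t} s * \<phi> (Y s) \<partial>lborel)"
proof -
  define \<delta> where "\<delta> n = t / real (Suc n)" for n
  have \<delta>0: "0 \<le> \<delta> n" for n using t by (simp add: \<delta>_def)
  have m: "0 \<le> m" using \<phi>(2)[of 0] by linarith
  define f where "f n s = (\<Sum>j<Suc n. indicator {real j * \<delta> n<..real (Suc j) * \<delta> n} s * \<phi> (Y (real (Suc j) * \<delta> n)))" for n s
  define g where "g s = indicator {0<..t} s * \<phi> (Y s)" for s
  have lim: "(\<lambda>n. f n s) \<longlonglongrightarrow> g s" and bound: "\<bar>f n s\<bar> \<le> m * indicator {0..t} s" for s n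
  proof -
    have out: "f n s = 0" if "\<not> (0 < s \<and> s \<le> t)" for n
    proof -
      have "s \<notin> {real j * \<delta> n<..real (Suc j) * \<delta> n}" if j: "j < Suc n" for j
      proof
        assume s: "s \<in> {real j * \<delta> n<..real (Suc j) * \<delta> n}"
        have "0 \<le> real j * \<delta> n" using \<delta>0[of n] by simp
        also have "\<dots> < s" using s by simp
        finally have "0 < s" .
        moreover have "real (Suc j) * \<delta> n \<le> real (Suc n) * \<delta> n" using j \<delta>0[of n] by (intro mult_right_mono) auto
        then have "s \<le> t" using s by (simp add: \<delta>_def)
        ultimately show False using \<open>\<not> (0 < s \<and> s \<le> t)\<close> by simp
      qed
      then show ?thesis unfolding f_def by (intro sum.neutral) auto
    qed
    define p where "p n = of_int \<lceil>s / \<delta> n\<rceil> * \<delta> n" for n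
    have ins: "f n s = \<phi> (Y (p n)) \<and> s \<le> p n \<and> p n \<le> s + \<delta> n" if s: "0 < s" "s \<le> t" for n
    proof -
      have \<delta>: "0 < \<delta> n" using s by (simp add: \<delta>_def)
      define k where "k = nat \<lceil>s / \<delta> n\<rceil> - 1"
      have c1: "1 \<le> \<lceil>s / \<delta> n\<rceil>" using s \<delta> by (simp add: one_le_ceiling)
      then have k: "real (Suc k) = of_int \<lceil>s / \<delta> n\<rceil>" unfolding k_def by simp
      have b: "real k < s / \<delta> n" "s / \<delta> n \<le> real (Suc k)"
        using ceiling_correct[of "s / \<delta> n"] k by auto
      have "real (Suc n) * \<delta> n = t" by (simp add: \<delta>_def)
      then have "s / \<delta> n \<le> real (Suc n)" using s \<delta> by (simp add: pos_divide_le_eq del: of_nat_Suc)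
      then have kn: "k < Suc n" using b by linarith
      have ind: "indicator {real j * \<delta> n<..real (Suc j) * \<delta> n} s = (if j = k then 1 else (0::real))" for j
      proof -
        have "s \<in> {real j * \<delta> n<..real (Suc j) * \<delta> n} \<longleftrightarrow> real j < s / \<delta> n \<and> s / \<delta> n \<le> real (Suc j)"
          using \<delta> by (auto simp: field_simps)
        also have "\<dots> \<longleftrightarrow> j = k"
        proof
          assume "real j < s / \<delta> n \<and> s / \<delta> n \<le> real (Suc j)"
          then have "real j < real (Suc k)" "real k < real (Suc j)" using b by linarith+
          then show "j = k" by simp
        qed (use b in auto)
        finally show ?thesis by (simp add: indicator_def)
      qed
      have "f n s = (\<Sum>j<Suc n. if j = k then \<phi> (Y (real (Suc j) * \<delta> n)) else 0)"
        unfolding f_def ind by (intro sum.cong) auto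
      also have "\<dots> = \<phi> (Y (p n))" using kn unfolding p_def k[symmetric] by simp
      finally have "f n s = \<phi> (Y (p n))" .
      moreover have "s \<le> p n" unfolding p_def k[symmetric] using b(2) \<delta> by (simp add: field_simps)
      moreover have "p n \<le> s + \<delta> n" unfolding p_def k[symmetric] using b(1) \<delta> by (simp add: field_simps)
      ultimately show ?thesis by simp
    qed
    show "(\<lambda>n. f n s) \<longlonglongrightarrow> g s"
    proof (cases "0 < s \<and> s \<le> t")
      case True
      have "(\<lambda>n. t * inverse (real (Suc n))) \<longlonglongrightarrow> t * 0" by (intro tendsto_intros LIMSEQ_inverse_real_of_nat)
      then have "\<delta> \<longlonglongrightarrow> 0" by (simp add: \<delta>_def[abs_def] divide_inverse)
      then have "(\<lambda>n. s + \<delta> n) \<longlonglongrightarrow> s + 0" by (intro tendsto_intros)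
      then have "p \<longlonglongrightarrow> s"
        using ins True by (intro tendsto_sandwich[of "\<lambda>_. s" p sequentially "\<lambda>n. s + \<delta> n"]) auto
      moreover have "s \<le> p n" for n using ins True by auto
      ultimately have "(\<lambda>n. Y (p n)) \<longlonglongrightarrow> Y s"
        using Y[of s] True by (intro right_continuous_seq[of s Y p]) auto
      moreover have "isCont \<phi> (Y s)" using \<phi>(1) by (simp add: continuous_on_eq_continuous_at)
      ultimately have "(\<lambda>n. \<phi> (Y (p n))) \<longlonglongrightarrow> \<phi> (Y s)"
        by (rule isCont_tendsto_compose[rotated])
      then show ?thesis using ins True by (simp add: g_def)
    qed (simp add: out g_def)
    show "\<bar>f n s\<bar> \<le> m * indicator {0..t} s"
      using ins[of n] out[of n] \<phi>(2) m by (cases "0 < s \<and> s \<le> t") auto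
  qed
  have meas: "f n \<in> borel_measurable lborel" for n unfolding f_def[abs_def] by measurable
  then have gm: "g \<in> borel_measurable lborel" by (rule borel_measurable_LIMSEQ_real[OF lim])
  have dom: "integrable lborel (\<lambda>s. m * indicator {0..t} s)"
    using t by (intro integrable_mult_right integrable_real_indicator) auto
  have null: "AE s in lborel. s \<noteq> (0::real)" by (rule AE_lborel_singleton)
  have eq: "AE s in lborel. indicator {0..t} s * \<phi> (Y s) = g s"
    using null by eventually_elim (auto simp: g_def indicator_def)
  have b': "AE s in lborel. norm (f n s) \<le> m * indicator {0..t} s" for n
    using bound by (intro AE_I2) simp
  have gi: "integrable lborel g"
    by (rule integrable_dominated_convergence[OF gm meas dom AE_I2[OF lim] b'])
  have gl: "(\<lambda>n. integral\<^sup>L lborel (f n)) \<longlonglongrightarrow> integral\<^sup>L lborel g"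
    by (rule integral_dominated_convergence[OF gm meas dom AE_I2[OF lim] b'])
  have g': "(\<lambda>s. indicator {0..t} s * \<phi> (Y s)) = (\<lambda>s. g s + indicator {0} s * (indicator {0..t} 0 * \<phi> (Y 0)))"
    by (auto simp: g_def indicator_def fun_eq_iff)
  have m': "(\<lambda>s. indicator {0..t} s * \<phi> (Y s)) \<in> borel_measurable lborel"
    unfolding g' using gm by measurable
  show "integrable lborel (\<lambda>s. indicator {0..t} s * \<phi> (Y s))"
    by (rule integrable_cong_AE_imp[OF gi m']) (use eq in eventually_elim, simp)
  have "(\<integral>s. indicator {0..t} s * \<phi> (Y s) \<partial>lborel) = integral\<^sup>L lborel g"
    by (rule integral_cong_AE[OF m' gm eq])
  moreover have "integral\<^sup>L lborel (f n) = (\<Sum>j<Suc n. t / real (Suc n) * \<phi> (Y (real (Suc j) * (t / real (Suc n)))))" for n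
  proof -
    have em: "emeasure lborel {real j * \<delta> n<..real (Suc j) * \<delta> n} = ennreal (\<delta> n)" for j
      using \<delta>0[of n] by (subst emeasure_lborel_Ioc) (auto simp: algebra_simps)
    have I: "integrable lborel (\<lambda>s. indicator {real j * \<delta> n<..real (Suc j) * \<delta> n} s * c)" for j and c :: real
      by (intro integrable_mult_left integrable_real_indicator) (auto simp: em simp del: of_nat_Suc)
    have J: "(\<integral>s. indicator {real j * \<delta> n<..real (Suc j) * \<delta> n} s * c \<partial>lborel) = \<delta> n * c" for j and c :: real
      using \<delta>0[of n] by (simp add: measure_def em del: of_nat_Suc)
    show ?thesis
      unfolding f_def by (subst Bochner_Integration.integral_sum[OF I]) (simp only: J, simp add: \<delta>_def)
  qed
  ultimately show "(\<lambda>n. \<Sum>j<Suc n. t / real (Suc n) * \<phi> (Y (real (Suc j) * (t / real (Suc n)))))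
       \<longlonglongrightarrow> (\<integral>s. indicator {0..t} s * \<phi> (Y s) \<partial>lborel)"
    using gl by simp
qed

text \<open>The left-hand side is at most \<open>t\<close>, and as a geometric series at most \<open>1 / (\<sigma> \<bar>v\<bar> powr \<alpha>)\<close>.\<close>

lemma sum_exp_le:
  fixes \<sigma> t a :: real
  assumes \<sigma>: "0 < \<sigma>" and t: "0 \<le> t"
  shows "t / real (Suc n) * (\<Sum>i<Suc n. exp (- \<sigma> * (t / real (Suc n)) * \<bar>v\<bar> powr \<alpha>) ^ Suc i) \<le> (t + 1 / \<sigma>) * stable_kernel \<alpha> v"
proof -
  define a where "a = \<bar>v\<bar> powr \<alpha>"
  define \<delta> where "\<delta> = t / real (Suc n)"
  define r where "r = exp (- \<sigma> * \<delta> * a)"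
  define S where "S = (\<Sum>i<Suc n. r ^ Suc i)"
  have a: "0 \<le> a" by (simp add: a_def)
  have \<delta>: "0 \<le> \<delta>" using t by (simp add: \<delta>_def)
  have r: "0 < r" "r \<le> 1" using \<sigma> \<delta> a by (auto simp: r_def)
  have S0: "0 \<le> S" unfolding S_def using r by (intro sum_nonneg) auto
  have "S \<le> (\<Sum>i<Suc n. 1)" unfolding S_def using r by (intro sum_mono power_le_one) auto
  then have "\<delta> * S \<le> \<delta> * real (Suc n)" using \<delta> by (intro mult_left_mono) auto
  then have 1: "\<delta> * S \<le> t" by (simp add: \<delta>_def)
  have "S * (1 - r) = r * (1 - r ^ Suc n)"
    unfolding S_def power_Suc sum_distrib_left[symmetric] using one_diff_power_eq[of r "Suc n"] by (simp add: mult_ac)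
  also have "\<dots> \<le> r" using r by (simp add: mult_left_le)
  finally have Sr: "S * (1 - r) \<le> r" .
  have "1 + \<sigma> * \<delta> * a \<le> exp (\<sigma> * \<delta> * a)" by (rule exp_ge_add_one_self)
  then have "r * (1 + \<sigma> * \<delta> * a) \<le> r * exp (\<sigma> * \<delta> * a)" using r by (intro mult_left_mono) auto
  also have "\<dots> = 1" by (simp add: r_def exp_add[symmetric])
  finally have "r * (\<sigma> * \<delta> * a) \<le> 1 - r" by (simp add: algebra_simps)
  then have "S * (r * (\<sigma> * \<delta> * a)) \<le> S * (1 - r)" using S0 by (rule mult_left_mono)
  then have "r * (S * (\<sigma> * \<delta> * a)) \<le> r * 1" using Sr by (simp add: mult_ac)
  then have "S * (\<sigma> * \<delta> * a) \<le> 1" using r by simp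
  then have 2: "\<delta> * S * a \<le> 1 / \<sigma>" using \<sigma> by (simp add: field_simps)
  have "\<delta> * S * (1 + a) \<le> t + 1 / \<sigma>" using 1 2 by (simp add: distrib_left)
  then have "\<delta> * S \<le> (t + 1 / \<sigma>) / (1 + a)" using a by (simp add: pos_le_divide_eq add_pos_nonneg)
  then show ?thesis unfolding S_def \<delta>_def r_def a_def stable_kernel_def by simp
qed

definition potential_bound :: "real \<Rightarrow> real \<Rightarrow> real \<Rightarrow> real \<Rightarrow> real" where
  "potential_bound \<alpha> \<sigma> t v = (t + 1 / \<sigma>) * stable_kernel \<alpha> v"

definition kernel_mass :: "real \<Rightarrow> real \<Rightarrow> real \<Rightarrow> ennreal" where
  "kernel_mass \<alpha> \<sigma> t = (\<integral>\<^sup>+u. ennreal (potential_bound \<alpha> \<sigma> t u) \<partial>lborel)"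

definition spectral_energy :: "real \<Rightarrow> real \<Rightarrow> real \<Rightarrow> (real \<Rightarrow> complex) \<Rightarrow> ennreal" where
  "spectral_energy \<alpha> \<sigma> t F = (\<integral>\<^sup>+u. ennreal (norm (F u)) ^ 2 * ennreal (potential_bound \<alpha> \<sigma> t u) \<partial>lborel)"

text \<open>\<open>A\<close> is the pointwise limit of the sums over time grids, which makes it measurable; the integral may
  differ from it on paths that are not right continuous.\<close>

lemma additive_functional_moment:
  fixes X :: "real \<Rightarrow> 'a \<Rightarrow> real"
  assumes M: "prob_space M" and X: "\<And>t. 0 \<le> t \<Longrightarrow> X t \<in> borel_measurable M"
    and X0: "AE \<omega> in M. X 0 \<omega> = x0"
    and indep: "\<And>n s. 0 \<le> s 0 \<Longrightarrow> (\<And>i. i < n \<Longrightarrow> s i \<le> s (Suc i)) \<Longrightarrow>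
        prob_space.indep_vars M (\<lambda>_. borel) (\<lambda>i \<omega>. X (s (Suc i)) \<omega> - X (s i) \<omega>) {..<n::nat}"
    and char: "\<And>s t u. 0 \<le> s \<Longrightarrow> s \<le> t \<Longrightarrow>
        char (distr M borel (\<lambda>\<omega>. X t \<omega> - X s \<omega>)) u = complex_of_real (exp (- \<sigma> * (t - s) * \<bar>u\<bar> powr \<alpha>))"
    and rc: "AE \<omega> in M. \<forall>t\<ge>0. continuous (at_right t) (\<lambda>s. X s \<omega>)"
    and \<sigma>: "0 < \<sigma>" and \<alpha>: "0 < \<alpha>" "\<alpha> \<le> 2" and t: "0 \<le> t"
    and \<phi>: "continuous_on UNIV \<phi>" "\<And>y. \<bar>\<phi> y\<bar> \<le> m"
    and F: "integrable lborel F" "\<And>y. complex_of_real (\<phi> y) = (\<integral>u. F u * iexp (u * y) \<partial>lborel)"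
    and R: "0 \<le> R" "spectral_energy \<alpha> \<sigma> t F * ((8 * kernel_mass \<alpha> \<sigma> t * spectral_energy \<alpha> \<sigma> t F) ^ n
       * kernel_mass \<alpha> \<sigma> t) \<le> ennreal (R\<^sup>2)"
    and even: "even (Suc n)"
  obtains A where "A \<in> borel_measurable M"
    "AE \<omega> in M. A \<omega> = (\<integral>s. indicator {0..t} s * \<phi> (X s \<omega>) \<partial>lborel)"
    "(\<integral>\<^sup>+\<omega>. ennreal (A \<omega> ^ Suc n) \<partial>M) \<le> ennreal (fact (Suc n) * R)"
proof -
  interpret prob_space M by (rule M)
  define \<delta> where "\<delta> i = t / real (Suc i)" for i
  have \<delta>0: "0 \<le> \<delta> i" for i using t by (simp add: \<delta>_def)
  have m: "0 \<le> m" using \<phi>(2)[of 0] by linarith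
  \<comment> \<open>The grid sum along the walk started at \<open>x0\<close>; almost surely this is the grid sum along \<open>X\<close>.\<close>
  define S where "S i \<omega> = (\<Sum>j<Suc i. \<delta> i * \<phi> (x0 + (\<Sum>l<Suc j. X (real (Suc l) * \<delta> i) \<omega> - X (real l * \<delta> i) \<omega>)))" for i \<omega>
  define \<rho> where "\<rho> i u = exp (- \<sigma> * \<delta> i * \<bar>u\<bar> powr \<alpha>)" for i u
  have [measurable]: "\<phi> \<in> borel_measurable borel" using \<phi>(1) by (rule borel_measurable_continuous_onI)
  have [measurable]: "(\<lambda>\<omega>. X (real l * \<delta> i) \<omega>) \<in> borel_measurable M" for l i
    using X[of "real l * \<delta> i"] \<delta>0[of i] by simp
  have Smeas [measurable]: "S i \<in> borel_measurable M" for i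
    unfolding S_def[abs_def] by measurable
  have Sbound: "\<bar>S i \<omega>\<bar> \<le> t * m" for i \<omega>
  proof -
    have "\<bar>S i \<omega>\<bar> \<le> (\<Sum>j<Suc i. \<delta> i * m)"
      unfolding S_def by (rule order_trans[OF sum_abs], rule sum_mono) (use \<delta>0[of i] \<phi>(2) in \<open>auto simp: abs_mult mult_left_mono\<close>)
    also have "\<dots> = t * m" by (simp add: \<delta>_def)
    finally show ?thesis .
  qed
  obtain C where C: "0 \<le> C" "\<And>a k m'. 0 \<le> m' \<Longrightarrow> real k * m' \<le> t * m \<Longrightarrow> (\<And>j. \<bar>a j\<bar> \<le> m') \<Longrightarrow>
    \<bar>fact (Suc n) * esum a (Suc n) k - (\<Sum>j<k. a (Suc j)) ^ Suc n\<bar> \<le> C * real k * m'\<^sup>2"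
    using esum_power_bound[of "t * m" "Suc n"] t m by (auto simp del: fact_Suc)
  have ES: "expectation (\<lambda>\<omega>. S i \<omega> ^ Suc n) \<le> fact (Suc n) * R + C * t * m\<^sup>2 * \<delta> i" for i
  proof -
    interpret W: fourier_walk M "\<lambda>l \<omega>. X (real (Suc l) * \<delta> i) \<omega> - X (real l * \<delta> i) \<omega>" "Suc i" "\<rho> i" x0 "\<delta> i" m \<phi> F
    proof
      show "indep_vars (\<lambda>_. borel) (\<lambda>l \<omega>. X (real (Suc l) * \<delta> i) \<omega> - X (real l * \<delta> i) \<omega>) {..<Suc i}"
        by (rule indep[of "\<lambda>l. real l * \<delta> i"]) (use \<delta>0[of i] in \<open>auto intro!: mult_right_mono\<close>)
      show "char (distr M borel (\<lambda>\<omega>. X (real (Suc l) * \<delta> i) \<omega> - X (real l * \<delta> i) \<omega>)) u = complex_of_real (\<rho> i u)" for l u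
        using char[of "real l * \<delta> i" "real (Suc l) * \<delta> i" u] \<delta>0[of i] unfolding \<rho>_def
        by (simp add: mult_right_mono left_diff_distrib[symmetric])
      show "\<rho> i \<in> borel_measurable borel" unfolding \<rho>_def[abs_def] by measurable
      show "0 \<le> \<rho> i u" "\<rho> i u \<le> 1" "\<rho> i 0 = 1" for u using \<sigma> \<delta>0[of i] by (auto simp: \<rho>_def)
    qed (use \<delta>0 \<phi> F in auto)
    let ?P = "\<lambda>\<omega> l. X (real (Suc l) * \<delta> i) \<omega> - X (real l * \<delta> i) \<omega>"
    define e where "e \<omega> = W.walk_esum (Suc n) (Suc i) (?P \<omega>)" for \<omega>
    have em: "e \<in> borel_measurable M" unfolding e_def[abs_def] by (rule W.walk_path_measurable) simp
    have eb: "\<bar>e \<omega>\<bar> \<le> (real (Suc i) * (\<delta> i * m)) ^ Suc n" for \<omega> unfolding e_def by (rule W.walk_esum_bound)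
    have ei: "integrable M e" by (rule integrable_const_bound[OF _ em]) (use eb in auto)
    have Si: "integrable M (\<lambda>\<omega>. S i \<omega> ^ Suc n)"
    proof (rule integrable_const_bound[of _ "(t * m) ^ Suc n"])
      show "AE \<omega> in M. norm (S i \<omega> ^ Suc n) \<le> (t * m) ^ Suc n"
        unfolding real_norm_def power_abs by (intro AE_I2 power_mono Sbound) simp
    qed measurable
    have close: "S i \<omega> ^ Suc n \<le> fact (Suc n) * e \<omega> + C * t * m\<^sup>2 * \<delta> i" for \<omega>
    proof -
      have k: "real (Suc i) * (\<delta> i * m) = t * m" by (simp add: \<delta>_def)
      have "\<bar>fact (Suc n) * e \<omega> - S i \<omega> ^ Suc n\<bar> \<le> C * real (Suc i) * (\<delta> i * m)\<^sup>2"
        unfolding e_def W.walk_esum_def S_def W.walk_def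
        by (rule C(2)) (use \<delta>0[of i] m \<phi>(2) k in \<open>auto simp: abs_mult mult_left_mono simp del: of_nat_Suc\<close>)
      also have "C * real (Suc i) * (\<delta> i * m)\<^sup>2 = C * (real (Suc i) * (\<delta> i * m)) * (\<delta> i * m)" by (simp add: power2_eq_square)
      also have "\<dots> = C * t * m\<^sup>2 * \<delta> i" unfolding k by (simp add: power2_eq_square)
      finally show ?thesis by linarith
    qed
    have "(ennreal \<bar>expectation e\<bar>)\<^sup>2 \<le> ennreal (R\<^sup>2)"
    proof -
      have kpos: "0 < potential_bound \<alpha> \<sigma> t v" for v
        unfolding potential_bound_def using \<sigma> t stable_kernel_pos[of \<alpha> v] by (intro mult_pos_pos add_nonneg_pos) auto
      have kk: "potential_bound \<alpha> \<sigma> t v * potential_bound \<alpha> \<sigma> t (w + v)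
         \<le> 4 * potential_bound \<alpha> \<sigma> t w * (potential_bound \<alpha> \<sigma> t v + potential_bound \<alpha> \<sigma> t (w + v))" for v w
      proof -
        have "(t + 1 / \<sigma>)\<^sup>2 * (stable_kernel \<alpha> v * stable_kernel \<alpha> (w + v))
          \<le> (t + 1 / \<sigma>)\<^sup>2 * (4 * stable_kernel \<alpha> w * (stable_kernel \<alpha> v + stable_kernel \<alpha> (w + v)))"
          by (intro mult_left_mono stable_kernel_mult_le \<alpha>) auto
        then show ?thesis unfolding potential_bound_def by (simp add: power2_eq_square algebra_simps)
      qed
      have km: "potential_bound \<alpha> \<sigma> t \<in> borel_measurable borel" unfolding potential_bound_def[abs_def] by measurable
      have "\<delta> i * (\<Sum>l<Suc i. \<rho> i v ^ Suc l) \<le> potential_bound \<alpha> \<sigma> t v" for v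
        unfolding \<delta>_def \<rho>_def potential_bound_def by (rule sum_exp_le[OF \<sigma> t])
      from W.moment_bound[OF km kpos _ kk this, of n] show ?thesis
        unfolding e_def[symmetric] using order_trans[OF _ R(2)[unfolded spectral_energy_def kernel_mass_def]] by simp
    qed
    then have "\<bar>expectation e\<bar>\<^sup>2 \<le> R\<^sup>2" by (simp add: ennreal_power)
    then have "expectation e \<le> R" using R(1) by (simp add: abs_le_square_iff[symmetric])
    have "expectation (\<lambda>\<omega>. S i \<omega> ^ Suc n) \<le> expectation (\<lambda>\<omega>. fact (Suc n) * e \<omega> + C * t * m\<^sup>2 * \<delta> i)"
      using close ei Si by (intro integral_mono) auto
    also have "\<dots> = fact (Suc n) * expectation e + C * t * m\<^sup>2 * \<delta> i" using ei by (simp add: prob_space)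
    also have "\<dots> \<le> fact (Suc n) * R + C * t * m\<^sup>2 * \<delta> i"
      using \<open>expectation e \<le> R\<close> by (intro add_right_mono mult_left_mono) auto
    finally show ?thesis .
  qed
  define A where "A \<omega> = lim (\<lambda>i. S i \<omega>)" for \<omega>
  have Am: "A \<in> borel_measurable M" unfolding A_def[abs_def] by (rule borel_measurable_lim_metric) measurable
  have conv: "AE \<omega> in M. (\<lambda>i. S i \<omega>) \<longlonglongrightarrow> (\<integral>s. indicator {0..t} s * \<phi> (X s \<omega>) \<partial>lborel)"
    using X0 rc
  proof eventually_elim
    case (elim \<omega>)
    have "x0 + (\<Sum>l<k. X (real (Suc l) * \<delta> i) \<omega> - X (real l * \<delta> i) \<omega>) = X (real k * \<delta> i) \<omega>" for k i
      using elim(1) sum_lessThan_telescope[of "\<lambda>l. X (real l * \<delta> i) \<omega>" k] by simp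
    then have "S i \<omega> = (\<Sum>j<Suc i. t / real (Suc i) * \<phi> (X (real (Suc j) * (t / real (Suc i))) \<omega>))" for i
      unfolding S_def \<delta>_def by (simp del: of_nat_Suc sum.lessThan_Suc)
    then show ?case
      using riemann_sum_right_continuous(2)[OF t, of "\<lambda>s. X s \<omega>" \<phi> m] elim(2) \<phi> by simp
  qed
  then have AS: "AE \<omega> in M. (\<lambda>i. S i \<omega>) \<longlonglongrightarrow> A \<omega>"
    by eventually_elim (simp add: A_def limI)
  have A1: "AE \<omega> in M. A \<omega> = (\<integral>s. indicator {0..t} s * \<phi> (X s \<omega>) \<partial>lborel)"
    using conv by eventually_elim (simp add: A_def limI)
  have "(\<integral>\<^sup>+\<omega>. ennreal (A \<omega> ^ Suc n) \<partial>M) \<le> (\<integral>\<^sup>+\<omega>. liminf (\<lambda>i. ennreal (S i \<omega> ^ Suc n)) \<partial>M)"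
  proof (rule nn_integral_mono_AE, use AS in eventually_elim)
    fix \<omega> assume "(\<lambda>i. S i \<omega>) \<longlonglongrightarrow> A \<omega>"
    then have "(\<lambda>i. ennreal (S i \<omega> ^ Suc n)) \<longlonglongrightarrow> ennreal (A \<omega> ^ Suc n)" by (intro tendsto_ennrealI tendsto_power)
    then show "ennreal (A \<omega> ^ Suc n) \<le> liminf (\<lambda>i. ennreal (S i \<omega> ^ Suc n))" by (simp add: lim_imp_Liminf)
  qed
  also have "\<dots> \<le> liminf (\<lambda>i. \<integral>\<^sup>+\<omega>. ennreal (S i \<omega> ^ Suc n) \<partial>M)" by (rule nn_integral_liminf) measurable
  also have "\<dots> \<le> liminf (\<lambda>i. ennreal (fact (Suc n) * R + C * t * m\<^sup>2 * \<delta> i))"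
  proof (rule Liminf_mono, rule always_eventually, rule allI)
    fix i
    have Si: "integrable M (\<lambda>\<omega>. S i \<omega> ^ Suc n)"
    proof (rule integrable_const_bound[of _ "(t * m) ^ Suc n"])
      show "AE \<omega> in M. norm (S i \<omega> ^ Suc n) \<le> (t * m) ^ Suc n"
        unfolding real_norm_def power_abs by (intro AE_I2 power_mono Sbound) simp
    qed measurable
    have "(\<integral>\<^sup>+\<omega>. ennreal (S i \<omega> ^ Suc n) \<partial>M) = ennreal (expectation (\<lambda>\<omega>. S i \<omega> ^ Suc n))"
      by (rule nn_integral_eq_integral[OF Si]) (use even in \<open>auto intro!: AE_I2 zero_le_even_power simp del: power_Suc\<close>)
    then show "(\<integral>\<^sup>+\<omega>. ennreal (S i \<omega> ^ Suc n) \<partial>M) \<le> ennreal (fact (Suc n) * R + C * t * m\<^sup>2 * \<delta> i)"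
      using ES[of i] by (simp add: ennreal_leI del: fact_Suc)
  qed
  also have "\<dots> = ennreal (fact (Suc n) * R)"
  proof -
    have "(\<lambda>i. fact (Suc n) * R + C * t * m\<^sup>2 * (t * inverse (real (Suc i)))) \<longlonglongrightarrow> fact (Suc n) * R + C * t * m\<^sup>2 * (t * 0)"
      by (intro tendsto_intros LIMSEQ_inverse_real_of_nat)
    then have "(\<lambda>i. fact (Suc n) * R + C * t * m\<^sup>2 * \<delta> i) \<longlonglongrightarrow> fact (Suc n) * R" by (simp add: \<delta>_def divide_inverse del: fact_Suc)
    then have "(\<lambda>i. ennreal (fact (Suc n) * R + C * t * m\<^sup>2 * \<delta> i)) \<longlonglongrightarrow> ennreal (fact (Suc n) * R)" by (rule tendsto_ennrealI)
    then show ?thesis by (simp add: lim_imp_Liminf del: fact_Suc)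
  qed
  finally show thesis using that Am A1 by blast
qed

section \<open>Gaussian mollification of the local time\<close>

lemma normal_density_fourier:
  assumes e: "0 < e"
  defines "G \<equiv> (\<lambda>u. complex_of_real (1 / (2 * pi) * exp (- (e * u)\<^sup>2 / 2)))"
  shows "integrable lborel G"
    and "complex_of_real (normal_density 0 e y) = (\<integral>u. G u * iexp (u * y) \<partial>lborel)"
proof -
  define S where "S x = complex_of_real (1 / sqrt (2 * pi) * std_normal_density x)" for x
  have "1 / (2 * pi) = 1 / sqrt (2 * pi) * (1 / sqrt (2 * pi))" by simp
  then have GS: "G u = S (0 + e * u)" for u
    unfolding G_def S_def std_normal_density_def by (simp only: mult.assoc add_0)
  have intS: "integrable lborel S"
    unfolding S_def[abs_def] by (intro integrable_of_real integrable_mult_right integrable_normal_density) simp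
  show "integrable lborel G"
    using lborel_integrable_real_affine[OF intS, of e 0] e by (simp add: GS[abs_def])
  have "(\<integral>x. S x * iexp (x * (y / e)) \<partial>lborel) = (1 / sqrt (2 * pi)) * char std_normal_distribution (y / e)"
  proof -
    have "char std_normal_distribution (y / e) = (\<integral>x. std_normal_density x *\<^sub>R iexp (y / e * x) \<partial>lborel)"
      unfolding char_def by (subst integral_density) auto
    also have "(1 / sqrt (2 * pi)) * \<dots> = (\<integral>x. (1 / sqrt (2 * pi)) * (std_normal_density x *\<^sub>R iexp (y / e * x)) \<partial>lborel)"
      by (rule integral_mult_right_zero[symmetric])
    finally show ?thesis
      unfolding S_def mult.commute[of "y / e"] by (simp only: scaleR_conv_of_real of_real_mult mult.assoc)
  qed
  also have "\<dots> = complex_of_real (1 / sqrt (2 * pi) * exp (- (y / e)\<^sup>2 / 2))"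
    unfolding char_std_normal_distribution by simp
  finally have 1: "(\<integral>x. S x * iexp (x * (y / e)) \<partial>lborel) = complex_of_real (1 / sqrt (2 * pi) * exp (- (y / e)\<^sup>2 / 2))" .
  have "(\<integral>x. S x * iexp (x * (y / e)) \<partial>lborel) = \<bar>e\<bar> *\<^sub>R (\<integral>u. S (0 + e * u) * iexp ((0 + e * u) * (y / e)) \<partial>lborel)"
    by (rule lborel_integral_real_affine) (use e in simp)
  also have "(\<integral>u. S (0 + e * u) * iexp ((0 + e * u) * (y / e)) \<partial>lborel) = (\<integral>u. G u * iexp (u * y) \<partial>lborel)"
    unfolding GS using e by simp
  finally have "(\<integral>u. G u * iexp (u * y) \<partial>lborel) = complex_of_real (1 / e * (1 / sqrt (2 * pi) * exp (- (y / e)\<^sup>2 / 2)))"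
    unfolding 1 using e by (simp add: scaleR_conv_of_real field_simps)
  moreover have "1 / e * (1 / sqrt (2 * pi) * exp (- (y / e)\<^sup>2 / 2)) = normal_density 0 e y"
    unfolding normal_density_def using e by (simp add: real_sqrt_mult power_divide field_simps)
  ultimately show "complex_of_real (normal_density 0 e y) = (\<integral>u. G u * iexp (u * y) \<partial>lborel)" by (simp only:)
qed

lemma normal_density_le:
  "0 < e \<Longrightarrow> normal_density 0 e y \<le> normal_density 0 e 0"
  unfolding normal_density_def by (intro mult_left_mono) auto

text \<open>Far from the origin the narrow Gaussian is a small multiple of the standard one.\<close>

lemma normal_density_far:
  assumes e: "0 < e" "e \<le> 1" and z: "\<eta> \<le> \<bar>z\<bar>" "0 \<le> \<eta>"
  shows "normal_density 0 e z \<le> 1 / e * exp (- \<eta>\<^sup>2 * (1 / e\<^sup>2 - 1) / 2) * std_normal_density z"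
proof -
  have c: "0 \<le> 1 / e\<^sup>2 - 1" using e by (simp add: power_le_one)
  have "\<eta>\<^sup>2 \<le> z\<^sup>2" using z by (simp add: abs_le_square_iff[symmetric])
  then have "\<eta>\<^sup>2 * (1 / e\<^sup>2 - 1) \<le> z\<^sup>2 * (1 / e\<^sup>2 - 1)" using c by (rule mult_right_mono)
  then have "exp (- z\<^sup>2 * (1 / e\<^sup>2 - 1) / 2) \<le> exp (- \<eta>\<^sup>2 * (1 / e\<^sup>2 - 1) / 2)" by simp
  then have "1 / e * exp (- z\<^sup>2 * (1 / e\<^sup>2 - 1) / 2) * std_normal_density z \<le> 1 / e * exp (- \<eta>\<^sup>2 * (1 / e\<^sup>2 - 1) / 2) * std_normal_density z"
    using e by (intro mult_right_mono mult_left_mono) auto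
  moreover have "1 / e * exp (- z\<^sup>2 * (1 / e\<^sup>2 - 1) / 2) * std_normal_density z = normal_density 0 e z"
  proof -
    have "exp (- z\<^sup>2 * (1 / e\<^sup>2 - 1) / 2) * exp (- z\<^sup>2 / 2) = exp (- z\<^sup>2 / (2 * e\<^sup>2))"
      using e by (simp add: exp_add[symmetric] field_simps)
    then have "1 / e * exp (- z\<^sup>2 * (1 / e\<^sup>2 - 1) / 2) * std_normal_density z = 1 / e * (1 / sqrt (2 * pi)) * exp (- z\<^sup>2 / (2 * e\<^sup>2))"
      unfolding std_normal_density_def by simp
    also have "\<dots> = normal_density 0 e z"
      unfolding normal_density_def using e by (simp add: real_sqrt_mult mult.commute)
    finally show ?thesis .
  qed
  ultimately show ?thesis by simp
qed

definition width :: "nat \<Rightarrow> real" where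
  "width i = 1 / real (Suc i)"

lemma width: "0 < width i" "width i \<le> 1"
  by (auto simp: width_def)

text \<open>Near \<open>x\<close> continuity is used; away from \<open>x\<close> the narrow Gaussian is a vanishing multiple of the standard
  one, against which \<open>l\<close> and its value at \<open>x\<close> have finite integrals.\<close>

lemma gaussian_approximation:
  fixes l :: "real \<Rightarrow> real"
  assumes l: "continuous_on UNIV l" "\<And>y. 0 \<le> l y" "integrable lborel l"
  shows "(\<lambda>i. \<integral>y. normal_density 0 (width i) (y - x) * l y \<partial>lborel) \<longlonglongrightarrow> l x"
proof -
  let ?n = "\<lambda>i y. normal_density 0 (width i) (y - x)"
  have nd: "integrable lborel (\<lambda>y. normal_density 0 e (y - x))" "(\<integral>y. normal_density 0 e (y - x) \<partial>lborel) = 1" if "0 < e" for e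
    using lborel_integrable_real_affine[of "normal_density 0 e" 1 "- x"] that
      lborel_integral_real_affine[of 1 "normal_density 0 e" "- x"] by simp_all
  have [measurable]: "l \<in> borel_measurable borel" using l(1) by (rule borel_measurable_continuous_onI)
  have int: "integrable lborel (\<lambda>y. normal_density 0 e (y - x) * l y)" if e: "0 < e" for e
  proof (rule Bochner_Integration.integrable_bound)
    show "integrable lborel (\<lambda>y. normal_density 0 e 0 * l y)" using l(3) by simp
    show "AE y in lborel. norm (normal_density 0 e (y - x) * l y) \<le> norm (normal_density 0 e 0 * l y)"
      using normal_density_le[OF e] l(2) by (intro AE_I2) (auto simp: abs_mult mult_right_mono)
  qed measurable
  define D where "D i = (\<integral>y. ?n i y * l y \<partial>lborel) - l x" for i
  define c where "c = (\<integral>y. std_normal_density (y - x) * l y \<partial>lborel) + l x"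
  have "\<bar>D i\<bar> \<le> e + (1 / width i * exp (- \<eta>\<^sup>2 * (1 / (width i)\<^sup>2 - 1) / 2)) * c"
    if e: "0 < e" and \<eta>: "0 < \<eta>" "\<And>y. \<bar>y - x\<bar> < \<eta> \<Longrightarrow> \<bar>l y - l x\<bar> < e" for e \<eta> i
  proof -
    define r where "r = 1 / width i * exp (- \<eta>\<^sup>2 * (1 / (width i)\<^sup>2 - 1) / 2)"
    have r: "0 \<le> r" using width(1)[of i] by (simp add: r_def)
    have i1: "integrable lborel (\<lambda>y. ?n i y * (l y - l x))"
      using int[OF width(1)] nd(1)[OF width(1)] by (simp add: right_diff_distrib)
    have i2: "integrable lborel (\<lambda>y. e * ?n i y + r * (std_normal_density (y - x) * l y + std_normal_density (y - x) * l x))"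
      using int[of 1] nd(1)[of 1] nd(1)[OF width(1)[of i]] by (intro Bochner_Integration.integrable_add integrable_mult_right integrable_mult_left) auto
    have "D i = (\<integral>y. ?n i y * (l y - l x) \<partial>lborel)"
      unfolding D_def using int[OF width(1)] nd[OF width(1)] by (simp add: right_diff_distrib)
    also have "\<bar>\<dots>\<bar> \<le> (\<integral>y. \<bar>?n i y * (l y - l x)\<bar> \<partial>lborel)"
      using integral_norm_bound[of lborel "\<lambda>y. ?n i y * (l y - l x)"] by simp
    also have "\<dots> \<le> (\<integral>y. e * ?n i y + r * (std_normal_density (y - x) * l y + std_normal_density (y - x) * l x) \<partial>lborel)"
    proof (rule integral_mono[OF integrable_abs[OF i1] i2])
      fix y
      have tail: "0 \<le> r * (std_normal_density (y - x) * l y + std_normal_density (y - x) * l x)"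
        using r l(2) by simp
      show "\<bar>?n i y * (l y - l x)\<bar> \<le> e * ?n i y + r * (std_normal_density (y - x) * l y + std_normal_density (y - x) * l x)"
      proof (cases "\<bar>y - x\<bar> < \<eta>")
        case True
        then have "?n i y * \<bar>l y - l x\<bar> \<le> ?n i y * e" using \<eta>(2)[of y] by (intro mult_left_mono) auto
        then show ?thesis using tail by (simp add: abs_mult mult.commute)
      next
        case False
        have "?n i y * \<bar>l y - l x\<bar> \<le> (r * std_normal_density (y - x)) * (l y + l x)"
        proof (rule mult_mono)
          show "?n i y \<le> r * std_normal_density (y - x)"
            unfolding r_def by (rule normal_density_far[OF width]) (use False \<eta>(1) in auto)
        qed (use l(2)[of x] l(2)[of y] r in auto)
        moreover have "0 \<le> e * ?n i y" using e by simp
        ultimately show ?thesis unfolding abs_mult by (simp add: distrib_left distrib_right mult_ac)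
      qed
    qed
    also have "\<dots> = e + r * c"
      using int[of 1] nd[of 1] nd[OF width(1)[of i]] by (simp add: c_def)
    finally show ?thesis unfolding r_def .
  qed note bound = this
  have "D \<longlonglongrightarrow> 0"
  proof (rule LIMSEQ_I)
    fix e :: real assume e: "0 < e"
    have "isCont l x" using l(1) by (simp add: continuous_on_eq_continuous_at)
    then obtain \<eta> where \<eta>: "0 < \<eta>" "\<And>y. \<bar>y - x\<bar> < \<eta> \<Longrightarrow> \<bar>l y - l x\<bar> < e / 2"
      using e unfolding continuous_at_eps_delta dist_real_def by (meson half_gt_zero)
    have "(\<lambda>i. (1 / width i * exp (- \<eta>\<^sup>2 * (1 / (width i)\<^sup>2 - 1) / 2)) * c) \<longlonglongrightarrow> 0 * c"
      unfolding width_def using \<eta>(1) by (intro tendsto_mult tendsto_const) real_asymp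
    then have "\<forall>\<^sub>F i in sequentially. (1 / width i * exp (- \<eta>\<^sup>2 * (1 / (width i)\<^sup>2 - 1) / 2)) * c < e / 2"
      using e by (intro order_tendstoD(2)) auto
    then obtain n0 where n0: "\<And>i. i \<ge> n0 \<Longrightarrow> (1 / width i * exp (- \<eta>\<^sup>2 * (1 / (width i)\<^sup>2 - 1) / 2)) * c < e / 2"
      by (auto simp: eventually_sequentially)
    have "\<bar>D i\<bar> < e" if "i \<ge> n0" for i
      using bound[OF _ \<eta>, of i] n0[OF that] e by linarith
    then show "\<exists>n0. \<forall>i\<ge>n0. norm (D i - 0) < e" by auto
  qed
  then have "(\<lambda>i. D i + l x) \<longlonglongrightarrow> 0 + l x" by (intro tendsto_intros)
  then show ?thesis by (simp add: D_def)
qed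

text \<open>Let \<open>\<phi>\<close> be the Gaussian mollification of \<open>\<Sum> c\<^sub>l (\<delta>\<^bsub>x (l + 1)\<^esub> - \<delta>\<^bsub>x l\<^esub>)\<close>. The energy of its Fourier
  transform is bounded uniformly in the width, so that the bound on the moments passes to the limit by
  Fatou's lemma.\<close>

theorem local_time_moment:
  fixes X :: "real \<Rightarrow> 'a \<Rightarrow> real" and L :: "real \<Rightarrow> real \<Rightarrow> 'a \<Rightarrow> real"
  assumes M: "prob_space M" and stable: "symmetric_stable_process M \<alpha> X"
    and L: "jointly_continuous_local_time M X L" and \<alpha>: "1 < \<alpha>" "\<alpha> < 2" and t: "0 \<le> t"
  shows "\<exists>C\<ge>0. \<forall>k c x b. (\<forall>l<k. x l \<le> x (Suc l)) \<longrightarrow> (\<forall>l<k. \<bar>c l\<bar> \<le> b) \<longrightarrow>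
    (\<integral>\<^sup>+\<omega>. ennreal ((\<Sum>l<k. c l * (L t (x (Suc l)) \<omega> - L t (x l) \<omega>)) ^ (2 * Suc r)) \<partial>M)
      \<le> ennreal (C * (b\<^sup>2 * (\<Sum>l<k. (x (Suc l) - x l) powr (\<alpha> - 1))) ^ Suc r)"
proof -
  interpret prob_space M by (rule M)
  note st = stable[unfolded symmetric_stable_process_def]
  note st1 = st[THEN conjunct2] note st2 = st1[THEN conjunct2] note st3 = st2[THEN conjunct2]
  have X: "\<And>t. 0 \<le> t \<Longrightarrow> X t \<in> borel_measurable M" using st[THEN conjunct1] by blast
  obtain x0 where X0: "AE \<omega> in M. X 0 \<omega> = x0" using st1[THEN conjunct1] by (elim exE)
  have indep: "indep_vars (\<lambda>_. borel) (\<lambda>i \<omega>. X (s (Suc i)) \<omega> - X (s i) \<omega>) {..<n::nat}"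
    if "0 \<le> s 0" "\<And>i. i < n \<Longrightarrow> s i \<le> s (Suc i)" for n s
    by (rule st2[THEN conjunct1, THEN spec, THEN spec, THEN mp]) (use that in simp)
  obtain \<sigma> where \<sigma>: "0 < \<sigma>" and char': "\<forall>s t u. 0 \<le> s \<and> s \<le> t \<longrightarrow>
        char (distr M borel (\<lambda>\<omega>. X t \<omega> - X s \<omega>)) u = complex_of_real (exp (- \<sigma> * (t - s) * \<bar>u\<bar> powr \<alpha>))"
    using st3[THEN conjunct1] by (elim exE conjE)
  have char: "char (distr M borel (\<lambda>\<omega>. X t \<omega> - X s \<omega>)) u = complex_of_real (exp (- \<sigma> * (t - s) * \<bar>u\<bar> powr \<alpha>))"
    if "0 \<le> s" "s \<le> t" for s t u
    by (rule char'[THEN spec, THEN spec, THEN spec, THEN mp]) (use that in simp)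
  note cadlag = st3[THEN conjunct2]
  have rc: "AE \<omega> in M. \<forall>t\<ge>0. continuous (at_right t) (\<lambda>s. X s \<omega>)"
    using cadlag by eventually_elim blast
  note lt = L[unfolded jointly_continuous_local_time_def]
  have Lm [measurable]: "L t x \<in> borel_measurable M" for x
    using L t by (simp add: jointly_continuous_local_time_def)
  have L0: "AE \<omega> in M. \<forall>x. 0 \<le> L t x \<omega>"
    using lt[THEN conjunct2, THEN conjunct1] by eventually_elim (use t in blast)
  have Lc: "AE \<omega> in M. continuous_on UNIV (\<lambda>x. L t x \<omega>)"
  proof -
    have "AE \<omega> in M. continuous_on ({0..} \<times> UNIV) (\<lambda>(t, x). L t x \<omega>)"
      using L unfolding jointly_continuous_local_time_def by blast
    then show ?thesis
    proof eventually_elim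
      case (elim \<omega>)
      have "continuous_on UNIV ((\<lambda>(t, x). L t x \<omega>) \<circ> (\<lambda>x. (t, x)))"
        by (rule continuous_on_compose[OF _ continuous_on_subset[OF elim]]) (use t in \<open>auto intro!: continuous_intros\<close>)
      then show ?case by (simp add: comp_def)
    qed
  qed
  have occ: "AE \<omega> in M. \<forall>\<phi>\<in>borel_measurable borel.
        (\<integral>\<^sup>+s\<in>{0..t}. \<phi> (X s \<omega>) \<partial>lborel) = (\<integral>\<^sup>+x. \<phi> x * ennreal (L t x \<omega>) \<partial>lborel)"
    using lt[THEN conjunct2, THEN conjunct2, THEN conjunct2] by eventually_elim (use t in blast)
  define \<kappa> where "\<kappa> = enn2real (kernel_mass \<alpha> \<sigma> t)"
  have \<kappa>: "kernel_mass \<alpha> \<sigma> t = ennreal \<kappa>" "0 \<le> \<kappa>"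
  proof -
    have "kernel_mass \<alpha> \<sigma> t = ennreal (t + 1 / \<sigma>) * (\<integral>\<^sup>+u. ennreal (stable_kernel \<alpha> u) \<partial>lborel)"
      unfolding kernel_mass_def potential_bound_def using t \<sigma> stable_kernel_pos[of \<alpha>] by (simp add: ennreal_mult less_imp_le nn_integral_cmult)
    also have "\<dots> < \<infinity>" using nn_integral_stable_kernel[OF \<alpha>(1)] by (simp add: ennreal_mult_less_top)
    finally show "kernel_mass \<alpha> \<sigma> t = ennreal \<kappa>" by (simp add: \<kappa>_def)
    show "0 \<le> \<kappa>" by (simp add: \<kappa>_def)
  qed
  define c0 where "c0 = (t + 1 / \<sigma>) * (4 * levy_const \<alpha>)"
  have c0: "0 \<le> c0" using t \<sigma> levy_const_nonneg[of \<alpha>] by (simp add: c0_def)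
  define n where "n = Suc (2 * r)"
  define C where "C = fact (Suc n) * (sqrt ((8 * \<kappa>) ^ n * \<kappa>) * c0 ^ Suc r)"
  show ?thesis
  proof (intro exI[of _ C] conjI allI impI)
    show "0 \<le> C" unfolding C_def using c0 \<kappa>(2) by (intro mult_nonneg_nonneg zero_le_power) auto
    fix k :: nat and c x :: "nat \<Rightarrow> real" and b :: real
    assume x: "\<forall>l<k. x l \<le> x (Suc l)" and c: "\<forall>l<k. \<bar>c l\<bar> \<le> b"
    define V where "V = b\<^sup>2 * (\<Sum>l<k. (x (Suc l) - x l) powr (\<alpha> - 1))"
    have V: "0 \<le> V" unfolding V_def by (intro mult_nonneg_nonneg sum_nonneg) auto
    define R where "R = sqrt ((8 * \<kappa>) ^ n * \<kappa>) * (c0 * V) ^ Suc r"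
    have R0: "0 \<le> R" unfolding R_def using c0 V \<kappa>(2) by (intro mult_nonneg_nonneg zero_le_power) auto
    define nd where "nd i z y = normal_density 0 (width i) (y - z)" for i z y
    define \<phi> where "\<phi> i y = (\<Sum>l<k. c l * (nd i (x (Suc l)) y - nd i (x l) y))" for i y
    define G where "G i u = complex_of_real (1 / (2 * pi) * exp (- (width i * u)\<^sup>2 / 2))" for i u
    define F where "F i u = G i u * step_transform k c x u" for i u
    have G: "integrable lborel (G i)" "complex_of_real (normal_density 0 (width i) y) = (\<integral>u. G i u * iexp (u * y) \<partial>lborel)" for i y
      using normal_density_fourier[OF width(1)[of i]] unfolding G_def[abs_def] by auto
    have Gz: "integrable lborel (\<lambda>u. G i u * iexp (- u * z))" for i z
      by (rule Bochner_Integration.integrable_bound[OF G(1)[of i]]) (use G(1)[of i] in \<open>auto simp: norm_mult\<close>)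
    have Gzy: "integrable lborel (\<lambda>u. G i u * iexp (- u * z) * iexp (u * y))" for i z y
      by (rule Bochner_Integration.integrable_bound[OF G(1)[of i]]) (use G(1)[of i] in \<open>auto simp: norm_mult\<close>)
    have nd_rep: "complex_of_real (nd i z y) = (\<integral>u. G i u * iexp (- u * z) * iexp (u * y) \<partial>lborel)" for i z y
      unfolding nd_def G(2) by (intro Bochner_Integration.integral_cong refl) (simp add: exp_add[symmetric] algebra_simps)
    have F_eq: "F i u = (\<Sum>l<k. of_real (c l) * (G i u * iexp (- u * x (Suc l)) - G i u * iexp (- u * x l)))" for i u
      unfolding F_def step_transform_def sum_distrib_left by (intro sum.cong refl) (simp add: algebra_simps)
    have F_int: "integrable lborel (F i)" for i
      unfolding F_eq by (intro Bochner_Integration.integrable_sum integrable_mult_right Bochner_Integration.integrable_diff Gz)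
    have F_rep: "complex_of_real (\<phi> i y) = (\<integral>u. F i u * iexp (u * y) \<partial>lborel)" for i y
    proof -
      have "(\<integral>u. F i u * iexp (u * y) \<partial>lborel)
        = (\<integral>u. (\<Sum>l<k. of_real (c l) * (G i u * iexp (- u * x (Suc l)) * iexp (u * y) - G i u * iexp (- u * x l) * iexp (u * y))) \<partial>lborel)"
        unfolding F_eq sum_distrib_right by (intro Bochner_Integration.integral_cong refl sum.cong) (simp add: algebra_simps)
      also have "\<dots> = (\<Sum>l<k. of_real (c l) * (of_real (nd i (x (Suc l)) y) - of_real (nd i (x l) y)))"
        unfolding nd_rep using Gzy
        by (subst Bochner_Integration.integral_sum) (auto intro!: integrable_mult_right Bochner_Integration.integrable_diff)
      also have "\<dots> = complex_of_real (\<phi> i y)" by (simp add: \<phi>_def)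
      finally show ?thesis by simp
    qed
    have nd_bound: "0 \<le> nd i z y" "nd i z y \<le> normal_density 0 (width i) 0" for i z y
      unfolding nd_def using normal_density_le[OF width(1)] by auto
    have nd_cont: "continuous_on UNIV (nd i z)" for i z
      unfolding nd_def[abs_def] normal_density_def by (intro continuous_intros) (use width(1)[of i] in auto)
    have \<phi>_cont: "continuous_on UNIV (\<phi> i)" for i
      unfolding \<phi>_def[abs_def] by (intro continuous_intros nd_cont)
    have \<phi>_bound: "\<bar>\<phi> i y\<bar> \<le> (\<Sum>l<k. \<bar>c l\<bar> * normal_density 0 (width i) 0)" for i y
      unfolding \<phi>_def
    proof (rule order_trans[OF sum_abs], rule sum_mono)
      fix l
      have "\<bar>nd i (x (Suc l)) y - nd i (x l) y\<bar> \<le> normal_density 0 (width i) 0"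
        using nd_bound[of i "x (Suc l)" y] nd_bound[of i "x l" y] by linarith
      then show "\<bar>c l * (nd i (x (Suc l)) y - nd i (x l) y)\<bar> \<le> \<bar>c l\<bar> * normal_density 0 (width i) 0"
        by (simp add: abs_mult mult_left_mono)
    qed
    have energy: "spectral_energy \<alpha> \<sigma> t (F i) \<le> ennreal (c0 * V)" for i
    proof -
      have st0: "step_transform k c x 0 = 0" by (simp add: step_transform_def)
      have "ennreal (norm (F i u)) ^ 2 * ennreal (potential_bound \<alpha> \<sigma> t u)
         \<le> ennreal (t + 1 / \<sigma>) * ennreal ((cmod (step_transform k c x u))\<^sup>2 * \<bar>u\<bar> powr - \<alpha>)" for u
      proof (cases "u = 0")
        case False
        have "1 \<le> 2 * pi" using pi_ge_two by linarith
        then have "1 / (2 * pi) * exp (- (width i * u)\<^sup>2 / 2) \<le> 1 * 1"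
          by (intro mult_mono) auto
        then have "norm (G i u) \<le> 1" unfolding G_def norm_of_real by (subst abs_of_nonneg) auto
        then have "norm (F i u) \<le> 1 * cmod (step_transform k c x u)"
          unfolding F_def norm_mult by (intro mult_right_mono) auto
        then have "(norm (F i u))\<^sup>2 * stable_kernel \<alpha> u \<le> (cmod (step_transform k c x u))\<^sup>2 * \<bar>u\<bar> powr - \<alpha>"
          using stable_kernel_le(2)[OF False, of \<alpha>] stable_kernel_pos[of \<alpha> u] by (intro mult_mono power_mono) auto
        then have "(t + 1 / \<sigma>) * ((norm (F i u))\<^sup>2 * stable_kernel \<alpha> u) \<le> (t + 1 / \<sigma>) * ((cmod (step_transform k c x u))\<^sup>2 * \<bar>u\<bar> powr - \<alpha>)"
          using t \<sigma> by (intro mult_left_mono) auto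
        then have "(norm (F i u))\<^sup>2 * potential_bound \<alpha> \<sigma> t u \<le> (t + 1 / \<sigma>) * ((cmod (step_transform k c x u))\<^sup>2 * \<bar>u\<bar> powr - \<alpha>)"
          by (simp add: potential_bound_def mult_ac)
        then have "ennreal ((norm (F i u))\<^sup>2 * potential_bound \<alpha> \<sigma> t u) \<le> ennreal ((t + 1 / \<sigma>) * ((cmod (step_transform k c x u))\<^sup>2 * \<bar>u\<bar> powr - \<alpha>))"
          by (rule ennreal_leI)
        then show ?thesis using t \<sigma> by (simp add: ennreal_mult' ennreal_mult'' ennreal_power[symmetric])
      qed (simp add: F_def st0)
      then have "(\<integral>\<^sup>+u. ennreal (norm (F i u)) ^ 2 * ennreal (potential_bound \<alpha> \<sigma> t u) \<partial>lborel)
        \<le> (\<integral>\<^sup>+u. ennreal (t + 1 / \<sigma>) * ennreal ((cmod (step_transform k c x u))\<^sup>2 * \<bar>u\<bar> powr - \<alpha>) \<partial>lborel)"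
        by (intro nn_integral_mono)
      also have "\<dots> = ennreal (t + 1 / \<sigma>) * (\<integral>\<^sup>+u. ennreal ((cmod (step_transform k c x u))\<^sup>2 * \<bar>u\<bar> powr - \<alpha>) \<partial>lborel)"
        by (rule nn_integral_cmult) (unfold step_transform_def, measurable)
      also have "\<dots> \<le> ennreal (t + 1 / \<sigma>) * ennreal (4 * levy_const \<alpha> * V)"
        unfolding V_def using x c by (intro mult_left_mono step_transform_energy \<alpha>) auto
      also have "\<dots> = ennreal (c0 * V)" using t \<sigma> by (simp add: c0_def ennreal_mult'[symmetric] mult.assoc del: ennreal_plus)
      finally show ?thesis unfolding spectral_energy_def .
    qed
    have R: "spectral_energy \<alpha> \<sigma> t (F i) * ((8 * kernel_mass \<alpha> \<sigma> t * spectral_energy \<alpha> \<sigma> t (F i)) ^ n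
       * kernel_mass \<alpha> \<sigma> t) \<le> ennreal (R\<^sup>2)" for i
    proof -
      have "spectral_energy \<alpha> \<sigma> t (F i) * ((8 * kernel_mass \<alpha> \<sigma> t * spectral_energy \<alpha> \<sigma> t (F i)) ^ n * kernel_mass \<alpha> \<sigma> t)
        \<le> ennreal (c0 * V) * ((8 * ennreal \<kappa> * ennreal (c0 * V)) ^ n * ennreal \<kappa>)"
        unfolding \<kappa>(1) by (intro mult_mono power_mono energy order_refl) auto
      moreover have "ennreal (c0 * V) * ((8 * ennreal \<kappa> * ennreal (c0 * V)) ^ n * ennreal \<kappa>)
        = ennreal ((c0 * V) * ((8 * \<kappa> * (c0 * V)) ^ n * \<kappa>))"
        using c0 V \<kappa>(2) by (simp add: ennreal_mult ennreal_power[symmetric])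
      moreover have "(c0 * V) * ((8 * \<kappa> * (c0 * V)) ^ n * \<kappa>) = R\<^sup>2"
      proof -
        define z where "z = c0 * V"
        have n': "2 * Suc r = Suc n" by (simp add: n_def)
        have "R\<^sup>2 = (sqrt ((8 * \<kappa>) ^ n * \<kappa>))\<^sup>2 * (z ^ Suc r)\<^sup>2"
          unfolding R_def z_def by (rule power_mult_distrib)
        also have "(sqrt ((8 * \<kappa>) ^ n * \<kappa>))\<^sup>2 = (8 * \<kappa>) ^ n * \<kappa>" using \<kappa>(2) by simp
        also have "(z ^ Suc r)\<^sup>2 = z ^ (2 * Suc r)" by (simp only: power_mult[symmetric] mult.commute)
        finally have "R\<^sup>2 = ((8 * \<kappa>) ^ n * \<kappa>) * z ^ Suc n" unfolding n' .
        then show ?thesis unfolding z_def[symmetric] by (simp add: power_mult_distrib mult_ac)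
      qed
      ultimately show ?thesis by simp
    qed
    have even: "even (Suc n)" by (simp add: n_def)
    have ex: "\<exists>A. A \<in> borel_measurable M \<and> (AE \<omega> in M. A \<omega> = (\<integral>s. indicator {0..t} s * \<phi> i (X s \<omega>) \<partial>lborel)) \<and>
      (\<integral>\<^sup>+\<omega>. ennreal (A \<omega> ^ Suc n) \<partial>M) \<le> ennreal (fact (Suc n) * R)" for i
      using \<alpha> by (rule_tac additive_functional_moment[OF M X X0 indep char rc \<sigma> _ _ t \<phi>_cont[of i] \<phi>_bound F_int F_rep R0 R even]) auto
    have "\<forall>i. \<exists>A. A \<in> borel_measurable M \<and> (AE \<omega> in M. A \<omega> = (\<integral>s. indicator {0..t} s * \<phi> i (X s \<omega>) \<partial>lborel)) \<and>
      (\<integral>\<^sup>+\<omega>. ennreal (A \<omega> ^ Suc n) \<partial>M) \<le> ennreal (fact (Suc n) * R)"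
      by (intro allI ex)
    from choice[OF this] obtain A where A': "\<forall>i. A i \<in> borel_measurable M \<and> (AE \<omega> in M. A i \<omega> = (\<integral>s. indicator {0..t} s * \<phi> i (X s \<omega>) \<partial>lborel)) \<and>
      (\<integral>\<^sup>+\<omega>. ennreal (A i \<omega> ^ Suc n) \<partial>M) \<le> ennreal (fact (Suc n) * R)"
      by (elim exE)
    have A: "A i \<in> borel_measurable M"
      "AE \<omega> in M. A i \<omega> = (\<integral>s. indicator {0..t} s * \<phi> i (X s \<omega>) \<partial>lborel)"
      "(\<integral>\<^sup>+\<omega>. ennreal (A i \<omega> ^ Suc n) \<partial>M) \<le> ennreal (fact (Suc n) * R)" for i
      by (rule A'[THEN spec, THEN conjunct1] A'[THEN spec, THEN conjunct2, THEN conjunct1]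
          A'[THEN spec, THEN conjunct2, THEN conjunct2])+
    define S where "S \<omega> = (\<Sum>l<k. c l * (L t (x (Suc l)) \<omega> - L t (x l) \<omega>))" for \<omega>
    have A2: "AE \<omega> in M. \<forall>i. A i \<omega> = (\<integral>s. indicator {0..t} s * \<phi> i (X s \<omega>) \<partial>lborel)"
      using A(2) by (simp add: AE_all_countable)
    have lim: "AE \<omega> in M. (\<lambda>i. A i \<omega>) \<longlonglongrightarrow> S \<omega>"
      using A2 L0 Lc occ rc
    proof eventually_elim
      case (elim \<omega>)
      have [measurable]: "(\<lambda>y. L t y \<omega>) \<in> borel_measurable borel" using elim(3) by (rule borel_measurable_continuous_onI)
      have occ\<omega>: "(\<integral>\<^sup>+s\<in>{0..t}. f (X s \<omega>) \<partial>lborel) = (\<integral>\<^sup>+y. f y * ennreal (L t y \<omega>) \<partial>lborel)"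
        if "f \<in> borel_measurable borel" for f using elim(4) that by blast
      have "(\<integral>\<^sup>+y. ennreal (L t y \<omega>) \<partial>lborel) < \<infinity>"
      proof -
        have "(\<integral>\<^sup>+y. ennreal (L t y \<omega>) \<partial>lborel) = ennreal t" using occ\<omega>[of "\<lambda>_. 1"] t by simp
        then show ?thesis by (simp only: ennreal_less_top infinity_ennreal_def)
      qed
      then have Li: "integrable lborel (\<lambda>y. L t y \<omega>)"
        using elim(2) by (intro integrableI_nonneg) auto
      have one: "integrable lborel (\<lambda>s. indicator {0..t} s * nd i z (X s \<omega>))"
        "(\<integral>s. indicator {0..t} s * nd i z (X s \<omega>) \<partial>lborel) = (\<integral>y. nd i z y * L t y \<omega> \<partial>lborel)" for i z
      proof -
        have b: "\<bar>nd i z y\<bar> \<le> normal_density 0 (width i) 0" for y using nd_bound[of i z y] by simp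
        show I: "integrable lborel (\<lambda>s. indicator {0..t} s * nd i z (X s \<omega>))"
          by (rule riemann_sum_right_continuous(1)[OF t _ nd_cont b]) (use elim(5) in blast)
        have [measurable]: "nd i z \<in> borel_measurable borel" using nd_cont by (rule borel_measurable_continuous_onI)
        have "ennreal (\<integral>s. indicator {0..t} s * nd i z (X s \<omega>) \<partial>lborel) = (\<integral>\<^sup>+s. ennreal (indicator {0..t} s * nd i z (X s \<omega>)) \<partial>lborel)"
          by (rule nn_integral_eq_integral[OF I, symmetric]) (simp add: nd_bound)
        also have "\<dots> = (\<integral>\<^sup>+s\<in>{0..t}. ennreal (nd i z (X s \<omega>)) \<partial>lborel)"
          by (intro nn_integral_cong) (auto simp: indicator_def)
        also have "\<dots> = (\<integral>\<^sup>+y. ennreal (nd i z y * L t y \<omega>) \<partial>lborel)"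
          using elim(2) nd_bound(1) by (subst occ\<omega>) (auto simp: ennreal_mult)
        finally have e: "ennreal (\<integral>s. indicator {0..t} s * nd i z (X s \<omega>) \<partial>lborel) = (\<integral>\<^sup>+y. ennreal (nd i z y * L t y \<omega>) \<partial>lborel)" .
        have "(\<integral>y. nd i z y * L t y \<omega> \<partial>lborel) = enn2real (\<integral>\<^sup>+y. ennreal (nd i z y * L t y \<omega>) \<partial>lborel)"
          using elim(2) nd_bound(1) by (intro integral_eq_nn_integral) auto
        also have "\<dots> = (\<integral>s. indicator {0..t} s * nd i z (X s \<omega>) \<partial>lborel)"
          unfolding e[symmetric] by (intro enn2real_ennreal Bochner_Integration.integral_nonneg) (simp add: nd_bound)
        finally show "(\<integral>s. indicator {0..t} s * nd i z (X s \<omega>) \<partial>lborel) = (\<integral>y. nd i z y * L t y \<omega> \<partial>lborel)" by simp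
      qed
      have AE_eq: "A i \<omega> = (\<Sum>l<k. c l * ((\<integral>y. nd i (x (Suc l)) y * L t y \<omega> \<partial>lborel) - (\<integral>y. nd i (x l) y * L t y \<omega> \<partial>lborel)))" for i
      proof -
        have "A i \<omega> = (\<integral>s. (\<Sum>l<k. c l * (indicator {0..t} s * nd i (x (Suc l)) (X s \<omega>) - indicator {0..t} s * nd i (x l) (X s \<omega>))) \<partial>lborel)"
          unfolding elim(1)[rule_format] \<phi>_def sum_distrib_left
          by (intro Bochner_Integration.integral_cong refl sum.cong) (simp add: algebra_simps)
        also have "\<dots> = (\<Sum>l<k. c l * ((\<integral>s. indicator {0..t} s * nd i (x (Suc l)) (X s \<omega>) \<partial>lborel) - (\<integral>s. indicator {0..t} s * nd i (x l) (X s \<omega>) \<partial>lborel)))"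
          using one(1)
          by (subst Bochner_Integration.integral_sum) (auto intro!: integrable_mult_right Bochner_Integration.integrable_diff)
        finally show ?thesis unfolding one(2) .
      qed
      have "(\<lambda>i. \<integral>y. nd i z y * L t y \<omega> \<partial>lborel) \<longlonglongrightarrow> L t z \<omega>" for z
        unfolding nd_def by (rule gaussian_approximation[OF elim(3) _ Li]) (use elim(2) in blast)
      then show "(\<lambda>i. A i \<omega>) \<longlonglongrightarrow> S \<omega>"
        unfolding AE_eq S_def by (intro tendsto_intros)
    qed
    have "(\<integral>\<^sup>+\<omega>. ennreal (S \<omega> ^ Suc n) \<partial>M) \<le> (\<integral>\<^sup>+\<omega>. liminf (\<lambda>i. ennreal (A i \<omega> ^ Suc n)) \<partial>M)"
    proof (rule nn_integral_mono_AE, use lim in eventually_elim)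
      fix \<omega> assume "(\<lambda>i. A i \<omega>) \<longlonglongrightarrow> S \<omega>"
      then have "(\<lambda>i. ennreal (A i \<omega> ^ Suc n)) \<longlonglongrightarrow> ennreal (S \<omega> ^ Suc n)" by (intro tendsto_ennrealI tendsto_power)
      then show "ennreal (S \<omega> ^ Suc n) \<le> liminf (\<lambda>i. ennreal (A i \<omega> ^ Suc n))" by (simp add: lim_imp_Liminf)
    qed
    also have "\<dots> \<le> liminf (\<lambda>i. \<integral>\<^sup>+\<omega>. ennreal (A i \<omega> ^ Suc n) \<partial>M)"
      using A(1) by (intro nn_integral_liminf) measurable
    also have "\<dots> \<le> liminf (\<lambda>i. ennreal (fact (Suc n) * R))"
      by (rule Liminf_mono, rule always_eventually, rule allI, rule A(3))
    also have "\<dots> = ennreal (fact (Suc n) * R)" by (simp add: Liminf_const)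
    also have "fact (Suc n) * R = C * V ^ Suc r"
      unfolding R_def C_def power_mult_distrib by (simp only: mult_ac)
    finally show "(\<integral>\<^sup>+\<omega>. ennreal ((\<Sum>l<k. c l * (L t (x (Suc l)) \<omega> - L t (x l) \<omega>)) ^ (2 * Suc r)) \<partial>M)
      \<le> ennreal (C * (b\<^sup>2 * (\<Sum>l<k. (x (Suc l) - x l) powr (\<alpha> - 1))) ^ Suc r)"
      unfolding S_def V_def n_def by simp
  qed
qed

section \<open>Measurability of the distance\<close>

lemma partitions_bounds:
  assumes "(n, x) \<in> partitions a b"
  shows "x 0 = a" "x n = b" "\<And>l. l < n \<Longrightarrow> x l \<le> x (Suc l)" "\<And>l. l \<le> n \<Longrightarrow> a \<le> x l \<and> x l \<le> b"
proof -
  have p: "x 0 = a" "x n = b" "\<forall>l\<in>{1..n}. x (l - 1) \<le> x l" using assms unfolding partitions_def by auto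
  show x: "x 0 = a" "x n = b" by (rule p)+
  show m: "x l \<le> x (Suc l)" if "l < n" for l using bspec[OF p(3), of "Suc l"] that by simp
  show "a \<le> x l \<and> x l \<le> b" if "l \<le> n" for l
    using mono_upto[of n x 0 l] mono_upto[of n x l n] m that x by simp
qed

definition rational_partition :: "real \<Rightarrow> real \<Rightarrow> nat \<times> int list \<times> nat \<Rightarrow> nat \<times> (nat \<Rightarrow> real)" where
  "rational_partition a b = (\<lambda>(n, ks, j). (n, \<lambda>l. if l = 0 then a else if l = n then b
     else if l < n then max a (min b (of_int (ks ! l) / real (Suc j))) else 0))"

text \<open>By continuity of the second level, partitions with rational interior points suffice.\<close>

lemma SUP_partitions_measurable:
  fixes H :: "real \<Rightarrow> real \<Rightarrow> 'a \<Rightarrow> real^2^2"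
  assumes ab: "a < b" and \<theta>: "0 < \<theta>"
    and H: "\<And>s u. (s, u) \<in> Delta a b \<Longrightarrow> H s u \<in> borel_measurable M"
    and cont: "\<And>\<omega>. continuous_on (Delta a b) (\<lambda>(s, u). H s u \<omega>)"
  shows "(\<lambda>\<omega>. SUP (n, x)\<in>partitions a b.
      ennreal ((\<Sum>l=1..n. norm (H (x (l - 1)) (x l) \<omega>) powr (\<theta> / 2)) powr (2 / \<theta>))) \<in> borel_measurable M"
proof -
  define val where "val p \<omega> = ennreal ((\<Sum>l=1..fst p. norm (H (snd p (l - 1)) (snd p l) \<omega>) powr (\<theta> / 2)) powr (2 / \<theta>))"
    for p :: "nat \<times> (nat \<Rightarrow> real)" and \<omega>
  define C where "C = partitions a b \<inter> range (rational_partition a b)"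
  have in_Delta: "(x (l - 1), x l) \<in> Delta a b" if p: "(n, x) \<in> partitions a b" and l: "l \<in> {1..n}" for n x l
  proof -
    obtain j where j: "l = Suc j" "j < n" using l by (cases l) auto
    then show ?thesis using partitions_bounds(3,4)[OF p, of j] partitions_bounds(4)[OF p, of l] l
      by (auto simp: Delta_def)
  qed
  have val_meas: "val p \<in> borel_measurable M" if "p \<in> partitions a b" for p
  proof -
    have "(\<lambda>\<omega>. \<Sum>l=1..fst p. norm (H (snd p (l - 1)) (snd p l) \<omega>) powr (\<theta> / 2)) \<in> borel_measurable M"
    proof (rule borel_measurable_sum)
      fix l assume "l \<in> {1..fst p}"
      then have [measurable]: "H (snd p (l - 1)) (snd p l) \<in> borel_measurable M"
        using in_Delta[of "fst p" "snd p" l] that by (intro H) auto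
      show "(\<lambda>\<omega>. norm (H (snd p (l - 1)) (snd p l) \<omega>) powr (\<theta> / 2)) \<in> borel_measurable M" by measurable
    qed
    then show ?thesis unfolding val_def[abs_def] by measurable
  qed
  have "(SUP p\<in>partitions a b. val p \<omega>) = (SUP p\<in>C. val p \<omega>)" for \<omega>
  proof (rule antisym)
    show "(SUP p\<in>C. val p \<omega>) \<le> (SUP p\<in>partitions a b. val p \<omega>)" by (rule SUP_subset_mono) (auto simp: C_def)
    show "(SUP p\<in>partitions a b. val p \<omega>) \<le> (SUP p\<in>C. val p \<omega>)"
    proof (rule SUP_least)
      fix p assume p: "p \<in> partitions a b"
      obtain n x where nx: "p = (n, x)" by (cases p)
      note P = partitions_bounds[OF p[unfolded nx]]
      have n: "n \<noteq> 0" using P(1,2) ab by (cases n) auto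
      define y where "y j = snd (rational_partition a b (n, map (\<lambda>l. \<lfloor>x l * real (Suc j)\<rfloor>) [0..<n], j))" for j
      have y: "y j l = (if l = 0 then a else if l = n then b else max a (min b (of_int \<lfloor>x l * real (Suc j)\<rfloor> / real (Suc j))))"
        if "l \<le> n" for j l
        using that unfolding y_def rational_partition_def by (auto simp: nth_append)
      have yC: "(n, y j) \<in> C" for j
      proof -
        have "y j l \<le> y j (Suc l)" if l: "l < n" for l
        proof -
          have "of_int \<lfloor>x l * real (Suc j)\<rfloor> / real (Suc j) \<le> of_int \<lfloor>x (Suc l) * real (Suc j)\<rfloor> / real (Suc j)"
            using P(3)[OF l] by (intro divide_right_mono) (auto intro!: floor_mono mult_right_mono simp del: of_nat_Suc)
          then show ?thesis using y[of l j] y[of "Suc l" j] l ab by (auto simp: max_def min_def)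
        qed
        moreover have "y j 0 = a" "y j n = b" using y[of 0 j] y[of n j] n by auto
        ultimately have "(n, y j) \<in> partitions a b" unfolding partitions_def by (auto simp: gr0_conv_Suc Suc_le_eq)
        moreover have "(n, y j) = rational_partition a b (n, map (\<lambda>l. \<lfloor>x l * real (Suc j)\<rfloor>) [0..<n], j)"
          by (simp add: y_def rational_partition_def)
        ultimately show ?thesis unfolding C_def by blast
      qed
      have ylim: "(\<lambda>j. y j l) \<longlonglongrightarrow> x l" if l: "l \<le> n" for l
      proof -
        have "(\<lambda>j. of_int \<lfloor>x l * real (Suc j)\<rfloor> / real (Suc j)) \<longlonglongrightarrow> x l"
        proof (rule tendsto_sandwich)
          have b: "x l * real (Suc j) - 1 \<le> of_int \<lfloor>x l * real (Suc j)\<rfloor>" "of_int \<lfloor>x l * real (Suc j)\<rfloor> \<le> x l * real (Suc j)" for j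
            by linarith+
          show "\<forall>\<^sub>F j in sequentially. x l - inverse (real (Suc j)) \<le> of_int \<lfloor>x l * real (Suc j)\<rfloor> / real (Suc j)"
          proof (intro always_eventually allI)
            fix j
            have "(x l * real (Suc j) - 1) / real (Suc j) \<le> of_int \<lfloor>x l * real (Suc j)\<rfloor> / real (Suc j)"
              by (rule divide_right_mono[OF b(1)]) simp
            moreover have "(x l * real (Suc j) - 1) / real (Suc j) = x l - inverse (real (Suc j))"
              by (simp add: diff_divide_distrib inverse_eq_divide del: of_nat_Suc)
            ultimately show "x l - inverse (real (Suc j)) \<le> of_int \<lfloor>x l * real (Suc j)\<rfloor> / real (Suc j)" by simp
          qed
          show "\<forall>\<^sub>F j in sequentially. of_int \<lfloor>x l * real (Suc j)\<rfloor> / real (Suc j) \<le> x l"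
            using b(2) by (intro always_eventually allI) (simp add: field_simps del: of_nat_Suc)
          have "(\<lambda>j. x l - inverse (real (Suc j))) \<longlonglongrightarrow> x l - 0" by (intro tendsto_intros LIMSEQ_inverse_real_of_nat)
          then show "(\<lambda>j. x l - inverse (real (Suc j))) \<longlonglongrightarrow> x l" by simp
        qed simp
        then have "(\<lambda>j. max a (min b (of_int \<lfloor>x l * real (Suc j)\<rfloor> / real (Suc j)))) \<longlonglongrightarrow> max a (min b (x l))"
          by (intro tendsto_max tendsto_min tendsto_const)
        moreover have "max a (min b (x l)) = x l" using P(4)[OF l] by auto
        ultimately have "(\<lambda>j. max a (min b (of_int \<lfloor>x l * real (Suc j)\<rfloor> / real (Suc j)))) \<longlonglongrightarrow> x l"
          by (simp only:)
        then show ?thesis unfolding y[OF l] using P(1,2) by (cases "l = 0"; cases "l = n") simp_all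
      qed
      have "(\<lambda>j. val (n, y j) \<omega>) \<longlonglongrightarrow> val p \<omega>"
        unfolding val_def nx fst_conv snd_conv
      proof (intro tendsto_ennrealI tendsto_powr' tendsto_sum tendsto_norm)
        fix l assume l: "l \<in> {1..n}"
        have "(\<lambda>j. case (y j (l - 1), y j l) of (s, u) \<Rightarrow> H s u \<omega>) \<longlonglongrightarrow> (case (x (l - 1), x l) of (s, u) \<Rightarrow> H s u \<omega>)"
          using yC l p nx by (intro continuous_on_tendsto_compose[OF cont] tendsto_Pair ylim always_eventually allI in_Delta) (auto simp: C_def)
        then show "(\<lambda>j. H (y j (l - 1)) (y j l) \<omega>) \<longlonglongrightarrow> H (x (l - 1)) (x l) \<omega>" by simp
      qed (use \<theta> in \<open>auto intro!: always_eventually sum_nonneg\<close>)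
      then show "val p \<omega> \<le> (SUP p\<in>C. val p \<omega>)"
        by (rule LIMSEQ_le_const2) (auto intro!: SUP_upper yC)
    qed
  qed
  moreover have "(\<lambda>\<omega>. SUP p\<in>C. val p \<omega>) \<in> borel_measurable M"
  proof (rule borel_measurable_SUP)
    show "countable C" unfolding C_def by (rule countable_subset[of _ "range (rational_partition a b)"]) auto
  qed (auto simp: C_def intro: val_meas)
  ultimately show ?thesis by (simp add: val_def split_def)
qed

lemma level2_dist_measurable:
  assumes ab: "a < b" and \<theta>: "0 < \<theta>"
    and A: "\<And>s u. (s, u) \<in> Delta a b \<Longrightarrow> A s u \<in> borel_measurable M" "\<And>\<omega>. continuous_on (Delta a b) (\<lambda>(s, u). A s u \<omega>)"
    and B: "\<And>s u. (s, u) \<in> Delta a b \<Longrightarrow> B s u \<in> borel_measurable M" "\<And>\<omega>. continuous_on (Delta a b) (\<lambda>(s, u). B s u \<omega>)"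
  shows "(\<lambda>\<omega>. level2_dist \<theta> a b (\<lambda>s u. A s u \<omega>) (\<lambda>s u. B s u \<omega>)) \<in> borel_measurable M"
  unfolding level2_dist_def
proof (rule SUP_partitions_measurable[OF ab \<theta>, of "\<lambda>s u \<omega>. A s u \<omega> - B s u \<omega>"])
  fix s u assume "(s, u) \<in> Delta a b"
  then show "(\<lambda>\<omega>. A s u \<omega> - B s u \<omega>) \<in> borel_measurable M" using A(1) B(1) by measurable
next
  fix \<omega> show "continuous_on (Delta a b) (\<lambda>(s, u). A s u \<omega> - B s u \<omega>)"
    using continuous_on_diff[OF A(2) B(2), of \<omega> \<omega>] by (simp add: split_def)
qed

text \<open>Consider the partition with interior points \<open>s\<close> and \<open>u\<close>.\<close>

lemma level2_dist_upper:
  assumes "(s, u) \<in> Delta a b" and \<theta>: "0 < \<theta>"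
  shows "ennreal (norm (A s u - B s u)) \<le> level2_dist \<theta> a b A B"
proof -
  define x where "x l = (if l = 0 then a else if l = 1 then s else if l = 2 then u else b)" for l :: nat
  have p: "(3, x) \<in> partitions a b"
  proof -
    have "l = 1 \<or> l = 2 \<or> l = 3" if "l \<in> {1..3}" for l :: nat using that by auto
    then show ?thesis using assms unfolding partitions_def Delta_def x_def by fastforce
  qed
  have "norm (A s u - B s u) = (norm (A s u - B s u) powr (\<theta> / 2)) powr (2 / \<theta>)"
    using \<theta> by (simp add: powr_powr)
  also have "\<dots> \<le> (\<Sum>l=1..3. norm (A (x (l - 1)) (x l) - B (x (l - 1)) (x l)) powr (\<theta> / 2)) powr (2 / \<theta>)"
  proof (intro powr_mono2)
    have "norm (A (x (2 - 1)) (x 2) - B (x (2 - 1)) (x 2)) powr (\<theta> / 2)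
      \<le> (\<Sum>l=1..3. norm (A (x (l - 1)) (x l) - B (x (l - 1)) (x l)) powr (\<theta> / 2))"
      by (rule member_le_sum) auto
    then show "norm (A s u - B s u) powr (\<theta> / 2)
      \<le> (\<Sum>l=1..3. norm (A (x (l - 1)) (x l) - B (x (l - 1)) (x l)) powr (\<theta> / 2))" by (simp add: x_def)
  qed (use \<theta> in auto)
  finally have "ennreal (norm (A s u - B s u)) \<le> ennreal ((\<Sum>l=1..3. norm (A (x (l - 1)) (x l) - B (x (l - 1)) (x l)) powr (\<theta> / 2)) powr (2 / \<theta>))"
    by (rule ennreal_leI)
  also have "\<dots> \<le> level2_dist \<theta> a b A B"
    unfolding level2_dist_def using SUP_upper[OF p, of "\<lambda>(n, x). ennreal ((\<Sum>l=1..n. norm (A (x (l - 1)) (x l) - B (x (l - 1)) (x l)) powr (\<theta> / 2)) powr (2 / \<theta>))"] by simp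
  finally show ?thesis .
qed

text \<open>As \<open>r \<theta> \<ge> 1\<close> and the increments of \<open>\<tau>\<close> are at most \<open>1\<close>, their powers of order \<open>r \<theta>\<close> are at most the
  increments themselves, whose sum is \<open>1\<close>.\<close>

lemma level2_dist_le_holder:
  assumes A: "\<And>s u. (s, u) \<in> Delta a b \<Longrightarrow> norm (A s u - B s u) \<le> K * (\<tau> u - \<tau> s) powr (2 * r)"
    and \<tau>: "\<And>s u. (s, u) \<in> Delta a b \<Longrightarrow> \<tau> s \<le> \<tau> u" "\<tau> a = 0" "\<tau> b = 1"
    and \<theta>: "0 < \<theta>" "1 \<le> r * \<theta>" and K: "0 \<le> K"
  shows "level2_dist \<theta> a b A B \<le> ennreal K"
  unfolding level2_dist_def
proof (rule SUP_least, clarsimp)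
  fix n x assume p: "(n, x) \<in> partitions a b"
  note P = partitions_bounds[OF p]
  have each: "norm (A (x (l - 1)) (x l) - B (x (l - 1)) (x l)) powr (\<theta> / 2) \<le> K powr (\<theta> / 2) * (\<tau> (x l) - \<tau> (x (l - 1)))"
    if l: "l \<in> {1..n}" for l
  proof -
    obtain j where j: "l = Suc j" "j < n" using l by (cases l) auto
    have D: "(x (l - 1), x l) \<in> Delta a b" and D1: "(a, x (l - 1)) \<in> Delta a b" and D2: "(x l, b) \<in> Delta a b"
      using P(3)[of j] P(4)[of j] P(4)[of "Suc j"] j by (auto simp: Delta_def)
    define d where "d = \<tau> (x l) - \<tau> (x (l - 1))"
    have d: "0 \<le> d" "d \<le> 1" using \<tau>(1)[OF D] \<tau>(1)[OF D1] \<tau>(1)[OF D2] \<tau>(2,3) by (auto simp: d_def)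
    have "norm (A (x (l - 1)) (x l) - B (x (l - 1)) (x l)) powr (\<theta> / 2) \<le> (K * d powr (2 * r)) powr (\<theta> / 2)"
      using A[OF D] \<theta> by (intro powr_mono2) (auto simp: d_def)
    also have "\<dots> = K powr (\<theta> / 2) * d powr (r * \<theta>)" using K by (simp add: powr_mult powr_powr)
    also have "d powr (r * \<theta>) \<le> d"
    proof (cases "d = 0")
      case False
      then have "d powr (r * \<theta>) \<le> d powr 1" using d \<theta> by (intro powr_mono') auto
      then show ?thesis using d by simp
    qed simp
    finally show ?thesis by (simp add: d_def mult_left_mono)
  qed
  have "(\<Sum>l=1..n. norm (A (x (l - 1)) (x l) - B (x (l - 1)) (x l)) powr (\<theta> / 2)) \<le> (\<Sum>l=1..n. K powr (\<theta> / 2) * (\<tau> (x l) - \<tau> (x (l - 1))))"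
    by (rule sum_mono) (rule each)
  also have "\<dots> = K powr (\<theta> / 2) * (\<Sum>l=1..n. \<tau> (x l) - \<tau> (x (l - 1)))" by (rule sum_distrib_left[symmetric])
  also have "(\<Sum>l=1..n. \<tau> (x l) - \<tau> (x (l - 1))) = \<tau> (x n) - \<tau> (x 0)"
    using sum_telescope''[of 0 n "\<lambda>l. \<tau> (x l)"] by simp
  also have "\<tau> (x n) - \<tau> (x 0) = 1" using P(1,2) \<tau>(2,3) by simp
  finally have "(\<Sum>l=1..n. norm (A (x (l - 1)) (x l) - B (x (l - 1)) (x l)) powr (\<theta> / 2)) powr (2 / \<theta>) \<le> (K powr (\<theta> / 2)) powr (2 / \<theta>)"
    using \<theta> by (intro powr_mono2 sum_nonneg) auto
  also have "\<dots> = K" using \<theta> K by (simp add: powr_powr)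
  finally show "ennreal ((\<Sum>l=Suc 0..n. norm (A (x (l - Suc 0)) (x l) - B (x (l - Suc 0)) (x l)) powr (\<theta> / 2)) powr (2 / \<theta>)) \<le> ennreal K"
    by (simp add: ennreal_leI)
qed

lemma geometric_Cauchy:
  fixes X :: "nat \<Rightarrow> 'b::banach"
  assumes X: "\<And>m. norm (X (Suc m) - X m) \<le> K * z ^ m" and z: "0 \<le> z" "z < 1" and K: "0 \<le> K"
  shows "convergent X" "norm (X m - lim X) \<le> K * z ^ m / (1 - z)"
proof -
  have tail: "norm (X (m + j) - X m) \<le> K * z ^ m / (1 - z)" for m j
  proof -
    have "norm (X (m + j) - X m) \<le> K * z ^ m * (\<Sum>i<j. z ^ i)"
    proof (induction j)
      case (Suc j)
      have "norm (X (m + Suc j) - X m) \<le> norm (X (Suc (m + j)) - X (m + j)) + norm (X (m + j) - X m)"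
        using norm_triangle_ineq[of "X (Suc (m + j)) - X (m + j)" "X (m + j) - X m"] by simp
      also have "\<dots> \<le> K * z ^ (m + j) + K * z ^ m * (\<Sum>i<j. z ^ i)" using Suc X by (intro add_mono) auto
      finally show ?case by (simp add: power_add distrib_left algebra_simps)
    qed simp
    also have "(\<Sum>i<j. z ^ i) \<le> 1 / (1 - z)"
      using z geometric_sum[of z j] by (simp add: field_simps)
    then have "K * z ^ m * (\<Sum>i<j. z ^ i) \<le> K * z ^ m * (1 / (1 - z))" using K z by (intro mult_left_mono) auto
    finally show ?thesis by simp
  qed
  have lim0: "(\<lambda>m. K * z ^ m / (1 - z)) \<longlonglongrightarrow> 0"
    using LIMSEQ_power_zero[of z] z by (auto intro!: tendsto_eq_intros)
  have "Cauchy X"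
  proof (rule metric_CauchyI)
    fix e :: real assume "0 < e"
    then have "\<forall>\<^sub>F m in sequentially. K * z ^ m / (1 - z) < e / 2" using lim0 by (intro order_tendstoD(2)) auto
    then obtain m0 where m0: "K * z ^ m0 / (1 - z) < e / 2" by (auto simp: eventually_sequentially)
    have "dist (X m) (X m0) < e / 2" if "m \<ge> m0" for m
      using order.strict_trans1[OF tail[of m0 "m - m0"] m0] that by (simp add: dist_norm)
    then show "\<exists>M. \<forall>m\<ge>M. \<forall>n\<ge>M. dist (X m) (X n) < e"
      by (intro exI[of _ m0] allI impI) (rule dist_triangle_half_l[of _ "X m0"]; simp)
  qed
  then show c: "convergent X" by (rule Cauchy_convergent)
  then have "(\<lambda>j. X (j + m)) \<longlonglongrightarrow> lim X" by (simp add: convergent_LIMSEQ_iff LIMSEQ_ignore_initial_segment)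
  then have "(\<lambda>j. norm (X (m + j) - X m)) \<longlonglongrightarrow> norm (lim X - X m)" by (intro tendsto_intros) (simp add: add.commute)
  then have "norm (lim X - X m) \<le> K * z ^ m / (1 - z)" by (rule LIMSEQ_le_const2) (use tail in blast)
  then show "norm (X m - lim X) \<le> K * z ^ m / (1 - z)" by (simp add: norm_minus_commute)
qed

section \<open>The random constant\<close>

lemma sum_pairs: "(\<Sum>q<2 * N. h q) = (\<Sum>l<N. h (2 * l) + h (2 * l + 1 :: nat))" for h :: "nat \<Rightarrow> real"
  by (induction N) (auto simp: algebra_simps)

text \<open>The weights of the increments of \<open>f\<close> in \<open>triangle_sum f g\<close>: each increment is paired with the increment
  of \<open>g\<close> over the other half of the same piece.\<close>

definition triangle_weight :: "(real \<Rightarrow> real) \<Rightarrow> nat \<Rightarrow> nat \<Rightarrow> nat \<Rightarrow> real" where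
  "triangle_weight g m i q = (if even q then dyadic_incr g (Suc m) (2 * i + q + 1)
     else - dyadic_incr g (Suc m) (2 * i + q - 1)) / 2"

lemma triangle_sum_increments:
  "triangle_sum f g m i j = (\<Sum>q<2 * (j - i). triangle_weight g m i q * dyadic_incr f (Suc m) (2 * i + q))"
proof -
  have "triangle_sum f g m i j = (\<Sum>l<j - i.
     (dyadic_incr f (Suc m) (2 * (i + l)) * dyadic_incr g (Suc m) (2 * (i + l) + 1)
      - dyadic_incr f (Suc m) (2 * (i + l) + 1) * dyadic_incr g (Suc m) (2 * (i + l))) / 2)"
    unfolding triangle_sum_def
    by (rule sum.reindex_bij_witness[where i = "\<lambda>l. i + l" and j = "\<lambda>l. l - i"]) auto
  also have "\<dots> = (\<Sum>q<2 * (j - i). triangle_weight g m i q * dyadic_incr f (Suc m) (2 * i + q))"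
    unfolding sum_pairs
    by (intro sum.cong refl) (simp add: triangle_weight_def field_simps)
  finally show ?thesis .
qed

lemma triangle_sum_swap: "triangle_sum g f m i j = - triangle_sum f g m i j"
  unfolding triangle_sum_def sum_negf[symmetric] by (intro sum.cong refl) (simp add: field_simps)

lemma triangle_sum_self: "triangle_sum f f m i j = 0"
  unfolding triangle_sum_def by (simp add: mult.commute)

text \<open>The hypotheses of \<open>dyadic_area_diff\<close> on a path \<open>f\<close> with one constant; the square root makes all
  products of two increments of order \<open>K\<close>.\<close>

definition area_controlled :: "(real \<Rightarrow> real) \<Rightarrow> (real \<Rightarrow> real) \<Rightarrow> real \<Rightarrow> real \<Rightarrow> real \<Rightarrow> bool" where
  "area_controlled f g K r \<eta> \<longleftrightarrow> 1 \<le> K \<and> dyadic_holder f (sqrt K) (r + \<eta>) \<and>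
     (\<forall>m n k. n \<le> m \<longrightarrow> k < 2 ^ n \<longrightarrow>
        \<bar>triangle_sum f g m (k * 2 ^ (m - n)) (Suc k * 2 ^ (m - n))\<bar>
          \<le> K * (1 / 2 ^ m) powr \<eta> * (1 / 2 ^ n) powr (2 * r))"

lemma scaled_moment:
  fixes S :: "'a \<Rightarrow> real"
  assumes [measurable]: "S \<in> borel_measurable M" and d: "0 < d" and C: "0 \<le> C" and V: "0 \<le> V" "V \<le> B * d\<^sup>2"
    and S: "(\<integral>\<^sup>+\<omega>. ennreal (S \<omega> ^ (2 * Suc R)) \<partial>M) \<le> ennreal (C * V ^ Suc R)"
  shows "(\<integral>\<^sup>+\<omega>. ennreal ((S \<omega> / d) ^ (2 * Suc R)) \<partial>M) \<le> ennreal (C * B ^ Suc R)"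
proof -
  have d2: "0 < (d\<^sup>2) ^ Suc R" using d by simp
  have dp: "d ^ (2 * Suc R) = (d\<^sup>2) ^ Suc R" by (rule power_mult)
  have "(\<integral>\<^sup>+\<omega>. ennreal ((S \<omega> / d) ^ (2 * Suc R)) \<partial>M) = (\<integral>\<^sup>+\<omega>. ennreal (1 / (d\<^sup>2) ^ Suc R) * ennreal (S \<omega> ^ (2 * Suc R)) \<partial>M)"
    unfolding power_divide dp by (intro nn_integral_cong) (use d2 in \<open>simp add: ennreal_mult'[symmetric] del: power_Suc\<close>)
  also have "\<dots> = ennreal (1 / (d\<^sup>2) ^ Suc R) * (\<integral>\<^sup>+\<omega>. ennreal (S \<omega> ^ (2 * Suc R)) \<partial>M)"
    by (rule nn_integral_cmult) measurable
  also have "\<dots> \<le> ennreal (1 / (d\<^sup>2) ^ Suc R) * ennreal (C * V ^ Suc R)" by (intro mult_left_mono S) simp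
  also have "\<dots> = ennreal (C * V ^ Suc R / (d\<^sup>2) ^ Suc R)" using d2 by (simp add: ennreal_mult'[symmetric] del: power_Suc)
  also have "\<dots> \<le> ennreal (C * B ^ Suc R)"
  proof (rule ennreal_leI)
    have "V ^ Suc R \<le> (B * d\<^sup>2) ^ Suc R" using V by (intro power_mono)
    then have "C * V ^ Suc R \<le> C * (B ^ Suc R * (d\<^sup>2) ^ Suc R)" unfolding power_mult_distrib using C by (rule mult_left_mono)
    then show "C * V ^ Suc R / (d\<^sup>2) ^ Suc R \<le> C * B ^ Suc R" using d2 by (simp add: pos_divide_le_eq mult.assoc del: power_Suc)
  qed
  finally show ?thesis .
qed

lemma le_max_one_power:
  fixes v :: real
  assumes "v ^ (2 * Suc R) \<le> c" "1 \<le> c"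
  shows "v\<^sup>2 \<le> c" "\<bar>v\<bar> \<le> c"
proof -
  have "v\<^sup>2 \<le> c \<and> \<bar>v\<bar> \<le> c"
  proof (cases "\<bar>v\<bar> \<le> 1")
    case True
    then have "v\<^sup>2 \<le> 1" by (simp add: abs_square_le_1)
    then show ?thesis using True assms by linarith
  next
    case False
    then have v: "1 \<le> \<bar>v\<bar>" by simp
    have e: "v ^ (2 * Suc R) = \<bar>v\<bar> ^ (2 * Suc R)" by (simp add: power_even_abs)
    have "\<bar>v\<bar> ^ 1 \<le> \<bar>v\<bar> ^ (2 * Suc R)" "\<bar>v\<bar> ^ 2 \<le> \<bar>v\<bar> ^ (2 * Suc R)"
      using v by (intro power_increasing; simp)+
    then show ?thesis using assms(1) unfolding e by simp
  qed
  then show "v\<^sup>2 \<le> c" "\<bar>v\<bar> \<le> c" by auto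
qed

lemma powr_power_half:
  fixes e :: real
  assumes "real j \<le> e * real (Suc R)"
  shows "((1 / 2 ^ m) powr e) ^ Suc R \<le> (1 / 2 ^ j) ^ m"
proof -
  have "((1 / 2 ^ m) powr e) ^ Suc R = (1 / 2 ^ m) powr (e * real (Suc R))"
    by (subst powr_realpow[symmetric]) (auto simp: powr_powr simp del: power_Suc of_nat_Suc)
  also have "\<dots> \<le> (1 / 2 ^ m) powr real j" using assms by (intro powr_half_mono)
  also have "\<dots> = (1 / 2 ^ j) ^ m" by (simp add: powr_realpow power_divide power_mult[symmetric] mult.commute)
  finally show ?thesis .
qed

lemma suminf_geometric_less_top:
  assumes "0 \<le> C" "0 \<le> z" "z < 1"
  shows "(\<Sum>n. ennreal (C * z ^ n)) < \<infinity>"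
proof -
  have "summable (\<lambda>n. C * z ^ n)" using assms by (intro summable_mult summable_geometric) auto
  then have "(\<Sum>n. ennreal (C * z ^ n)) = ennreal (\<Sum>n. C * z ^ n)"
    using assms by (intro suminf_ennreal2) auto
  then show ?thesis by simp
qed

text \<open>\<open>\<Lambda>\<close> is the sum of high powers of all increments and triangle sums, each divided by its asserted
  bound. With \<open>\<kappa> = r + 2 \<eta>\<close>, the true order of a triangle sum is \<open>2 powr ((m - n)/2 - 2 m \<kappa>)\<close>; as
  \<open>4 r \<ge> 1\<close>, this is smaller than the asserted order \<open>2 powr (- m \<eta> - 2 n r)\<close> by the factor
  \<open>2 powr (- 3 m \<eta>)\<close>. A power of order at least \<open>2/\<eta>\<close> of this factor outweighs the number of dyadic
  intervals.\<close>

lemma local_time_dyadic_control: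
  fixes X :: "real \<Rightarrow> 'a \<Rightarrow> real" and L :: "real \<Rightarrow> real \<Rightarrow> 'a \<Rightarrow> real" and g x :: "real \<Rightarrow> real"
  assumes M: "prob_space M" and stable: "symmetric_stable_process M \<alpha> X"
    and L: "jointly_continuous_local_time M X L" and \<alpha>: "1 < \<alpha>" "\<alpha> < 2" and t: "0 \<le> t"
    and x: "\<And>n k. k < 2 ^ n \<Longrightarrow> x (real k / 2 ^ n) \<le> x (real (Suc k) / 2 ^ n)"
      "\<And>n k. k < 2 ^ n \<Longrightarrow> x (real (Suc k) / 2 ^ n) - x (real k / 2 ^ n) \<le> W / 2 ^ n" and W: "0 \<le> W"
    and g: "dyadic_holder g c (r + 2 * \<eta>)" and c: "0 \<le> c"
    and r: "1 / 4 \<le> r" and \<eta>: "0 < \<eta>" and r\<alpha>: "2 * r + 4 * \<eta> \<le> \<alpha> - 1"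
  shows "\<exists>\<Lambda>::'a \<Rightarrow> ennreal. \<Lambda> \<in> borel_measurable M \<and> (\<integral>\<^sup>+\<omega>. \<Lambda> \<omega> \<partial>M) < \<infinity> \<and>
    (\<forall>\<omega>. \<Lambda> \<omega> < \<infinity> \<longrightarrow> area_controlled (\<lambda>s. L t (x s) \<omega>) g (enn2real (\<Lambda> \<omega>)) r \<eta>)"
proof -
  interpret prob_space M by (rule M)
  have Lm [measurable]: "L t y \<in> borel_measurable M" for y
    using L t by (simp add: jointly_continuous_local_time_def)
  define \<beta> where "\<beta> = \<alpha> - 1"
  have \<beta>: "0 < \<beta>" "2 * r + 4 * \<eta> \<le> \<beta>" using \<alpha> r\<alpha> by (auto simp: \<beta>_def)
  obtain R :: nat where "1 / \<eta> \<le> real R" using real_arch_simple by blast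
  then have "1 \<le> \<eta> * real R" using \<eta> by (simp add: field_simps)
  then have R: "1 \<le> \<eta> * real (Suc R)" using \<eta> by (simp add: algebra_simps)
  obtain C where C: "0 \<le> C" and mom: "\<And>k c x b. (\<forall>l<k. x l \<le> x (Suc l)) \<Longrightarrow> (\<forall>l<k. \<bar>c l\<bar> \<le> b) \<Longrightarrow>
    (\<integral>\<^sup>+\<omega>. ennreal ((\<Sum>l<k. c l * (L t (x (Suc l)) \<omega> - L t (x l) \<omega>)) ^ (2 * Suc R)) \<partial>M)
      \<le> ennreal (C * (b\<^sup>2 * (\<Sum>l<k. (x (Suc l) - x l) powr \<beta>)) ^ Suc R)"
    using local_time_moment[OF M stable L \<alpha> t, of R] unfolding \<beta>_def[symmetric] by blast
  define f where "f \<omega> s = L t (x s) \<omega>" for \<omega> s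
  have step: "(x (real (Suc k) / 2 ^ n) - x (real k / 2 ^ n)) powr \<beta> \<le> W powr \<beta> * (1 / 2 ^ n) powr (2 * r + 4 * \<eta>)"
    if "k < 2 ^ n" for k n
  proof -
    have "(x (real (Suc k) / 2 ^ n) - x (real k / 2 ^ n)) powr \<beta> \<le> (W * (1 / 2 ^ n)) powr \<beta>"
      using x[OF that] \<beta> by (intro powr_mono2) auto
    also have "\<dots> = W powr \<beta> * (1 / 2 ^ n) powr \<beta>" using W by (subst powr_mult) auto
    also have "\<dots> \<le> W powr \<beta> * (1 / 2 ^ n) powr (2 * r + 4 * \<eta>)" using \<beta> by (intro mult_left_mono powr_half_mono) auto
    finally show ?thesis .
  qed
  define dU where "dU n = (1 / 2 ^ n :: real) powr (r + \<eta>)" for n :: nat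
  define U where "U n k \<omega> = dyadic_incr (f \<omega>) n k / dU n" for n k \<omega>
  define dV where "dV m n = (1 / 2 ^ m :: real) powr \<eta> * (1 / 2 ^ n) powr (2 * r)" for m n :: nat
  define T where "T m n k \<omega> = triangle_sum (f \<omega>) g m (k * 2 ^ (m - n)) (Suc k * 2 ^ (m - n))" for m n k \<omega>
  define V where "V m n k \<omega> = T m n k \<omega> / dV m n" for m n k \<omega>
  have d: "0 < dU n" "0 < dV m n" for m n by (auto simp: dU_def dV_def)
  have incr_meas [measurable]: "(\<lambda>\<omega>. dyadic_incr (f \<omega>) n k) \<in> borel_measurable M" for n k
    unfolding dyadic_incr_def f_def by measurable
  have T_meas [measurable]: "(\<lambda>\<omega>. T m n k \<omega>) \<in> borel_measurable M" for m n k
    unfolding T_def triangle_sum_def by measurable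
  have U_meas [measurable]: "(\<lambda>\<omega>. U n k \<omega>) \<in> borel_measurable M" for n k
    unfolding U_def by measurable
  have V_meas [measurable]: "(\<lambda>\<omega>. V m n k \<omega>) \<in> borel_measurable M" for m n k
    unfolding V_def by measurable
  let ?p = "2 * Suc R"
  define C1 where "C1 = C * (W powr \<beta>) ^ Suc R"
  have C1: "0 \<le> C1" unfolding C1_def using C by (intro mult_nonneg_nonneg zero_le_power) auto
  have EU: "(\<integral>\<^sup>+\<omega>. ennreal (U n k \<omega> ^ ?p) \<partial>M) \<le> ennreal (C1 * (1 / 4) ^ n)" if k: "k < 2 ^ n" for n k
  proof -
    let ?x = "\<lambda>l. x (real (k + l) / 2 ^ n)"
    have "(\<integral>\<^sup>+\<omega>. ennreal (dyadic_incr (f \<omega>) n k ^ ?p) \<partial>M) \<le> ennreal (C * ((x (real (Suc k) / 2 ^ n) - x (real k / 2 ^ n)) powr \<beta>) ^ Suc R)"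
      using mom[of 1 ?x "\<lambda>_. 1" 1] x(1)[OF k] by (simp add: dyadic_incr_def f_def)
    moreover have "(x (real (Suc k) / 2 ^ n) - x (real k / 2 ^ n)) powr \<beta> \<le> (W powr \<beta> * (1 / 2 ^ n) powr (2 * \<eta>)) * (dU n)\<^sup>2"
    proof -
      have "(1 / 2 ^ n) powr (2 * \<eta>) * (dU n)\<^sup>2 = (1 / 2 ^ n) powr (2 * r + 4 * \<eta>)"
        unfolding dU_def power2_eq_square powr_add[symmetric] by (simp add: algebra_simps)
      then show ?thesis using step[OF k] by (simp add: mult.assoc)
    qed
    ultimately have "(\<integral>\<^sup>+\<omega>. ennreal (U n k \<omega> ^ ?p) \<partial>M) \<le> ennreal (C * (W powr \<beta> * (1 / 2 ^ n) powr (2 * \<eta>)) ^ Suc R)"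
      unfolding U_def using C d by (intro scaled_moment) auto
    also have "\<dots> \<le> ennreal (C1 * (1 / 4) ^ n)"
    proof (rule ennreal_leI)
      have "((1 / 2 ^ n) powr (2 * \<eta>)) ^ Suc R \<le> (1 / 2 ^ 2) ^ n" using R by (intro powr_power_half) simp
      then have "C1 * ((1 / 2 ^ n) powr (2 * \<eta>)) ^ Suc R \<le> C1 * (1 / 2 ^ 2) ^ n" using C1 by (rule mult_left_mono)
      then show "C * (W powr \<beta> * (1 / 2 ^ n) powr (2 * \<eta>)) ^ Suc R \<le> C1 * (1 / 4) ^ n"
        unfolding C1_def power_mult_distrib by (simp add: mult.assoc)
    qed
    finally show ?thesis .
  qed
  define B where "B = 2 * c\<^sup>2 * W powr \<beta>"
  define C2 where "C2 = C * B ^ Suc R"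
  have B: "0 \<le> B" by (simp add: B_def)
  have C2: "0 \<le> C2" unfolding C2_def using C B by (intro mult_nonneg_nonneg zero_le_power) auto
  have EV: "(\<integral>\<^sup>+\<omega>. ennreal (V m n k \<omega> ^ ?p) \<partial>M) \<le> ennreal (C2 * (1 / 64) ^ m)" if nm: "n \<le> m" and k: "k < 2 ^ n" for m n k
  proof -
    define Y y :: real where "Y = 1 / 2 ^ m" and "y = 1 / 2 ^ n"
    have Y: "0 < Y" "Y \<le> y" "y \<le> 1" "0 < y" using nm by (auto simp: Y_def y_def field_simps power_increasing)
    define N :: nat where "N = 2 ^ (m - n)"
    define i where "i = k * N"
    define b where "b = c * Y powr (r + 2 * \<eta>)"
    have iN: "i + N \<le> 2 ^ m"
    proof -
      have "Suc k * N \<le> 2 ^ n * N" using k by (intro mult_le_mono1) auto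
      then show ?thesis using nm by (simp add: i_def N_def power_add[symmetric])
    qed
    let ?x = "\<lambda>q. x (real (2 * i + q) / 2 ^ Suc m)"
    have small: "(1 / 2 ^ Suc m) powr e \<le> Y powr e" if "0 \<le> e" for e :: real
      unfolding Y_def using that by (intro powr_mono2) (auto simp: field_simps)
    have in_range: "2 * i + q < 2 ^ Suc m" if "q < 2 * N" for q using that iN by simp
    have wt: "\<bar>triangle_weight g m i q\<bar> \<le> b" if q: "q < 2 * N" for q
    proof -
      have inc: "\<bar>dyadic_incr g (Suc m) l\<bar> \<le> b" if "l < 2 ^ Suc m" for l
      proof -
        have "\<bar>dyadic_incr g (Suc m) l\<bar> \<le> c * (1 / 2 ^ Suc m) powr (r + 2 * \<eta>)"
          using g that unfolding dyadic_holder_def by blast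
        also have "\<dots> \<le> b" unfolding b_def using c r \<eta> by (intro mult_left_mono small) auto
        finally show ?thesis .
      qed
      show ?thesis
      proof (cases "even q")
        case True
        then have "q + 1 < 2 * N" using q by presburger
        then have "2 * i + q + 1 < 2 ^ Suc m" using in_range[of "q + 1"] by simp
        from inc[OF this] show ?thesis using True by (simp add: triangle_weight_def)
      next
        case False
        have "2 * i + q - 1 < 2 ^ Suc m" using in_range[OF q] by simp
        from inc[OF this] show ?thesis using False by (simp add: triangle_weight_def)
      qed
    qed
    have T_eq: "T m n k \<omega> = (\<Sum>q<2 * N. triangle_weight g m i q * (L t (?x (Suc q)) \<omega> - L t (?x q) \<omega>))" for \<omega>
    proof -
      have "Suc k * N - k * N = N" by simp
      then show ?thesis unfolding T_def N_def[symmetric] triangle_sum_increments i_def[symmetric]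
        by (simp add: i_def dyadic_incr_def f_def)
    qed
    have "(\<integral>\<^sup>+\<omega>. ennreal (T m n k \<omega> ^ ?p) \<partial>M) \<le> ennreal (C * (b\<^sup>2 * (\<Sum>q<2 * N. (?x (Suc q) - ?x q) powr \<beta>)) ^ Suc R)"
      unfolding T_eq
    proof (rule mom)
      show "\<forall>q<2 * N. ?x q \<le> ?x (Suc q)" using x(1)[OF in_range] by simp
      show "\<forall>q<2 * N. \<bar>triangle_weight g m i q\<bar> \<le> b" using wt by blast
    qed
    moreover have "b\<^sup>2 * (\<Sum>q<2 * N. (?x (Suc q) - ?x q) powr \<beta>) \<le> (B * Y powr (6 * \<eta>)) * (dV m n)\<^sup>2"
    proof -
      have "(\<Sum>q<2 * N. (?x (Suc q) - ?x q) powr \<beta>) \<le> (\<Sum>q<2 * N. W powr \<beta> * Y powr (2 * r + 4 * \<eta>))"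
      proof (rule sum_mono)
        fix q assume "q \<in> {..<2 * N}"
        then have "(?x (Suc q) - ?x q) powr \<beta> \<le> W powr \<beta> * (1 / 2 ^ Suc m) powr (2 * r + 4 * \<eta>)"
          using step[OF in_range[of q]] by simp
        also have "\<dots> \<le> W powr \<beta> * Y powr (2 * r + 4 * \<eta>)" using r \<eta> by (intro mult_left_mono small) auto
        finally show "(?x (Suc q) - ?x q) powr \<beta> \<le> W powr \<beta> * Y powr (2 * r + 4 * \<eta>)" .
      qed
      also have "\<dots> = 2 * real N * (W powr \<beta> * Y powr (2 * r + 4 * \<eta>))" by simp
      finally have s1: "b\<^sup>2 * (\<Sum>q<2 * N. (?x (Suc q) - ?x q) powr \<beta>) \<le> b\<^sup>2 * (2 * real N * (W powr \<beta> * Y powr (2 * r + 4 * \<eta>)))"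
        by (rule mult_left_mono) simp
      have s2: "b\<^sup>2 = c\<^sup>2 * Y powr (2 * r + 4 * \<eta>)"
        unfolding b_def power_mult_distrib power2_eq_square[of "Y powr _"] powr_add[symmetric] by (simp add: algebra_simps)
      have s3: "b\<^sup>2 * (2 * real N * (W powr \<beta> * Y powr (2 * r + 4 * \<eta>)))
         = B * (Y powr (2 * r + 4 * \<eta>) * Y powr (2 * r + 4 * \<eta>) * real N)" unfolding s2 by (simp add: B_def mult_ac)
      have "Y powr (2 * r + 4 * \<eta>) * Y powr (2 * r + 4 * \<eta>) * real N \<le> Y powr (6 * \<eta>) * (dV m n)\<^sup>2"
      proof -
        have "real N = 2 ^ (m - n)" by (simp add: N_def)
        also have "\<dots> = 2 ^ m / 2 ^ n" using nm by (simp add: power_diff)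
        finally have N: "real N = y / Y" by (simp add: y_def Y_def)
        have "Y powr (2 * r + 4 * \<eta>) * Y powr (2 * r + 4 * \<eta>) = Y powr (8 * \<eta>) * (Y powr (4 * r - 1) * Y powr 1)"
          unfolding powr_add[symmetric] by (simp add: algebra_simps)
        then have "Y powr (2 * r + 4 * \<eta>) * Y powr (2 * r + 4 * \<eta>) * real N = Y powr (8 * \<eta>) * (Y powr (4 * r - 1) * y)"
          unfolding N using Y by simp
        also have "\<dots> \<le> Y powr (8 * \<eta>) * (y powr (4 * r - 1) * y)"
          using Y r by (intro mult_left_mono mult_right_mono powr_mono2) auto
        also have "y powr (4 * r - 1) * y = y powr (4 * r - 1) * y powr 1" using Y by simp
        also have "\<dots> = y powr (2 * r) * y powr (2 * r)" unfolding powr_add[symmetric] by simp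
        also have "Y powr (8 * \<eta>) = Y powr (6 * \<eta>) * (Y powr \<eta> * Y powr \<eta>)" unfolding powr_add[symmetric] by simp
        finally show ?thesis unfolding dV_def Y_def[symmetric] y_def[symmetric] by (simp add: power2_eq_square mult_ac)
      qed
      then have "B * (Y powr (2 * r + 4 * \<eta>) * Y powr (2 * r + 4 * \<eta>) * real N) \<le> B * (Y powr (6 * \<eta>) * (dV m n)\<^sup>2)"
        using B by (rule mult_left_mono)
      with s1 show ?thesis unfolding s3 by (simp only: mult.assoc)
    qed
    moreover have "0 \<le> b\<^sup>2 * (\<Sum>q<2 * N. (?x (Suc q) - ?x q) powr \<beta>)" by (intro mult_nonneg_nonneg sum_nonneg) auto
    ultimately have "(\<integral>\<^sup>+\<omega>. ennreal (V m n k \<omega> ^ ?p) \<partial>M) \<le> ennreal (C * (B * Y powr (6 * \<eta>)) ^ Suc R)"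
      unfolding V_def using C d by (intro scaled_moment) auto
    also have "\<dots> \<le> ennreal (C2 * (1 / 64) ^ m)"
    proof (rule ennreal_leI)
      have "(Y powr (6 * \<eta>)) ^ Suc R \<le> (1 / 2 ^ 6) ^ m" unfolding Y_def using R by (intro powr_power_half) simp
      then have "C2 * (Y powr (6 * \<eta>)) ^ Suc R \<le> C2 * (1 / 2 ^ 6) ^ m" using C2 by (rule mult_left_mono)
      then show "C * (B * Y powr (6 * \<eta>)) ^ Suc R \<le> C2 * (1 / 64) ^ m"
        unfolding C2_def power_mult_distrib by (simp add: mult.assoc)
    qed
    finally show ?thesis .
  qed
  define SU where "SU \<omega> = (\<Sum>n. \<Sum>k<2 ^ n. ennreal (U n k \<omega> ^ ?p))" for \<omega>
  define SV where "SV \<omega> = (\<Sum>m. \<Sum>n\<le>m. \<Sum>k<2 ^ n. ennreal (V m n k \<omega> ^ ?p))" for \<omega>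
  define \<Lambda> where "\<Lambda> \<omega> = 1 + SU \<omega> + SV \<omega>" for \<omega>
  have SU_meas [measurable]: "SU \<in> borel_measurable M" unfolding SU_def[abs_def] by measurable
  have SV_meas [measurable]: "SV \<in> borel_measurable M" unfolding SV_def[abs_def] by measurable
  have "(\<integral>\<^sup>+\<omega>. SU \<omega> \<partial>M) = (\<Sum>n. \<Sum>k<2 ^ n. \<integral>\<^sup>+\<omega>. ennreal (U n k \<omega> ^ ?p) \<partial>M)"
    unfolding SU_def by (subst nn_integral_suminf) (auto simp: nn_integral_sum)
  also have "\<dots> \<le> (\<Sum>n. ennreal (C1 * (1 / 2) ^ n))"
  proof (intro suminf_le)
    fix n
    have "(\<Sum>k<2 ^ n. \<integral>\<^sup>+\<omega>. ennreal (U n k \<omega> ^ ?p) \<partial>M) \<le> (\<Sum>k<(2::nat) ^ n. ennreal (C1 * (1 / 4) ^ n))"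
      by (intro sum_mono EU) auto
    also have "\<dots> = ennreal (2 ^ n * (C1 * (1 / 4) ^ n))"
      using C1 by (simp add: ennreal_mult ennreal_power[symmetric])
    also have "2 ^ n * (C1 * (1 / 4) ^ n) = C1 * (2 * (1 / 4)) ^ n"
      by (simp only: power_mult_distrib mult_ac)
    also have "C1 * (2 * (1 / 4)) ^ n = C1 * (1 / 2) ^ n" by simp
    finally show "(\<Sum>k<2 ^ n. \<integral>\<^sup>+\<omega>. ennreal (U n k \<omega> ^ ?p) \<partial>M) \<le> ennreal (C1 * (1 / 2) ^ n)" .
  qed auto
  also have "\<dots> < \<infinity>" using C1 by (intro suminf_geometric_less_top) auto
  finally have ESU: "(\<integral>\<^sup>+\<omega>. SU \<omega> \<partial>M) < \<infinity>" .
  have "(\<integral>\<^sup>+\<omega>. SV \<omega> \<partial>M) = (\<Sum>m. \<Sum>n\<le>m. \<Sum>k<2 ^ n. \<integral>\<^sup>+\<omega>. ennreal (V m n k \<omega> ^ ?p) \<partial>M)"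
    unfolding SV_def by (subst nn_integral_suminf) (auto simp: nn_integral_sum)
  also have "\<dots> \<le> (\<Sum>m. ennreal (C2 * (1 / 16) ^ m))"
  proof (intro suminf_le)
    fix m
    have "(\<Sum>n\<le>m. \<Sum>k<2 ^ n. \<integral>\<^sup>+\<omega>. ennreal (V m n k \<omega> ^ ?p) \<partial>M) \<le> (\<Sum>n\<le>m. \<Sum>k<(2::nat) ^ m. ennreal (C2 * (1 / 64) ^ m))"
    proof (rule sum_mono)
      fix n assume n: "n \<in> {..m}"
      have "(\<Sum>k<2 ^ n. \<integral>\<^sup>+\<omega>. ennreal (V m n k \<omega> ^ ?p) \<partial>M) \<le> (\<Sum>k<(2::nat) ^ n. ennreal (C2 * (1 / 64) ^ m))"
        using n by (intro sum_mono EV) auto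
      also have "\<dots> \<le> (\<Sum>k<(2::nat) ^ m. ennreal (C2 * (1 / 64) ^ m))"
        using n by (intro sum_mono2) (auto intro: less_le_trans power_increasing)
      finally show "(\<Sum>k<2 ^ n. \<integral>\<^sup>+\<omega>. ennreal (V m n k \<omega> ^ ?p) \<partial>M) \<le> (\<Sum>k<(2::nat) ^ m. ennreal (C2 * (1 / 64) ^ m))" .
    qed
    also have "\<dots> = ennreal (real (Suc m) * (2 ^ m * (C2 * (1 / 64) ^ m)))"
      using C2 by (simp add: ennreal_mult ennreal_power[symmetric] ennreal_of_nat_eq_real_of_nat del: ennreal_plus)
    also have "\<dots> \<le> ennreal (C2 * (1 / 16) ^ m)"
    proof (rule ennreal_leI)
      have "Suc m \<le> 2 ^ m" by (simp add: Suc_leI)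
      then have "real (Suc m) \<le> 2 ^ m" by (metis of_nat_mono of_nat_numeral of_nat_power)
      then have "real (Suc m) * (2 ^ m * (C2 * (1 / 64) ^ m)) \<le> 2 ^ m * (2 ^ m * (C2 * (1 / 64) ^ m))"
        using C2 by (intro mult_right_mono) auto
      also have "\<dots> = C2 * (2 * 2 * (1 / 64)) ^ m" by (simp only: power_mult_distrib mult_ac)
      finally show "real (Suc m) * (2 ^ m * (C2 * (1 / 64) ^ m)) \<le> C2 * (1 / 16) ^ m" by simp
    qed
    finally show "(\<Sum>n\<le>m. \<Sum>k<2 ^ n. \<integral>\<^sup>+\<omega>. ennreal (V m n k \<omega> ^ ?p) \<partial>M) \<le> ennreal (C2 * (1 / 16) ^ m)" .
  qed auto
  also have "\<dots> < \<infinity>" using C2 by (intro suminf_geometric_less_top) auto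
  finally have ESV: "(\<integral>\<^sup>+\<omega>. SV \<omega> \<partial>M) < \<infinity>" .
  show ?thesis
    unfolding area_controlled_def
  proof (intro exI[of _ \<Lambda>] conjI allI impI)
    show "\<Lambda> \<in> borel_measurable M" unfolding \<Lambda>_def[abs_def] by measurable
    have "(\<integral>\<^sup>+\<omega>. \<Lambda> \<omega> \<partial>M) = 1 + (\<integral>\<^sup>+\<omega>. SU \<omega> \<partial>M) + (\<integral>\<^sup>+\<omega>. SV \<omega> \<partial>M)"
      unfolding \<Lambda>_def by (simp add: nn_integral_add emeasure_space_1)
    then show "(\<integral>\<^sup>+\<omega>. \<Lambda> \<omega> \<partial>M) < \<infinity>" using ESU ESV by (simp add: ennreal_add_less_top)
    fix \<omega> assume fin: "\<Lambda> \<omega> < \<infinity>"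
    define K where "K = enn2real (\<Lambda> \<omega>)"
    have K: "\<Lambda> \<omega> = ennreal K" "0 \<le> K" using fin by (auto simp: K_def)
    have "ennreal 1 \<le> ennreal K" unfolding K(1)[symmetric] \<Lambda>_def by (simp add: add.assoc)
    then show K1: "1 \<le> enn2real (\<Lambda> \<omega>)" using K(2) unfolding K_def[symmetric] by (simp only: ennreal_le_iff)
    have toL: "a \<le> K" if "ennreal a \<le> SU \<omega> + SV \<omega>" "0 \<le> a" for a
    proof -
      have "ennreal a \<le> ennreal K" unfolding K(1)[symmetric] \<Lambda>_def add.assoc by (rule add_increasing[OF _ that(1)]) simp
      then show ?thesis using K(2) by simp
    qed
    have even_nn: "0 \<le> a ^ ?p" for a :: real by (intro zero_le_even_power) simp
    have Ule: "U n k \<omega> ^ ?p \<le> K" if "k < 2 ^ n" for n k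
    proof (rule toL[OF _ even_nn])
      have "ennreal (U n k \<omega> ^ ?p) \<le> (\<Sum>k<2 ^ n. ennreal (U n k \<omega> ^ ?p))"
        by (rule member_le_sum[of k "{..<2 ^ n}" "\<lambda>k. ennreal (U n k \<omega> ^ ?p)"]) (use that in auto)
      also have "\<dots> \<le> SU \<omega>"
        unfolding SU_def using sum_le_suminf[of "\<lambda>n. \<Sum>k<2 ^ n. ennreal (U n k \<omega> ^ ?p)" "{n}"] by simp
      also have "\<dots> \<le> SU \<omega> + SV \<omega>" by simp
      finally show "ennreal (U n k \<omega> ^ ?p) \<le> SU \<omega> + SV \<omega>" .
    qed
    have Vle: "V m n k \<omega> ^ ?p \<le> K" if "n \<le> m" "k < 2 ^ n" for m n k
    proof (rule toL[OF _ even_nn])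
      have "ennreal (V m n k \<omega> ^ ?p) \<le> (\<Sum>k<2 ^ n. ennreal (V m n k \<omega> ^ ?p))"
        by (rule member_le_sum[of k "{..<2 ^ n}" "\<lambda>k. ennreal (V m n k \<omega> ^ ?p)"]) (use that in auto)
      also have "\<dots> \<le> (\<Sum>n\<le>m. \<Sum>k<2 ^ n. ennreal (V m n k \<omega> ^ ?p))"
        by (rule member_le_sum[of n "{..m}" "\<lambda>n. \<Sum>k<2 ^ n. ennreal (V m n k \<omega> ^ ?p)"]) (use that in auto)
      also have "\<dots> \<le> SV \<omega>"
        unfolding SV_def using sum_le_suminf[of "\<lambda>m. \<Sum>n\<le>m. \<Sum>k<2 ^ n. ennreal (V m n k \<omega> ^ ?p)" "{m}"] by simp
      also have "\<dots> \<le> SU \<omega> + SV \<omega>" by simp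
      finally show "ennreal (V m n k \<omega> ^ ?p) \<le> SU \<omega> + SV \<omega>" .
    qed
    note K1' = K1[folded K_def]
    show "dyadic_holder (\<lambda>s. L t (x s) \<omega>) (sqrt (enn2real (\<Lambda> \<omega>))) (r + \<eta>)"
      unfolding dyadic_holder_def K_def[symmetric]
    proof (intro allI impI)
      fix n k assume k: "k < (2::nat) ^ n"
      have "(U n k \<omega>)\<^sup>2 \<le> K" by (rule le_max_one_power(1)[OF Ule[OF k] K1'])
      then have "\<bar>U n k \<omega>\<bar> \<le> sqrt K" by (rule real_le_rsqrt[of "\<bar>U n k \<omega>\<bar>", simplified])
      then show "\<bar>dyadic_incr (\<lambda>s. L t (x s) \<omega>) n k\<bar> \<le> sqrt K * (1 / 2 ^ n) powr (r + \<eta>)"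
        using d(1)[of n] unfolding U_def f_def dU_def[symmetric] by (simp add: pos_divide_le_eq)
    qed
    fix m n k assume nm: "n \<le> m" and k: "k < (2::nat) ^ n"
    have "\<bar>V m n k \<omega>\<bar> \<le> K" by (rule le_max_one_power(2)[OF Vle[OF nm k] K1'])
    then have "\<bar>T m n k \<omega>\<bar> \<le> K * dV m n" using d(2)[of m n] unfolding V_def by (simp add: pos_divide_le_eq)
    then show "\<bar>triangle_sum (\<lambda>s. L t (x s) \<omega>) g m (k * 2 ^ (m - n)) (Suc k * 2 ^ (m - n))\<bar>
            \<le> enn2real (\<Lambda> \<omega>) * (1 / 2 ^ m) powr \<eta> * (1 / 2 ^ n) powr (2 * r)"
      unfolding T_def f_def dV_def K_def by (simp only: mult.assoc)
  qed
qed

section \<open>Convergence of the second level\<close>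

definition matrix_of :: "(2 \<Rightarrow> 2 \<Rightarrow> real) \<Rightarrow> real^2^2" where
  "matrix_of e = (\<chi> i j. e i j)"

lemma matrix_of_sum: "matrix_of e = (\<Sum>i\<in>UNIV. \<Sum>j\<in>UNIV. e i j *\<^sub>R axis i (axis j 1))"
  unfolding matrix_of_def vec_eq_iff UNIV_2 by (simp add: forall_2 axis_def)

lemma norm_matrix_le:
  assumes "\<And>i j. \<bar>A $ i $ j\<bar> \<le> c"
  shows "norm (A :: real^2^2) \<le> 4 * c"
proof -
  have "norm A \<le> (\<Sum>i\<in>UNIV. norm (A $ i))"
    unfolding norm_vec_def by (rule L2_set_le_sum) simp
  also have "\<dots> \<le> (\<Sum>i\<in>(UNIV :: 2 set). \<Sum>j\<in>UNIV. \<bar>A $ i $ j\<bar>)"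
    by (rule sum_mono) (rule norm_le_l1_cart)
  also have "\<dots> \<le> (\<Sum>i\<in>(UNIV :: 2 set). \<Sum>j\<in>(UNIV :: 2 set). c)" by (intro sum_mono assms)
  also have "\<dots> = 4 * c" by simp
  finally show ?thesis .
qed

lemma dyadic_area_measurable:
  assumes "\<And>l. (\<lambda>\<omega>. f \<omega> (real l / 2 ^ m)) \<in> borel_measurable M" "\<And>l. (\<lambda>\<omega>. g \<omega> (real l / 2 ^ m)) \<in> borel_measurable M"
  shows "(\<lambda>\<omega>. dyadic_area m (f \<omega>) (g \<omega>) a b) \<in> borel_measurable M"
proof -
  note [measurable] = assms
  show ?thesis unfolding dyadic_area_def lin_area_def lin_primitive_def lin_def by measurable
qed

theorem theorem3p8:
  fixes M :: "'a measure"
    and X :: "real \<Rightarrow> 'a \<Rightarrow> real"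
    and L :: "real \<Rightarrow> real \<Rightarrow> 'a \<Rightarrow> real"
    and g :: "real \<Rightarrow> real"
    and w w1 :: "real \<Rightarrow> real \<Rightarrow> real"
    and pt :: "nat \<Rightarrow> nat \<Rightarrow> real"
    and Z :: "real \<Rightarrow> 'a \<Rightarrow> real^2"
    and Zm2 :: "nat \<Rightarrow> real \<Rightarrow> real \<Rightarrow> 'a \<Rightarrow> real^2^2"
    and \<alpha> q p h t xl xr :: real
  assumes "prob_space M"
    and "5 / 3 < \<alpha>" "\<alpha> < 2"
    and "2 / (3 - \<alpha>) \<le> q" "q < 3"
    and "2 / (\<alpha> - 1) < p" "p < 3"
    and "h = 1 / max p q"
    and "0 \<le> t"
    and "xl < xr"
    and "symmetric_stable_process M \<alpha> X"
    and "jointly_continuous_local_time M X L"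
    and "continuous_on {xl..xr} g"
    and "bounded_q_variation q g xl xr"
    and "control xl xr w"
    and "\<And>a b. (a, b) \<in> Delta xl xr \<Longrightarrow> \<bar>g b - g a\<bar> powr q \<le> w a b"
    and "w1 = (\<lambda>a b. w a b + (b - a))"
    and "\<And>m. pt m 0 = xl \<and> pt m (2 ^ m) = xr"
    and "\<And>m l. l \<in> {1..2 ^ m} \<Longrightarrow> pt m (l - 1) < pt m l \<and>
           w1 xl (pt m l) - w1 xl (pt m (l - 1)) = w1 xl xr / 2 ^ m"
    and "Z = (\<lambda>x \<omega>. vector [L t x \<omega>, g x])"
    and "Zm2 = (\<lambda>m a b \<omega>. level2 (interpolate (w1 xl) (pt m) (\<lambda>x. Z x \<omega>)) a b)"
  shows "\<exists>Z2.
    (\<exists>\<theta>. max p q < \<theta> \<and> 4 / (2 * h + \<alpha> - 1) < \<theta> \<and> \<theta> < 3 \<and>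
       level2_converges M \<theta> xl xr Zm2 Z2) \<and>
    (\<forall>W \<theta>. max p q < \<theta> \<and> 4 / (2 * h + \<alpha> - 1) < \<theta> \<and> \<theta> < 3 \<and>
       level2_converges M \<theta> xl xr Zm2 W \<longrightarrow>
       (AE \<omega> in M. \<forall>(a, b)\<in>Delta xl xr. W a b \<omega> = Z2 a b \<omega>))"
proof -
  note M = assms(1) and \<alpha> = assms(2,3) and q = assms(4,5) and p = assms(6,7) and h = assms(8)
    and t = assms(9) and lr = assms(10) and stable = assms(11) and L = assms(12)
    and ctl = assms(15) and gw = assms(16) and w1 = assms(17) and ptb = assms(18) and ptl = assms(19)
    and Z = assms(20) and Zm2 = assms(21)
  interpret prob_space M by (rule M)
  have q0: "0 < q" using q(1) \<alpha> by (intro less_le_trans[OF _ q(1)]) auto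
  have Lm [measurable]: "L t y \<in> borel_measurable M" for y
    using L t by (simp add: jointly_continuous_local_time_def)

  define v where "v = w1 xl"
  define W where "W = v xr"
  note ctl' = ctl[unfolded control_def]
  have w_nn: "0 \<le> w a b" if "xl \<le> a" "a \<le> b" "b \<le> xr" for a b
    using ctl'[THEN conjunct2, THEN conjunct1] that by (auto simp: Delta_def)
  have w_0: "w xl xl = 0" using ctl'[THEN conjunct2, THEN conjunct2, THEN conjunct1] lr by auto
  have v_incr: "w a b + (b - a) \<le> v b - v a" if "xl \<le> a" "a \<le> b" "b \<le> xr" for a b
  proof -
    have "w xl a + w a b \<le> w xl b"
      using ctl'[THEN conjunct2, THEN conjunct2, THEN conjunct2, THEN spec, THEN spec, THEN spec, THEN mp, of xl a b] that by simp
    then show ?thesis by (simp add: v_def w1)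
  qed
  have v_mono: "v a \<le> v b" if "xl \<le> a" "a \<le> b" "b \<le> xr" for a b
    using v_incr[OF that] w_nn[OF that] that by linarith
  have v_inj: "inj_on v {xl..xr}"
  proof (rule linorder_inj_onI)
    fix a b assume ab: "a < b" "a \<in> {xl..xr}" "b \<in> {xl..xr}"
    then show "v a \<noteq> v b" using v_incr[of a b] w_nn[of a b] by simp
  qed auto
  have v_xl: "v xl = 0" using w_0 by (simp add: v_def w1)
  have W: "0 < W" using v_incr[of xl xr] w_nn[of xl xr] v_xl lr by (simp add: W_def)
  have v_cont: "continuous_on {xl..xr} v"
  proof -
    have "continuous_on {xl..xr} (\<lambda>x. (\<lambda>(a, b). w a b) (xl, x))"
      by (rule continuous_on_compose2[OF ctl'[THEN conjunct1]]) (auto simp: Delta_def intro!: continuous_intros)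
    then show ?thesis unfolding v_def w1 by (auto intro!: continuous_intros)
  qed
  \<comment> \<open>The inverse of the time change; \<open>x (l / 2 ^ m)\<close> is the node \<open>pt m l\<close>.\<close>
  define x where "x s = inv_into {xl..xr} v (W * s)" for s
  have pt_step: "pt m l < pt m (Suc l)" "v (pt m (Suc l)) - v (pt m l) = W / 2 ^ m" if "l < 2 ^ m" for m l
    using ptl[of "Suc l" m] that by (auto simp: v_def W_def)
  have pt_bounds: "xl \<le> pt m l \<and> pt m l \<le> xr" if "l \<le> 2 ^ m" for m l
    using mono_upto[of "2 ^ m" "pt m" 0 l] mono_upto[of "2 ^ m" "pt m" l "2 ^ m"] pt_step(1)[of _ m] ptb[of m] that
    by (auto simp: less_imp_le)
  have v_pt: "v (pt m l) = W * (real l / 2 ^ m)" if "l \<le> 2 ^ m" for m l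
    using that
  proof (induction l)
    case 0 then show ?case using ptb[of m] v_xl by simp
  next
    case (Suc l)
    then have "v (pt m (Suc l)) = W * (real l / 2 ^ m) + W / 2 ^ m" using pt_step(2)[of l m] by simp
    then show ?case by (simp add: field_simps)
  qed
  have x_node: "x (real l / 2 ^ m) = pt m l" if "l \<le> 2 ^ m" for m l
    unfolding x_def v_pt[OF that, symmetric] using pt_bounds[OF that] v_inj by (intro inv_into_f_f) auto
  have x_step: "x (real k / 2 ^ n) \<le> x (real (Suc k) / 2 ^ n)" "x (real (Suc k) / 2 ^ n) - x (real k / 2 ^ n) \<le> W / 2 ^ n"
    if k: "k < 2 ^ n" for n k
  proof -
    have e: "x (real k / 2 ^ n) = pt n k" "x (real (Suc k) / 2 ^ n) = pt n (Suc k)"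
      using x_node[of k n] x_node[of "Suc k" n] k by (auto simp del: of_nat_Suc)
    show "x (real k / 2 ^ n) \<le> x (real (Suc k) / 2 ^ n)" "x (real (Suc k) / 2 ^ n) - x (real k / 2 ^ n) \<le> W / 2 ^ n"
      unfolding e using pt_step[OF k] v_incr[of "pt n k" "pt n (Suc k)"] w_nn[of "pt n k" "pt n (Suc k)"]
        pt_bounds[of k n] pt_bounds[of "Suc k" n] k by auto
  qed

  \<comment> \<open>Half of the gap between \<open>\<kappa>\<close> and \<open>1/3\<close> is spent on the decay in \<open>m\<close> and on the summability of moments, the other half
    keeps \<open>r\<close> above \<open>1/3\<close>.\<close>
  define \<kappa> where "\<kappa> = min (1 / q) ((\<alpha> - 1) / 2)"
  have \<kappa>: "1 / 3 < \<kappa>" "\<kappa> \<le> 1 / q" "2 * \<kappa> \<le> \<alpha> - 1"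
    using q q0 \<alpha> unfolding \<kappa>_def by (auto simp: field_simps min_def)
  define \<eta> where "\<eta> = (\<kappa> - 1 / 3) / 4"
  define r where "r = \<kappa> - 2 * \<eta>"
  have \<eta>: "0 < \<eta>" using \<kappa> by (simp add: \<eta>_def)
  have r: "1 / 3 < r" "r + 2 * \<eta> = \<kappa>" using \<kappa> by (auto simp: r_def \<eta>_def field_simps)
  have r1: "r \<le> 1" using r(2) \<eta> \<kappa>(3) \<alpha> by linarith
  have hpq: "0 < max p q" "max p q < 3" using q0 q p by auto
  have h3: "1 / 3 < h" unfolding h using hpq by (simp add: field_simps)
  have th3: "4 / (2 * h + \<alpha> - 1) < 3"
  proof -
    have "4 < 3 * (2 * h + \<alpha> - 1)" using h3 \<alpha> by simp
    moreover have "0 < 2 * h + \<alpha> - 1" using h3 \<alpha> by simp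
    ultimately show ?thesis by (simp add: pos_divide_less_eq)
  qed
  have "1 / r < 3" using r by (simp add: field_simps)
  define \<theta> where "\<theta> = (max (max p q) (max (4 / (2 * h + \<alpha> - 1)) (1 / r)) + 3) / 2"
  have \<theta>: "max p q < \<theta>" "4 / (2 * h + \<alpha> - 1) < \<theta>" "\<theta> < 3" "1 / r < \<theta>"
    using hpq th3 \<open>1 / r < 3\<close> unfolding \<theta>_def by (auto simp: max_def)
  have \<theta>0: "0 < \<theta>" "1 \<le> r * \<theta>" using \<theta>(1,4) hpq r by (auto simp: field_simps)

  define G where "G s = g (x s)" for s
  define c where "c = W powr (1 / q)"
  have c0: "0 \<le> c" by (simp add: c_def)
  have G: "dyadic_holder G c (r + 2 * \<eta>)"
    unfolding dyadic_holder_def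
  proof (intro allI impI)
    fix n k assume k: "k < (2::nat) ^ n"
    have e: "dyadic_incr G n k = g (pt n (Suc k)) - g (pt n k)"
      using x_node[of k n] x_node[of "Suc k" n] k by (simp add: dyadic_incr_def G_def del: of_nat_Suc)
    have o: "xl \<le> pt n k" "pt n k \<le> pt n (Suc k)" "pt n (Suc k) \<le> xr"
      using pt_step(1)[OF k] pt_bounds[of k n] pt_bounds[of "Suc k" n] k by auto
    have "\<bar>dyadic_incr G n k\<bar> powr q \<le> w (pt n k) (pt n (Suc k))"
      unfolding e using o by (intro gw) (auto simp: Delta_def)
    also have "\<dots> \<le> W / 2 ^ n" using v_incr[OF o] pt_step(2)[OF k] o by linarith
    finally have "(\<bar>dyadic_incr G n k\<bar> powr q) powr (1 / q) \<le> (W * (1 / 2 ^ n)) powr (1 / q)"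
      using q0 by (intro powr_mono2) auto
    moreover have "(\<bar>dyadic_incr G n k\<bar> powr q) powr (1 / q) = \<bar>dyadic_incr G n k\<bar>"
      using q0 by (simp add: powr_powr)
    moreover have "(W * (1 / 2 ^ n)) powr (1 / q) = c * (1 / 2 ^ n) powr (1 / q)"
      unfolding c_def using W by (subst powr_mult) auto
    ultimately have "\<bar>dyadic_incr G n k\<bar> \<le> c * (1 / 2 ^ n) powr (1 / q)" by (simp only:)
    also have "\<dots> \<le> c * (1 / 2 ^ n) powr (r + 2 * \<eta>)" unfolding r(2) using c0 \<kappa>(2) by (intro mult_left_mono powr_half_mono)
    finally show "\<bar>dyadic_incr G n k\<bar> \<le> c * (1 / 2 ^ n) powr (r + 2 * \<eta>)" .
  qed
  define f where "f \<omega> s = L t (x s) \<omega>" for \<omega> s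
  have "\<exists>\<Lambda>::'a \<Rightarrow> ennreal. \<Lambda> \<in> borel_measurable M \<and> (\<integral>\<^sup>+\<omega>. \<Lambda> \<omega> \<partial>M) < \<infinity> \<and>
    (\<forall>\<omega>. \<Lambda> \<omega> < \<infinity> \<longrightarrow> area_controlled (\<lambda>s. L t (x s) \<omega>) G (enn2real (\<Lambda> \<omega>)) r \<eta>)"
    by (rule local_time_dyadic_control[OF M stable L _ \<alpha>(2) t _ _ less_imp_le[OF W] G c0 _ \<eta>])
      (use \<alpha> r \<kappa> x_step in auto)
  then obtain \<Lambda> :: "'a \<Rightarrow> ennreal" where \<Lambda>_meas [measurable]: "\<Lambda> \<in> borel_measurable M" and \<Lambda>_int: "(\<integral>\<^sup>+\<omega>. \<Lambda> \<omega> \<partial>M) < \<infinity>"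
    and \<Lambda>: "\<forall>\<omega>. \<Lambda> \<omega> < \<infinity> \<longrightarrow> area_controlled (\<lambda>s. L t (x s) \<omega>) G (enn2real (\<Lambda> \<omega>)) r \<eta>"
    by (elim exE conjE)

  define F where "F \<omega> i = (if i = (1::2) then f \<omega> else G)" for \<omega> i
  define \<tau> where "\<tau> s = v s / W" for s
  have \<tau>: "\<tau> xl = 0" "\<tau> xr = 1" using v_xl W by (auto simp: \<tau>_def W_def)
  have \<tau>_mono: "\<tau> a \<le> \<tau> b" "0 \<le> \<tau> a" "\<tau> b \<le> 1" if "(a, b) \<in> Delta xl xr" for a b
    using v_mono[of a b] v_mono[of xl a] v_mono[of b xr] that W v_xl
    unfolding \<tau>_def Delta_def W_def[symmetric] by (auto simp: divide_right_mono)
  have Z_entry: "Zm2 m a b \<omega> $ i $ j = dyadic_area m (F \<omega> i) (F \<omega> j) (\<tau> a) (\<tau> b)"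
    if ab: "(a, b) \<in> Delta xl xr" for m a b \<omega> i j
    unfolding Zm2 v_def[symmetric] \<tau>_def
  proof (rule level2_interpolate)
    show "Z (pt m l) \<omega> $ i = F \<omega> i (real l / 2 ^ m)" if "l \<le> 2 ^ m" for i l
      using exhaust_2[of i] unfolding Z F_def f_def G_def by (auto simp: vector_2 x_node[OF that])
  qed (use W v_xl ptb[of m] v_pt v_mono v_cont pt_bounds ab in \<open>auto simp: W_def Delta_def\<close>)
  have Z_sum: "Zm2 m a b \<omega> = (\<Sum>i\<in>UNIV. \<Sum>j\<in>UNIV. dyadic_area m (F \<omega> i) (F \<omega> j) (\<tau> a) (\<tau> b) *\<^sub>R axis i (axis j 1))"
    if "(a, b) \<in> Delta xl xr" for m a b \<omega>
  proof -
    have "Zm2 m a b \<omega> = matrix_of (\<lambda>i j. dyadic_area m (F \<omega> i) (F \<omega> j) (\<tau> a) (\<tau> b))"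
      by (simp add: matrix_of_def vec_eq_iff Z_entry[OF that])
    then show ?thesis unfolding matrix_of_sum .
  qed
  have Z_meas: "Zm2 m a b \<in> borel_measurable M" if ab: "(a, b) \<in> Delta xl xr" for m a b
  proof -
    have "(\<lambda>\<omega>. F \<omega> i s) \<in> borel_measurable M" for i s
      unfolding F_def f_def by (cases "i = 1") auto
    then have [measurable]: "(\<lambda>\<omega>. dyadic_area m (F \<omega> i) (F \<omega> j) (\<tau> a) (\<tau> b)) \<in> borel_measurable M" for i j
      by (intro dyadic_area_measurable)
    have "(\<lambda>\<omega>. \<Sum>i\<in>UNIV. \<Sum>j\<in>UNIV. dyadic_area m (F \<omega> i) (F \<omega> j) (\<tau> a) (\<tau> b) *\<^sub>R (axis i (axis j 1) :: real^2^2)) \<in> borel_measurable M"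
      by measurable
    then show ?thesis by (subst measurable_cong[OF Z_sum[OF ab]])
  qed
  have Z_cont: "continuous_on (Delta xl xr) (\<lambda>(a, b). Zm2 m a b \<omega>)" for m \<omega>
  proof -
    have "continuous_on (Delta xl xr) (\<lambda>z. v (fst z))" "continuous_on (Delta xl xr) (\<lambda>z. v (snd z))"
      by (rule continuous_on_compose2[OF v_cont]; auto simp: Delta_def intro!: continuous_intros)+
    then have \<tau>c: "continuous_on (Delta xl xr) (\<lambda>z. (\<tau> (fst z), \<tau> (snd z)))"
      unfolding \<tau>_def using W by (intro continuous_intros) auto
    have "continuous_on (Delta xl xr) (\<lambda>z. dyadic_area m (F \<omega> i) (F \<omega> j) (\<tau> (fst z)) (\<tau> (snd z)))" for i j
      using continuous_on_compose2[OF continuous_on_dyadic_area[of UNIV m "F \<omega> i" "F \<omega> j"] \<tau>c] by simp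
    then have "continuous_on (Delta xl xr) (\<lambda>z. \<Sum>i\<in>UNIV. \<Sum>j\<in>UNIV. dyadic_area m (F \<omega> i) (F \<omega> j) (\<tau> (fst z)) (\<tau> (snd z)) *\<^sub>R (axis i (axis j 1) :: real^2^2))"
      by (intro continuous_on_sum continuous_on_scaleR continuous_on_const)
    then show ?thesis by (rule continuous_on_eq) (auto simp: Z_sum)
  qed

  define z where "z = (1 / 2 :: real) powr \<eta>"
  have "z = 2 powr - \<eta>" by (simp add: z_def powr_divide powr_minus_divide)
  then have z: "0 < z" "z < 1" using \<eta> by (auto simp: powr_less_one)
  have zm: "(1 / 2 ^ m) powr \<eta> = z ^ m" for m
  proof -
    have "z ^ m = (1 / 2) powr (\<eta> * real m)" unfolding z_def by (simp add: powr_power mult.commute)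
    also have "\<dots> = ((1 / 2) powr real m) powr \<eta>" by (simp add: powr_powr mult.commute)
    also have "(1 / 2 :: real) powr real m = 1 / 2 ^ m" by (simp add: powr_realpow power_divide)
    finally show ?thesis ..
  qed
  define K0 where "K0 = chain_const (2 * r) * (4 * (chain_const r)\<^sup>2 * (1 + c)\<^sup>2 + 1)"
  have K0: "0 \<le> K0" unfolding K0_def using chain_const_ge1[of "2 * r"] r c0 by (intro mult_nonneg_nonneg) auto
  have diff: "norm (Zm2 (Suc m) a b \<omega> - Zm2 m a b \<omega>) \<le> (4 * K0 * enn2real (\<Lambda> \<omega>) * (\<tau> b - \<tau> a) powr (2 * r)) * z ^ m"
    if fin: "\<Lambda> \<omega> < \<infinity>" and ab: "(a, b) \<in> Delta xl xr" for m a b \<omega>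
  proof -
    define K where "K = enn2real (\<Lambda> \<omega>)"
    have K1: "1 \<le> K" and hf: "dyadic_holder (f \<omega>) (sqrt K) (r + \<eta>)"
      and tri: "\<And>m n k. n \<le> m \<Longrightarrow> k < 2 ^ n \<Longrightarrow> \<bar>triangle_sum (f \<omega>) G m (k * 2 ^ (m - n)) (Suc k * 2 ^ (m - n))\<bar>
            \<le> K * (1 / 2 ^ m) powr \<eta> * (1 / 2 ^ n) powr (2 * r)"
      using \<Lambda>[THEN spec, THEN mp, OF fin] unfolding area_controlled_def K_def f_def[abs_def] by auto
    define cc where "cc i = (if i = (1::2) then sqrt K else c)" for i
    have cc: "0 \<le> cc i" "cc i \<le> (1 + c) * sqrt K" for i
    proof -
      have s: "1 \<le> sqrt K" using K1 by simp
      have "c * 1 \<le> c * sqrt K" using s c0 by (rule mult_left_mono)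
      then have "c \<le> (1 + c) * sqrt K" "sqrt K \<le> (1 + c) * sqrt K"
        using s c0 unfolding distrib_right by linarith+
      then show "0 \<le> cc i" "cc i \<le> (1 + c) * sqrt K" using K1 c0 unfolding cc_def by (auto split: if_splits)
    qed
    have hF: "dyadic_holder (F \<omega> i) (cc i) (r + \<eta>)" for i
    proof (cases "i = 1")
      case False
      have "dyadic_holder G c (r + \<eta>)"
        unfolding dyadic_holder_def
      proof (intro allI impI)
        fix n k assume "k < (2::nat) ^ n"
        then have "\<bar>dyadic_incr G n k\<bar> \<le> c * (1 / 2 ^ n) powr (r + 2 * \<eta>)" using G by (simp add: dyadic_holder_def)
        also have "\<dots> \<le> c * (1 / 2 ^ n) powr (r + \<eta>)" using c0 \<eta> by (intro mult_left_mono powr_half_mono) auto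
        finally show "\<bar>dyadic_incr G n k\<bar> \<le> c * (1 / 2 ^ n) powr (r + \<eta>)" .
      qed
      then show ?thesis using False by (simp add: F_def cc_def)
    qed (simp add: F_def cc_def hf)
    have triF: "\<bar>triangle_sum (F \<omega> i) (F \<omega> j) m (k * 2 ^ (m - n)) (Suc k * 2 ^ (m - n))\<bar> \<le> K * (1 / 2 ^ m) powr \<eta> * (1 / 2 ^ n) powr (2 * r)"
      if "n \<le> m" "k < 2 ^ n" for i j n k
      using tri[OF that] K1 triangle_sum_swap[of G "f \<omega>" m "k * 2 ^ (m - n)" "Suc k * 2 ^ (m - n)"]
      unfolding F_def by (cases "i = 1"; cases "j = 1") (auto simp: triangle_sum_self simp del: mult_Suc)
    have entry: "\<bar>(Zm2 (Suc m) a b \<omega> - Zm2 m a b \<omega>) $ i $ j\<bar> \<le> K0 * K * z ^ m * (\<tau> b - \<tau> a) powr (2 * r)" for i j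
    proof -
      have "\<bar>(Zm2 (Suc m) a b \<omega> - Zm2 m a b \<omega>) $ i $ j\<bar> = \<bar>dyadic_area (Suc m) (F \<omega> i) (F \<omega> j) (\<tau> a) (\<tau> b) - dyadic_area m (F \<omega> i) (F \<omega> j) (\<tau> a) (\<tau> b)\<bar>"
        by (simp add: Z_entry[OF ab])
      also have "\<dots> \<le> chain_const (2 * r) * (4 * (chain_const r)\<^sup>2 * cc i * cc j + K) * (1 / 2 ^ m) powr \<eta> * (\<tau> b - \<tau> a) powr (2 * r)"
        by (rule dyadic_area_diff[OF hF hF _ r1]) (use r \<eta> cc K1 triF \<tau>_mono[OF ab] in auto)
      also have "\<dots> \<le> K0 * K * z ^ m * (\<tau> b - \<tau> a) powr (2 * r)"
        unfolding zm
      proof (intro mult_right_mono)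
        have "cc i * cc j \<le> ((1 + c) * sqrt K) * ((1 + c) * sqrt K)" using cc c0 K1 by (intro mult_mono) auto
        also have "\<dots> = (1 + c)\<^sup>2 * K" using K1 by (simp add: power2_eq_square)
        finally have "4 * (chain_const r)\<^sup>2 * (cc i * cc j) \<le> 4 * (chain_const r)\<^sup>2 * ((1 + c)\<^sup>2 * K)" by (intro mult_left_mono) auto
        then have "4 * (chain_const r)\<^sup>2 * cc i * cc j + K \<le> (4 * (chain_const r)\<^sup>2 * (1 + c)\<^sup>2 + 1) * K"
          by (simp add: distrib_right mult.assoc)
        then have "chain_const (2 * r) * (4 * (chain_const r)\<^sup>2 * cc i * cc j + K) \<le> chain_const (2 * r) * ((4 * (chain_const r)\<^sup>2 * (1 + c)\<^sup>2 + 1) * K)"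
          using chain_const_ge1[of "2 * r"] r by (intro mult_left_mono) auto
        then show "chain_const (2 * r) * (4 * (chain_const r)\<^sup>2 * cc i * cc j + K) \<le> K0 * K" by (simp add: K0_def mult.assoc)
      qed (use z in auto)
      finally show ?thesis .
    qed
    from norm_matrix_le[OF entry] show ?thesis unfolding K_def by (simp add: mult_ac)
  qed
  \<comment> \<open>The default value makes \<open>Z2\<close> continuous for every \<open>\<omega>\<close>, which the measurability of the distance needs
    as the probability space may be incomplete.\<close>
  define Z2 where "Z2 a b \<omega> = (if \<Lambda> \<omega> < \<infinity> then lim (\<lambda>m. Zm2 m a b \<omega>) else 0)" for a b \<omega>
  define K1 where "K1 = 4 * K0 / (1 - z)"
  have K1: "0 \<le> K1" using K0 z by (simp add: K1_def)
  have close: "norm (Zm2 m a b \<omega> - Z2 a b \<omega>) \<le> (K1 * enn2real (\<Lambda> \<omega>) * z ^ m) * (\<tau> b - \<tau> a) powr (2 * r)"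
    if fin: "\<Lambda> \<omega> < \<infinity>" and ab: "(a, b) \<in> Delta xl xr" for m a b \<omega>
  proof -
    have "norm (Zm2 m a b \<omega> - lim (\<lambda>m. Zm2 m a b \<omega>)) \<le> (4 * K0 * enn2real (\<Lambda> \<omega>) * (\<tau> b - \<tau> a) powr (2 * r)) * z ^ m / (1 - z)"
      using K0 z by (intro geometric_Cauchy(2) diff[OF fin ab]) auto
    then show ?thesis using fin by (simp add: Z2_def K1_def mult_ac)
  qed
  have Z2_meas: "Z2 a b \<in> borel_measurable M" if ab: "(a, b) \<in> Delta xl xr" for a b
  proof -
    have [measurable]: "(\<lambda>\<omega>. lim (\<lambda>m. Zm2 m a b \<omega>)) \<in> borel_measurable M"
      by (rule borel_measurable_lim_metric) (rule Z_meas[OF ab])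
    show ?thesis unfolding Z2_def[abs_def] by measurable
  qed
  have Z2_cont: "continuous_on (Delta xl xr) (\<lambda>(a, b). Z2 a b \<omega>)" for \<omega>
  proof (cases "\<Lambda> \<omega> < \<infinity>")
    case True
    have "uniform_limit (Delta xl xr) (\<lambda>m (a, b). Zm2 m a b \<omega>) (\<lambda>(a, b). Z2 a b \<omega>) sequentially"
    proof (rule uniform_limitI)
      fix e :: real assume e: "0 < e"
      have "(\<lambda>m. K1 * enn2real (\<Lambda> \<omega>) * z ^ m) \<longlonglongrightarrow> K1 * enn2real (\<Lambda> \<omega>) * 0"
        using z by (intro tendsto_intros LIMSEQ_power_zero) auto
      then have "\<forall>\<^sub>F m in sequentially. K1 * enn2real (\<Lambda> \<omega>) * z ^ m < e" using e by (intro order_tendstoD(2)) auto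
      then show "\<forall>\<^sub>F m in sequentially. \<forall>y\<in>Delta xl xr. dist (case y of (a, b) \<Rightarrow> Zm2 m a b \<omega>) (case y of (a, b) \<Rightarrow> Z2 a b \<omega>) < e"
      proof eventually_elim
        case (elim m)
        show ?case
        proof safe
          fix a b assume ab: "(a, b) \<in> Delta xl xr"
          have "(\<tau> b - \<tau> a) powr (2 * r) \<le> 1 powr (2 * r)" using \<tau>_mono[OF ab] r by (intro powr_mono2) auto
          then have "(K1 * enn2real (\<Lambda> \<omega>) * z ^ m) * (\<tau> b - \<tau> a) powr (2 * r) \<le> (K1 * enn2real (\<Lambda> \<omega>) * z ^ m) * 1"
            using K1 z by (intro mult_left_mono) auto
          then show "dist (Zm2 m a b \<omega>) (Z2 a b \<omega>) < e" using close[OF True ab, of m] elim unfolding dist_norm by linarith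
        qed
      qed
    qed
    then show ?thesis by (rule uniform_limit_theorem[rotated]) (auto intro!: always_eventually Z_cont)
  next
    case False
    then show ?thesis by (simp add: Z2_def split_def)
  qed
  define D where "D m \<omega> = level2_dist \<theta> xl xr (\<lambda>a b. Zm2 m a b \<omega>) (\<lambda>a b. Z2 a b \<omega>)" for m \<omega>
  have dist_le: "D m \<omega> \<le> ennreal (K1 * enn2real (\<Lambda> \<omega>) * z ^ m)"
    if fin: "\<Lambda> \<omega> < \<infinity>" for m \<omega>
    unfolding D_def by (rule level2_dist_le_holder[where \<tau> = \<tau> and r = r, OF close[OF fin] \<tau>_mono(1) \<tau> \<theta>0]) (use K1 z in auto)
  have AE_fin: "AE \<omega> in M. \<Lambda> \<omega> < \<infinity>"
    using nn_integral_PInf_AE[OF \<Lambda>_meas] \<Lambda>_int by (auto simp: less_top)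
  have conv: "level2_converges M \<theta> xl xr Zm2 Z2"
    unfolding level2_converges_def Let_def D_def[symmetric]
  proof (intro conjI)
    show "\<forall>(a, b)\<in>Delta xl xr. Z2 a b \<in> borel_measurable M" using Z2_meas by auto
    show "\<forall>m. D m \<in> borel_measurable M"
      unfolding D_def[abs_def] by (intro allI level2_dist_measurable lr \<theta>0 Z_meas Z_cont Z2_meas Z2_cont)
    show "AE \<omega> in M. (\<lambda>m. D m \<omega>) \<longlonglongrightarrow> 0"
      using AE_fin
    proof eventually_elim
      case (elim \<omega>)
      have "(\<lambda>m. ennreal (K1 * enn2real (\<Lambda> \<omega>) * z ^ m)) \<longlonglongrightarrow> ennreal (K1 * enn2real (\<Lambda> \<omega>) * 0)"
        using z by (intro tendsto_intros tendsto_ennrealI LIMSEQ_power_zero) auto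
      then have "(\<lambda>m. ennreal (K1 * enn2real (\<Lambda> \<omega>) * z ^ m)) \<longlonglongrightarrow> 0" by simp
      then show ?case
        by (rule tendsto_sandwich[OF always_eventually[OF allI[OF zero_le]] always_eventually[OF allI[OF dist_le[OF elim]]] tendsto_const])
    qed
    have bound: "(\<integral>\<^sup>+\<omega>. D m \<omega> \<partial>M) \<le> ennreal (K1 * z ^ m) * (\<integral>\<^sup>+\<omega>. \<Lambda> \<omega> \<partial>M)" for m
    proof -
      have "(\<integral>\<^sup>+\<omega>. D m \<omega> \<partial>M) \<le> (\<integral>\<^sup>+\<omega>. ennreal (K1 * z ^ m) * \<Lambda> \<omega> \<partial>M)"
      proof (rule nn_integral_mono_AE, use AE_fin in eventually_elim)
        fix \<omega> assume fin: "\<Lambda> \<omega> < \<infinity>"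
        have "ennreal (K1 * enn2real (\<Lambda> \<omega>) * z ^ m) = ennreal (K1 * z ^ m) * ennreal (enn2real (\<Lambda> \<omega>))"
          using K1 z by (simp add: ennreal_mult[symmetric] mult_ac)
        also have "ennreal (enn2real (\<Lambda> \<omega>)) = \<Lambda> \<omega>" using fin by simp
        finally show "D m \<omega> \<le> ennreal (K1 * z ^ m) * \<Lambda> \<omega>"
          using dist_le[OF fin, of m] by simp
      qed
      also have "\<dots> = ennreal (K1 * z ^ m) * (\<integral>\<^sup>+\<omega>. \<Lambda> \<omega> \<partial>M)" by (rule nn_integral_cmult) measurable
      finally show ?thesis .
    qed
    have "(\<lambda>m. ennreal (K1 * z ^ m) * (\<integral>\<^sup>+\<omega>. \<Lambda> \<omega> \<partial>M)) \<longlonglongrightarrow> 0"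
    proof -
      have "(\<lambda>m. K1 * z ^ m * enn2real (\<integral>\<^sup>+\<omega>. \<Lambda> \<omega> \<partial>M)) \<longlonglongrightarrow> K1 * 0 * enn2real (\<integral>\<^sup>+\<omega>. \<Lambda> \<omega> \<partial>M)"
        using z by (intro tendsto_intros LIMSEQ_power_zero) auto
      then have "(\<lambda>m. ennreal (K1 * z ^ m * enn2real (\<integral>\<^sup>+\<omega>. \<Lambda> \<omega> \<partial>M))) \<longlonglongrightarrow> ennreal 0"
        by (intro tendsto_ennrealI) simp
      moreover have "ennreal (K1 * z ^ m * enn2real (\<integral>\<^sup>+\<omega>. \<Lambda> \<omega> \<partial>M)) = ennreal (K1 * z ^ m) * (\<integral>\<^sup>+\<omega>. \<Lambda> \<omega> \<partial>M)" for m
        using K1 z \<Lambda>_int by (simp add: ennreal_mult)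
      ultimately show ?thesis by simp
    qed
    then show "(\<lambda>m. \<integral>\<^sup>+\<omega>. D m \<omega> \<partial>M) \<longlonglongrightarrow> 0"
      by (rule tendsto_sandwich[OF always_eventually[OF allI[OF zero_le]] always_eventually[OF allI[OF bound]] tendsto_const])
  qed

  \<comment> \<open>Convergence in the distance, of whatever order, determines the limit pointwise.\<close>
  have pointwise: "AE \<omega> in M. \<forall>(a, b)\<in>Delta xl xr. (\<lambda>m. Zm2 m a b \<omega>) \<longlonglongrightarrow> V a b \<omega>"
    if V: "level2_converges M \<theta>' xl xr Zm2 V" and \<theta>': "0 < \<theta>'" for V \<theta>'
  proof -
    have "AE \<omega> in M. (\<lambda>m. level2_dist \<theta>' xl xr (\<lambda>a b. Zm2 m a b \<omega>) (\<lambda>a b. V a b \<omega>)) \<longlonglongrightarrow> 0"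
      using V unfolding level2_converges_def Let_def by blast
    then show ?thesis
    proof eventually_elim
      case (elim \<omega>)
      show ?case
      proof safe
        fix a b assume ab: "(a, b) \<in> Delta xl xr"
        have "(\<lambda>m. ennreal (norm (Zm2 m a b \<omega> - V a b \<omega>))) \<longlonglongrightarrow> 0"
          by (rule tendsto_sandwich[OF always_eventually[OF allI[OF zero_le]]
                always_eventually[OF allI[OF level2_dist_upper[OF ab \<theta>']]] tendsto_const elim])
        then have "(\<lambda>m. norm (Zm2 m a b \<omega> - V a b \<omega>)) \<longlonglongrightarrow> 0"
          using tendsto_ennreal_iff[of "\<lambda>m. norm (Zm2 m a b \<omega> - V a b \<omega>)" sequentially 0] by simp
        then have "(\<lambda>m. Zm2 m a b \<omega> - V a b \<omega>) \<longlonglongrightarrow> 0" by (rule tendsto_norm_zero_cancel)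
        then show "(\<lambda>m. Zm2 m a b \<omega>) \<longlonglongrightarrow> V a b \<omega>" by (rule LIM_zero_cancel)
      qed
    qed
  qed
  show ?thesis
  proof (intro exI[of _ Z2] conjI allI impI)
    show "\<exists>\<theta>. max p q < \<theta> \<and> 4 / (2 * h + \<alpha> - 1) < \<theta> \<and> \<theta> < 3 \<and> level2_converges M \<theta> xl xr Zm2 Z2"
      using \<theta> conv by blast
    fix V \<theta>' assume V: "max p q < \<theta>' \<and> 4 / (2 * h + \<alpha> - 1) < \<theta>' \<and> \<theta>' < 3 \<and> level2_converges M \<theta>' xl xr Zm2 V"
    then have "0 < \<theta>'" using hpq by linarith
    with V have "AE \<omega> in M. \<forall>(a, b)\<in>Delta xl xr. (\<lambda>m. Zm2 m a b \<omega>) \<longlonglongrightarrow> V a b \<omega>" by (intro pointwise) auto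
    then show "AE \<omega> in M. \<forall>(a, b)\<in>Delta xl xr. V a b \<omega> = Z2 a b \<omega>"
      using pointwise[OF conv \<theta>0(1)]
    proof eventually_elim
      case (elim \<omega>)
      show ?case
      proof safe
        fix a b assume "(a, b) \<in> Delta xl xr"
        then show "V a b \<omega> = Z2 a b \<omega>" using elim by (intro LIMSEQ_unique[of "\<lambda>m. Zm2 m a b \<omega>"]) auto
      qed
    qed
  qed
qed

end
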